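(* Suppose Assumption 1 holds and $\mathcal M$ is a nested candidate set with sizes $k_1<\dots<k_{M_n}$. If $$k_{M_n}\mathbb E(\hat\sigma^2-\sigma^2)^2=o[nR_n(\mathbf w^*|\mathcal M,\mathbf f)]\quad\text{and}\quad\psi(\mathcal M)=o[nR_n(\mathbf w^*|\mathcal M,\mathbf f)],$$ then $Q_n(\hat{\mathbf w}|\mathcal M,\mathbf f)\le[1+o(1)]R_n(\mathbf w^*|\mathcal M,\mathbf f)$ as $n\to\infty$. In particular, let $\hat\sigma^2=\hat\sigma^2_{m_n}=\|\mathbf y-\mathbf P_{m_n}\mathbf y\|^2/(n-m_n)$ with $m_n=\lfloor\kappa n\rfloor\wedge p_n$ for a constant $0<\kappa<1$, and $\boldsymbol\theta_{-m_n}=(\theta_{m_n+1},\dots,\theta_{p_n})^\top$. If $$(1/n)\vee\|\boldsymbol\theta_{-m_n}\|^4=o[R_n(\mathbf w^*|\mathcal M_A,\mathbf f)]\quad\text{and}\quad[\log p_n+\varphi(\boldsymbol\theta)](\log p_n)^2=o[nR_n(\mathbf w^*|\mathcal M_A,\mathbf f)],$$ where $\varphi(\boldsymbol\theta)=\sum_{j=1}^{p_n'-1}\theta_j^2/\sum_{l=j+1}^{p_n}\theta_l^2$ and $p_n'=\min\{1\le j\le p_n:\sum_{l=j+1}^{p_n}\theta_l^2=0\}$, then the MMA estimator based on $\mathcal M_A$ satisfies $Q_n(\hat{\mathbf w}|\mathcal M_A,\mathbf f)\le[1+o(1)]R_n(\mathbf w^*|\mathcal M_A,\mathbf f)$.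
   Context: Setup. For each sample size $n$ we observe $\mathbf y=\mathbf f+\boldsymbol\epsilon\in\mathbb R^n$ with $\mathbf f=\mathbf X\boldsymbol\beta$, where $\mathbf X\in\mathbb R^{n\times p_n}$ is nonstochastic with full column rank, $p_n\le n$, and $\epsilon_1,\dots,\epsilon_n$ are i.i.d. sub-Gaussian with mean $0$ and variance $\sigma^2>0$. Let $\mathbf P_j$ be the orthogonal projection onto the span of the first $j$ columns of $\mathbf X$ ($\mathbf P_0=\mathbf 0$); then $\mathbf P_j-\mathbf P_{j-1}=\boldsymbol\phi_j\boldsymbol\phi_j^\top$ for unit vectors $\boldsymbol\phi_1,\dots,\boldsymbol\phi_{p_n}$ forming an orthonormal basis of the column space of $\mathbf X$. The transformed coefficients are $\theta_j=\boldsymbol\phi_j^\top\mathbf f/\sqrt n$. A nested candidate set is $\mathcal M=\{\{1,\dots,k_m\}:m=1,\dots,M_n\}$ with $1\le k_1<\dots<k_{M_n}\le p_n$; model $m$ gives $\hat{\mathbf f}_m=\mathbf P_{k_m}\mathbf y$. $\mathcal M_A=\{\{1,\dots,j\}:1\le j\le p_n\}$. For $\mathbf w\in\mathcal W_{M_n}=\{\mathbf w\in[0,1]^{M_n}:\sum_m w_m=1\}$, the MA estimator is $\hat{\mathbf f}_{\mathbf w|\mathcal M}=\sum_m w_m\hat{\mathbf f}_m=\mathbf P_{\mathbf w|\mathcal M}\mathbf y$; for deterministic $\mathbf w$, $R_n(\mathbf w|\mathcal M,\mathbf f)=n^{-1}\mathbb E\|\hat{\mathbf f}_{\mathbf w|\mathcal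 M}-\mathbf f\|^2$; $\mathbf w^*|\mathcal M$ minimizes it over $\mathcal W_{M_n}$. MMA: with $\hat\sigma^2$ an estimator of $\sigma^2$, $C_n(\mathbf w|\mathcal M,\mathbf y)=n^{-1}\|\mathbf y-\hat{\mathbf f}_{\mathbf w|\mathcal M}\|^2+2\hat\sigma^2n^{-1}\sum_mk_mw_m$; $\hat{\mathbf w}|\mathcal M$ minimizes $C_n$ over $\mathcal W_{M_n}$. $Q_n(\hat{\mathbf w}|\mathcal M,\mathbf f)$ denotes either $n^{-1}\mathbb E\|\hat{\mathbf f}_{\hat{\mathbf w}|\mathcal M}-\mathbf f\|^2$ or $\mathbb E R_n(\hat{\mathbf w}|\mathcal M,\mathbf f)=n^{-1}\mathbb E\|\mathbf f-\mathbf P_{\hat{\mathbf w}|\mathcal M}\mathbf f\|^2+\sigma^2n^{-1}\mathbb E\operatorname{tr}(\mathbf P_{\hat{\mathbf w}|\mathcal M}^\top\mathbf P_{\hat{\mathbf w}|\mathcal M})$. $\psi(\mathcal M)$: let $k_0=0$, $S_j=\sum_{l=k_j+1}^{k_{M_n}}\theta_l^2$ ($0\le j\le M_n-1$), $S_{M_n}=0$, $M_n'=\min\{1\le j\le M_n:S_j=0\}$, and $\psi(\mathcal M)=\big[M_n\wedge\big(1+\sum_{j=1}^{M_n-1}\frac{k_{j+1}-k_j}{4k_j}+\sum_{j=1}^{M_n'-1}\frac{S_{j-1}-S_j}{4S_j}\big)\big](1+\log M_n)^2$. Assumption 1: $\limsup_n n^{-1}\|\mathbf f\|^2<\infty$.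 $o(\cdot)$ refers to $n\to\infty$. *)

theory Defs
  imports "HOL-Probability.Probability" "HOL-Library.Landau_Symbols"
begin

text \<open>Vectors in R^n are represented as functions nat => real, only the
  coordinates i < n being relevant; matrices as nat => nat => real.
  Regressor columns are indexed 0..p-1 (column l is the (l+1)-th column).\<close>

definition ipn :: "nat \<Rightarrow> (nat \<Rightarrow> real) \<Rightarrow> (nat \<Rightarrow> real) \<Rightarrow> real" where
  "ipn n u v = (\<Sum>i<n. u i * v i)"

definition sqn :: "nat \<Rightarrow> (nat \<Rightarrow> real) \<Rightarrow> real" where
  "sqn n u = ipn n u u"

definition col :: "nat \<Rightarrow> (nat \<Rightarrow> nat \<Rightarrow> real) \<Rightarrow> nat \<Rightarrow> nat \<Rightarrow> real" where
  "col n X l = (\<lambda>i. if i < n then X i l else 0)"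

definition colspan :: "nat \<Rightarrow> (nat \<Rightarrow> nat \<Rightarrow> real) \<Rightarrow> nat \<Rightarrow> (nat \<Rightarrow> real) set" where
  "colspan n X j = {v. \<exists>c. v = (\<lambda>i. \<Sum>l<j. c l * col n X l i)}"

definition proj :: "nat \<Rightarrow> (nat \<Rightarrow> nat \<Rightarrow> real) \<Rightarrow> nat \<Rightarrow> (nat \<Rightarrow> real) \<Rightarrow> nat \<Rightarrow> real" where
  "proj n X j y = (THE v. v \<in> colspan n X j \<and>
       (\<forall>u\<in>colspan n X j. ipn n (\<lambda>i. y i - v i) u = 0))"

text \<open>phi_j (j \<ge> 1): unit vector with P_j - P_(j-1) = phi_j phi_j^T (Gram-Schmidt)\<close>
definition phi :: "nat \<Rightarrow> (nat \<Rightarrow> nat \<Rightarrow> real) \<Rightarrow> nat \<Rightarrow> nat \<Rightarrow> real" where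
  "phi n X j = (let r = (\<lambda>i. col n X (j - 1) i - proj n X (j - 1) (col n X (j - 1)) i)
                in (\<lambda>i. r i / sqrt (sqn n r)))"

definition theta :: "nat \<Rightarrow> (nat \<Rightarrow> nat \<Rightarrow> real) \<Rightarrow> (nat \<Rightarrow> real) \<Rightarrow> nat \<Rightarrow> real" where
  "theta n X f j = ipn n (phi n X j) f / sqrt (real n)"

definition fvec :: "nat \<Rightarrow> nat \<Rightarrow> (nat \<Rightarrow> nat \<Rightarrow> real) \<Rightarrow> (nat \<Rightarrow> real) \<Rightarrow> nat \<Rightarrow> real" where
  "fvec n p X \<beta> = (\<lambda>i. if i < n then (\<Sum>j<p. X i j * \<beta> j) else 0)"

definition full_col_rank :: "nat \<Rightarrow> nat \<Rightarrow> (nat \<Rightarrow> nat \<Rightarrow> real) \<Rightarrow> bool" where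
  "full_col_rank n p X = (\<forall>c. (\<forall>i<n. (\<Sum>j<p. X i j * c j) = 0) \<longrightarrow> (\<forall>j<p. c j = 0))"

definition wsimplex :: "nat \<Rightarrow> (nat \<Rightarrow> real) set" where
  "wsimplex Mn = {w. (\<forall>m\<in>{1..Mn}. 0 \<le> w m \<and> w m \<le> 1) \<and> (\<Sum>m\<in>{1..Mn}. w m) = 1}"

definition ma_fit :: "nat \<Rightarrow> (nat \<Rightarrow> nat \<Rightarrow> real) \<Rightarrow> (nat \<Rightarrow> nat) \<Rightarrow> nat \<Rightarrow> (nat \<Rightarrow> real)
     \<Rightarrow> (nat \<Rightarrow> real) \<Rightarrow> nat \<Rightarrow> real" where
  "ma_fit n X k Mn w y = (\<lambda>i. \<Sum>m\<in>{1..Mn}. w m * proj n X (k m) y i)"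

definition noisy :: "nat \<Rightarrow> (nat \<Rightarrow> real) \<Rightarrow> (nat \<Rightarrow> 'a \<Rightarrow> real) \<Rightarrow> 'a \<Rightarrow> nat \<Rightarrow> real" where
  "noisy n f \<epsilon> x = (\<lambda>i. if i < n then f i + \<epsilon> i x else 0)"

definition risk :: "'a measure \<Rightarrow> (nat \<Rightarrow> 'a \<Rightarrow> real) \<Rightarrow> nat \<Rightarrow> (nat \<Rightarrow> nat \<Rightarrow> real)
     \<Rightarrow> (nat \<Rightarrow> nat) \<Rightarrow> nat \<Rightarrow> (nat \<Rightarrow> real) \<Rightarrow> (nat \<Rightarrow> real) \<Rightarrow> real" where
  "risk M \<epsilon> n X k Mn f w =
     (\<integral>x. sqn n (\<lambda>i. ma_fit n X k Mn w (noisy n f \<epsilon> x) i - f i) \<partial>M) / real n"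

definition opt_risk :: "'a measure \<Rightarrow> (nat \<Rightarrow> 'a \<Rightarrow> real) \<Rightarrow> nat \<Rightarrow> (nat \<Rightarrow> nat \<Rightarrow> real)
     \<Rightarrow> (nat \<Rightarrow> nat) \<Rightarrow> nat \<Rightarrow> (nat \<Rightarrow> real) \<Rightarrow> real" where
  "opt_risk M \<epsilon> n X k Mn f = Inf (risk M \<epsilon> n X k Mn f ` wsimplex Mn)"

definition mma_crit :: "nat \<Rightarrow> (nat \<Rightarrow> nat \<Rightarrow> real) \<Rightarrow> (nat \<Rightarrow> nat) \<Rightarrow> nat \<Rightarrow> real
     \<Rightarrow> (nat \<Rightarrow> real) \<Rightarrow> (nat \<Rightarrow> real) \<Rightarrow> real" where
  "mma_crit n X k Mn s y w =
     sqn n (\<lambda>i. y i - ma_fit n X k Mn w y i) / real n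
     + 2 * s * (\<Sum>m\<in>{1..Mn}. real (k m) * w m) / real n"

definition Q_loss :: "'a measure \<Rightarrow> (nat \<Rightarrow> 'a \<Rightarrow> real) \<Rightarrow> nat \<Rightarrow> (nat \<Rightarrow> nat \<Rightarrow> real)
     \<Rightarrow> (nat \<Rightarrow> nat) \<Rightarrow> nat \<Rightarrow> (nat \<Rightarrow> real) \<Rightarrow> ((nat \<Rightarrow> real) \<Rightarrow> nat \<Rightarrow> real) \<Rightarrow> real" where
  "Q_loss M \<epsilon> n X k Mn f what =
     (\<integral>x. sqn n (\<lambda>i. ma_fit n X k Mn (what (noisy n f \<epsilon> x)) (noisy n f \<epsilon> x) i - f i) \<partial>M)
       / real n"

definition Q_risk :: "'a measure \<Rightarrow> (nat \<Rightarrow> 'a \<Rightarrow> real) \<Rightarrow> nat \<Rightarrow> (nat \<Rightarrow> nat \<Rightarrow> real)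
     \<Rightarrow> (nat \<Rightarrow> nat) \<Rightarrow> nat \<Rightarrow> (nat \<Rightarrow> real) \<Rightarrow> ((nat \<Rightarrow> real) \<Rightarrow> nat \<Rightarrow> real) \<Rightarrow> real" where
  "Q_risk M \<epsilon> n X k Mn f what =
     (\<integral>x. risk M \<epsilon> n X k Mn f (what (noisy n f \<epsilon> x)) \<partial>M)"

definition psi :: "(nat \<Rightarrow> real) \<Rightarrow> (nat \<Rightarrow> nat) \<Rightarrow> nat \<Rightarrow> real" where
  "psi th k Mn =
    (let kk = (\<lambda>j. if j = 0 then 0 else k j);
         S = (\<lambda>j. \<Sum>l\<in>{kk j + 1..kk Mn}. (th l)^2);
         M' = (LEAST j. 1 \<le> j \<and> j \<le> Mn \<and> S j = 0)
     in min (real Mn)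
          (1 + (\<Sum>j\<in>{1..<Mn}. real (kk (Suc j) - kk j) / (4 * real (kk j)))
             + (\<Sum>j\<in>{1..<M'}. (S (j - 1) - S j) / (4 * S j)))
        * (1 + ln (real Mn))^2)"

definition varphi :: "(nat \<Rightarrow> real) \<Rightarrow> nat \<Rightarrow> real" where
  "varphi th p =
    (let T = (\<lambda>j. \<Sum>l\<in>{j + 1..p}. (th l)^2);
         p' = (LEAST j. 1 \<le> j \<and> j \<le> p \<and> T j = 0)
     in \<Sum>j\<in>{1..<p'}. (th j)^2 / T j)"

definition subgaussian :: "'a measure \<Rightarrow> ('a \<Rightarrow> real) \<Rightarrow> bool" where
  "subgaussian M Z = (\<exists>c. \<forall>t. integrable M (\<lambda>x. exp (t * Z x)) \<and>
                         (\<integral>x. exp (t * Z x) \<partial>M) \<le> exp (c^2 * t^2 / 2))"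

definition iid_noise :: "'a measure \<Rightarrow> (nat \<Rightarrow> 'a \<Rightarrow> real) \<Rightarrow> real \<Rightarrow> bool" where
  "iid_noise M \<epsilon> \<sigma> = (prob_space M \<and> prob_space.indep_vars M (\<lambda>_. borel) \<epsilon> UNIV \<and>
      (\<forall>i. distr M borel (\<epsilon> i) = distr M borel (\<epsilon> 0)) \<and>
      subgaussian M (\<epsilon> 0) \<and> (\<integral>x. \<epsilon> 0 x \<partial>M) = 0 \<and>
      (\<integral>x. (\<epsilon> 0 x)^2 \<partial>M) = \<sigma>^2 \<and> \<sigma> > 0)"

end

theory Submission
  imports Defs
begin

text \<open>In the orthonormal basis \<open>phi\<close> a nested averaging estimator multiplies the \<open>l\<close>-th coordinate of
  the data by a weight that is decreasing in \<open>l\<close>, constant on the blocks between consecutive model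
  sizes, and equal to 1 on the first block. Up to terms free of the weights, both the criterion and
  the loss differ from the risk \<open>\<rho>\<close> (times \<open>n\<close>) by random sums of monotone functions of the block
  weights against two noise processes, the centred squared noise coordinates and the cross products
  of signal and noise, plus the error of the variance estimator. A weighted form of the
  Rademacher-Menshov inequality, which needs second moments only, bounds these sums by
  \<open>b sqrt \<rho>\<close> simultaneously for all weights; the number of models enters through the dyadic depth, a
  logarithm, and the normalised block sizes and signals add up to the other factor of \<open>psi\<close>.
  Minimality of the criterion at the selected weights \<open>v\<close> then gives \<open>sqrt \<rho>(v) \<le> sqrt \<rho>(w) + b\<close>
  for every \<open>w\<close>, and the two assumptions say that the expectation of \<open>b\<^sup>2\<close> is negligible against the
  optimal risk.\<close>

section \<open>Weighted Rademacher-Menshov inequality\<close>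

text \<open>The selected weights depend on the data and range over a simplex of growing dimension,
  so deviations must be bounded for all weights at once. Monotonicity makes this possible: under
  Abel summation a monotone weight acts through partial sums of blocks, which form a chain. A
  maximal inequality in terms of the total variance would be too coarse, since that variance can far
  exceed the optimal risk. The weighted form compares with
  \<open>\<Sum>i. (u i)\<^sup>2 * d i\<close> instead, and \<open>d\<close> is chosen to make this
  sum a part of the risk: block sizes for the squared noise (variance part), block signals for the
  cross products (squared bias part). The price is the sum of \<open>d\<close> over its own running
  total, which is what the two sums in \<open>psi\<close> measure. As \<open>1 - g\<close> increases
  along the blocks, the signal blocks are run backwards, and their running totals become the tail
  sums \<open>S\<close>. Of the two logarithms in \<open>psi\<close>, one comes from Cauchy-Schwarz
  over the dyadic levels, the other from the number of levels in the expected energy. Second moments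
  of squared noise coordinates are fourth moments of the errors, finite by the sub-Gaussian
  tails.\<close>

primrec dyadic_energy :: "(nat \<Rightarrow> real) \<Rightarrow> (nat \<Rightarrow> real) \<Rightarrow> nat \<Rightarrow> nat \<Rightarrow> real" where
  "dyadic_energy x d 0 s = 0"
| "dyadic_energy x d (Suc L) s = dyadic_energy x d L s + dyadic_energy x d L (s + 2^L)
     + (\<Sum>i\<in>{s..<s + 2^L}. x i)\<^sup>2 / (\<Sum>i<s + 2^L. d i)"

lemma dyadic_energy_nonneg:
  assumes "\<And>i. 0 \<le> d i"
  shows "0 \<le> dyadic_energy x d L s"
  by (induction L arbitrary: s) (auto simp: assms sum_nonneg)

text \<open>Splitting the interval in the middle, the partial sums in the right half exceed those restarted
  at the midpoint by the sum over the left half; this costs one summand of the energy per level, and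
  \<open>v j - v (Suc j)\<close> is controlled through \<open>(v a - v b)\<^sup>2 \<le> (v a)\<^sup>2 - (v b)\<^sup>2\<close>.\<close>
lemma dyadic_energy_bound:
  fixes v x d :: "nat \<Rightarrow> real"
  assumes v: "\<And>i. v (Suc i) \<le> v i" "\<And>i. 0 \<le> v i"
    and d: "\<And>i. 0 \<le> d i" and xd: "\<And>i. d i = 0 \<Longrightarrow> x i = 0"
  shows "(\<Sum>j\<in>{s..<s + 2^L}. (v j - v (Suc j)) * \<bar>\<Sum>i\<in>{s..<j}. x i\<bar>)
    \<le> sqrt (real L) * sqrt (dyadic_energy x d L s)
       * sqrt (\<Sum>j\<in>{s..<s + 2^L}. ((v j)\<^sup>2 - (v (Suc j))\<^sup>2) * (\<Sum>i<j. d i))"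
proof (induction L arbitrary: s)
  case 0
  then show ?case by simp
next
  case (Suc L)
  define m where "m = s + 2^L"
  define e where "e = m + 2^L"
  let ?g = "\<lambda>a b. \<Sum>j\<in>{a..<b}. (v j - v (Suc j)) * \<bar>\<Sum>i\<in>{a..<j}. x i\<bar>"
  let ?T = "\<lambda>a b. \<Sum>j\<in>{a..<b}. ((v j)\<^sup>2 - (v (Suc j))\<^sup>2) * (\<Sum>i<j. d i)"
  define Y where "Y = (\<Sum>i\<in>{s..<m}. x i)"
  \<comment> \<open>\<open>D\<close> counts from 0 although the interval starts at \<open>s\<close>:
    the right-hand side of the bound carries the prefix sums \<open>\<Sum>i<j. d i\<close>, which
    later arise from Abel summation over the whole range. For \<open>j \<ge> m\<close> they are at
    least \<open>D\<close>, so the jump \<open>v m - v e\<close> can be charged to the right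
    half.\<close>
  define D where "D = (\<Sum>i<m. d i)"
  define c where "c = sqrt (Y\<^sup>2 / D)"
  have sm: "s \<le> m" "m \<le> e" "s + 2^Suc L = e" by (auto simp: m_def e_def)
  have D0: "0 \<le> D" by (simp add: D_def d sum_nonneg)
  have vm: "v b \<le> v a" if "a \<le> b" for a b
    using that by (rule lift_Suc_antimono_le[of v, OF v(1)])
  have T0: "0 \<le> ?T a b" for a b
    by (intro sum_nonneg mult_nonneg_nonneg) (auto simp: v d power_mono)
  have tele: "(\<Sum>j\<in>{m..<e}. v j - v (Suc j)) = v m - v e"
    using sum_Suc_diff'[OF sm(2), of "\<lambda>i. - v i"] by simp
  have tele2: "(\<Sum>j\<in>{m..<e}. (v j)\<^sup>2 - (v (Suc j))\<^sup>2) = (v m)\<^sup>2 - (v e)\<^sup>2"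
    using sum_Suc_diff'[OF sm(2), of "\<lambda>i. - (v i)\<^sup>2"] by simp
  \<comment> \<open>If \<open>D = 0\<close> then \<open>c = 0\<close>, because division by 0 gives
    0; the identity survives since \<open>xd\<close> then forces \<open>Y = 0\<close>.\<close>
  have cY: "\<bar>Y\<bar> = c * sqrt D"
  proof (cases "D = 0")
    case True
    hence "d i = 0" if "i < m" for i
      using that d by (auto simp: D_def sum_nonneg_eq_0_iff)
    hence "Y = 0" unfolding Y_def by (intro sum.neutral) (auto simp: xd)
    with True show ?thesis by simp
  next
    case False
    with D0 show ?thesis by (simp add: c_def real_sqrt_divide)
  qed
  have c0: "0 \<le> c" by (simp add: c_def D0)
  have cr: "\<bar>Y\<bar> * (v m - v e) \<le> c * sqrt (?T m e)"
  proof -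
    have "D * (v m - v e)\<^sup>2 \<le> D * ((v m)\<^sup>2 - (v e)\<^sup>2)"
    proof (rule mult_left_mono[OF _ D0])
      have "0 \<le> 2 * v e * (v m - v e)" using vm[OF sm(2)] v(2) by simp
      then show "(v m - v e)\<^sup>2 \<le> (v m)\<^sup>2 - (v e)\<^sup>2" by (simp add: power2_eq_square algebra_simps)
    qed
    also have "\<dots> = (\<Sum>j\<in>{m..<e}. ((v j)\<^sup>2 - (v (Suc j))\<^sup>2) * D)"
      by (simp add: tele2[symmetric] sum_distrib_left mult.commute)
    also have "\<dots> \<le> ?T m e"
      by (intro sum_mono mult_left_mono) (auto simp: D_def v power_mono d intro!: sum_mono2)
    finally have "sqrt D * (v m - v e) \<le> sqrt (?T m e)"
      using vm[OF sm(2)] by (intro real_le_rsqrt) (auto simp: power_mult_distrib D0)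
    then show ?thesis unfolding cY by (simp add: c0 mult.assoc mult_left_mono)
  qed
  have "?g s e = ?g s m + (\<Sum>j\<in>{m..<e}. (v j - v (Suc j)) * \<bar>\<Sum>i\<in>{s..<j}. x i\<bar>)"
    using sm by (simp add: sum.atLeastLessThan_concat)
  also have "(\<Sum>j\<in>{m..<e}. (v j - v (Suc j)) * \<bar>\<Sum>i\<in>{s..<j}. x i\<bar>)
     \<le> (\<Sum>j\<in>{m..<e}. (v j - v (Suc j)) * (\<bar>Y\<bar> + \<bar>\<Sum>i\<in>{m..<j}. x i\<bar>))"
  proof (intro sum_mono mult_left_mono)
    fix j assume j: "j \<in> {m..<e}"
    have "(\<Sum>i\<in>{s..<j}. x i) = Y + (\<Sum>i\<in>{m..<j}. x i)"
      using j sm by (simp add: Y_def sum.atLeastLessThan_concat)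
    then show "\<bar>\<Sum>i\<in>{s..<j}. x i\<bar> \<le> \<bar>Y\<bar> + \<bar>\<Sum>i\<in>{m..<j}. x i\<bar>" by simp
  qed (auto simp: v)
  also have "\<dots> = \<bar>Y\<bar> * (v m - v e) + ?g m e"
    by (simp add: tele[symmetric] distrib_left sum.distrib sum_distrib_left mult.commute)
  finally have 1: "?g s e \<le> ?g s m + ?g m e + c * sqrt (?T m e)" using cr by simp
  define w1 where "w1 = sqrt (dyadic_energy x d L s)"
  define w2 where "w2 = sqrt (dyadic_energy x d L m)"
  define t1 where "t1 = sqrt (?T s m)"
  define t2 where "t2 = sqrt (?T m e)"
  have nn: "0 \<le> w1" "0 \<le> w2" "0 \<le> t1" "0 \<le> t2"
    by (auto simp: w1_def w2_def t1_def t2_def dyadic_energy_nonneg d T0)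
  have cs: "a * b + a' * b' \<le> sqrt (a\<^sup>2 + a'\<^sup>2) * sqrt (b\<^sup>2 + b'\<^sup>2)" for a b a' b' :: real
  proof -
    have "(a * b + a' * b')\<^sup>2 \<le> (a\<^sup>2 + a'\<^sup>2) * (b\<^sup>2 + b'\<^sup>2)"
      using zero_le_power2[of "a * b' - a' * b"] by (simp add: power2_eq_square algebra_simps)
    then show ?thesis by (metis real_le_rsqrt real_sqrt_mult)
  qed
  have "?g s e \<le> sqrt (real L) * (w1 * t1 + w2 * t2) + c * t2"
    using 1 Suc.IH[of s] Suc.IH[of m]
    by (simp add: w1_def w2_def t1_def t2_def m_def e_def algebra_simps)
  also have "\<dots> \<le> sqrt (real L) * (sqrt (w1\<^sup>2 + w2\<^sup>2) * sqrt (t1\<^sup>2 + t2\<^sup>2)) + c * sqrt (t1\<^sup>2 + t2\<^sup>2)"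
    by (intro add_mono mult_left_mono cs) (auto simp: c0 real_le_rsqrt)
  also have "\<dots> = (sqrt (real L) * sqrt (w1\<^sup>2 + w2\<^sup>2) + 1 * c) * sqrt (t1\<^sup>2 + t2\<^sup>2)"
    by (simp add: algebra_simps)
  \<comment> \<open>Cauchy-Schwarz again, now between the \<open>L\<close> lower levels with weight
    \<open>sqrt L\<close> and the current level with weight 1. This is how the depth grows from
    \<open>L\<close> to \<open>Suc L\<close> under the root.\<close>
  also have "\<dots> \<le> (sqrt ((sqrt (real L))\<^sup>2 + 1\<^sup>2) * sqrt ((sqrt (w1\<^sup>2 + w2\<^sup>2))\<^sup>2 + c\<^sup>2)) * sqrt (t1\<^sup>2 + t2\<^sup>2)"
    by (intro mult_right_mono cs) auto
  also have "(sqrt (w1\<^sup>2 + w2\<^sup>2))\<^sup>2 + c\<^sup>2 = dyadic_energy x d (Suc L) s"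
    by (simp add: w1_def w2_def c_def dyadic_energy_nonneg d D0 Y_def D_def m_def)
      (simp flip: m_def D_def Y_def add: D0)
  also have "(sqrt (real L))\<^sup>2 + 1\<^sup>2 = real (Suc L)" by simp
  also have "t1\<^sup>2 + t2\<^sup>2 = ?T s e"
    using sm by (simp add: t1_def t2_def T0 sum.atLeastLessThan_concat)
  finally show ?case unfolding sm(3) .
qed

lemma sum_abel:
  fixes u x :: "nat \<Rightarrow> real"
  shows "(\<Sum>i<N. u i * x i) = (\<Sum>j<N. (u j - u (Suc j)) * (\<Sum>i<Suc j. x i)) + u N * (\<Sum>i<N. x i)"
  by (induction N) (auto simp: algebra_simps)

text \<open>Abel summation turns the weighted sum into decrements of \<open>u\<close> against
  partial sums of \<open>x\<close>, the form treated by \<open>dyadic_energy_bound\<close>. Abel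
  summation of \<open>u\<^sup>2\<close> against \<open>d\<close>, read backwards, then collapses the
  last factor of that bound to \<open>\<Sum>i<N. (u i)\<^sup>2 * d i\<close>.\<close>

lemma sum_antitone_weights_le:
  fixes u x d :: "nat \<Rightarrow> real"
  assumes u: "\<And>i j. i \<le> j \<Longrightarrow> j < N \<Longrightarrow> u j \<le> u i" "\<And>i. i < N \<Longrightarrow> 0 \<le> u i"
    and d: "\<And>i. 0 \<le> d i" and xd: "\<And>i. d i = 0 \<Longrightarrow> x i = 0" and N: "N < 2^L"
  shows "(\<Sum>i<N. u i * x i)\<^sup>2 \<le> real L * dyadic_energy x d L 0 * (\<Sum>i<N. (u i)\<^sup>2 * d i)"
proof (cases "N = 0")
  case False
  define u' where "u' i = (if i < N then u i else 0)" for i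
  \<comment> \<open>The shift by one reconciles the inclusive partial sums of Abel summation with
    the exclusive ones of the dyadic bound. As \<open>v 0 = v 1\<close>, the term
    \<open>j = 0\<close> vanishes. After the shift the index \<open>N\<close> itself occurs, which
    is why \<open>N < 2^L\<close> is strict.\<close>
  define v where "v i = u' (i - 1)" for i
  have u'1: "u' (Suc i) \<le> u' i" for i using u by (auto simp: u'_def)
  have u'0: "0 \<le> u' i" for i using u by (auto simp: u'_def)
  have v: "v (Suc i) \<le> v i" "0 \<le> v i" for i
    using u'1[of "i - 1"] u'0 by (cases i; auto simp: v_def)+
  have reindex: "(\<Sum>j<N. g (Suc j)) = (\<Sum>j\<in>{0..<0 + 2^L}. g j)"
    if "g 0 = 0" "\<And>j. j > N \<Longrightarrow> g j = 0" for g :: "nat \<Rightarrow> real"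
  proof -
    have "(\<Sum>j<N. g (Suc j)) = (\<Sum>j\<le>N. g j)"
      unfolding lessThan_Suc_atMost[symmetric] sum.lessThan_Suc_shift by (simp add: that)
    also have "\<dots> = (\<Sum>j\<in>{0..<0 + 2^L}. g j)"
      using N that by (intro sum.mono_neutral_left) auto
    finally show ?thesis .
  qed
  have "(\<Sum>i<N. u i * x i) = (\<Sum>i<N. u' i * x i)" by (simp add: u'_def)
  also have "\<dots> = (\<Sum>j<N. (u' j - u' (Suc j)) * (\<Sum>i<Suc j. x i))"
    unfolding sum_abel[of u'] by (simp add: u'_def)
  finally have "\<bar>\<Sum>i<N. u i * x i\<bar> \<le> (\<Sum>j<N. \<bar>(u' j - u' (Suc j)) * (\<Sum>i<Suc j. x i)\<bar>)" by simp
  also have "\<dots> = (\<Sum>j<N. (v (Suc j) - v (Suc (Suc j))) * \<bar>\<Sum>i\<in>{0..<Suc j}. x i\<bar>)"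
    using u'1 by (intro sum.cong refl) (simp add: v_def abs_mult atLeast0LessThan del: sum.lessThan_Suc)
  also have "\<dots> = (\<Sum>j\<in>{0..<0 + 2^L}. (v j - v (Suc j)) * \<bar>\<Sum>i\<in>{0..<j}. x i\<bar>)"
    by (intro reindex) (auto simp: v_def u'_def)
  also have "\<dots> \<le> sqrt (real L) * sqrt (dyadic_energy x d L 0)
       * sqrt (\<Sum>j\<in>{0..<0 + 2^L}. ((v j)\<^sup>2 - (v (Suc j))\<^sup>2) * (\<Sum>i<j. d i))"
    by (intro dyadic_energy_bound) (auto simp: v d xd)
  also have "(\<Sum>j\<in>{0..<0 + 2^L}. ((v j)\<^sup>2 - (v (Suc j))\<^sup>2) * (\<Sum>i<j. d i))
      = (\<Sum>j<N. ((v (Suc j))\<^sup>2 - (v (Suc (Suc j)))\<^sup>2) * (\<Sum>i<Suc j. d i))"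
    by (rule reindex[symmetric]) (auto simp: v_def u'_def)
  also have "\<dots> = (\<Sum>i<N. (u' i)\<^sup>2 * d i)"
    unfolding sum_abel[of "\<lambda>i. (u' i)\<^sup>2"] by (simp add: u'_def v_def)
  also have "\<dots> = (\<Sum>i<N. (u i)\<^sup>2 * d i)" by (simp add: u'_def)
  finally have "\<bar>\<Sum>i<N. u i * x i\<bar> \<le> sqrt (real L * dyadic_energy x d L 0 * (\<Sum>i<N. (u i)\<^sup>2 * d i))"
    by (simp add: real_sqrt_mult)
  then have "\<bar>\<Sum>i<N. u i * x i\<bar>\<^sup>2 \<le> (sqrt (real L * dyadic_energy x d L 0 * (\<Sum>i<N. (u i)\<^sup>2 * d i)))\<^sup>2"
    by (intro power_mono) auto
  then show ?thesis
    by (simp add: dyadic_energy_nonneg d sum_nonneg)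
qed simp

text \<open>For \<open>i\<close> in a left half the prefix sum through \<open>i\<close> is at most
  the denominator of that half, so the expected contribution of the half is at most \<open>C\<close>
  times the sum of \<open>d i\<close> over the prefix through \<open>i\<close>. The left halves of
  one level are disjoint, hence every level costs at most the same total, and there are
  \<open>L\<close> levels.\<close>

lemma dyadic_energy_expectation:
  fixes x :: "nat \<Rightarrow> 'a \<Rightarrow> real"
  assumes int: "\<And>a b. integrable M (\<lambda>\<omega>. (\<Sum>i\<in>{a..<b}. x i \<omega>)\<^sup>2)"
    and E: "\<And>a b. (\<integral>\<omega>. (\<Sum>i\<in>{a..<b}. x i \<omega>)\<^sup>2 \<partial>M) \<le> C * (\<Sum>i\<in>{a..<b}. d i)"
    and d: "\<And>i. 0 \<le> d i" and C: "0 \<le> C"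
  shows "integrable M (\<lambda>\<omega>. dyadic_energy (\<lambda>i. x i \<omega>) d L s)" (is ?A)
    and "(\<integral>\<omega>. dyadic_energy (\<lambda>i. x i \<omega>) d L s \<partial>M)
      \<le> C * real L * (\<Sum>i\<in>{s..<s + 2^L}. d i / (\<Sum>l<Suc i. d l))" (is ?B)
proof -
  have int2: "integrable M (\<lambda>\<omega>. dyadic_energy (\<lambda>i. x i \<omega>) d L s)" for L s
    by (induction L arbitrary: s) (auto intro!: int)
  then show ?A .
  show ?B
  proof (induction L arbitrary: s)
    case 0
    then show ?case by simp
  next
    case (Suc L)
    define m where "m = s + 2^L"
    define e where "e = m + 2^L"
    let ?Q = "\<lambda>a b. \<Sum>i\<in>{a..<b}. d i / (\<Sum>l<Suc i. d l)"
    define D where "D = (\<Sum>i<m. d i)"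
    have D0: "0 \<le> D" by (simp add: D_def d sum_nonneg)
    have sm: "s \<le> m" "m \<le> e" "s + 2^Suc L = e" by (auto simp: m_def e_def)
    have Q0: "0 \<le> ?Q a b" for a b by (intro sum_nonneg divide_nonneg_nonneg) (auto simp: d)
    have Q: "?Q s e = ?Q s m + ?Q m e" using sm by (simp add: sum.atLeastLessThan_concat)
    have "(\<Sum>i\<in>{s..<m}. d i) / D \<le> ?Q s m"
      unfolding sum_divide_distrib
    proof (rule sum_mono)
      fix i assume i: "i \<in> {s..<m}"
      show "d i / D \<le> d i / (\<Sum>l<Suc i. d l)"
      proof (cases "d i = 0")
        case False
        hence di: "0 < d i" using d[of i] by linarith
        have "d i \<le> (\<Sum>l<Suc i. d l)" using d by (simp add: sum_nonneg)
        moreover have "(\<Sum>l<Suc i. d l) \<le> D" unfolding D_def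
          using i by (intro sum_mono2) (auto simp: d)
        ultimately show ?thesis using di by (intro divide_left_mono) auto
      qed simp
    qed
    then have 3: "C * ((\<Sum>i\<in>{s..<m}. d i) / D) \<le> C * ?Q s e"
      using C Q Q0[of m e] by (intro mult_left_mono) auto
    have "(\<integral>\<omega>. dyadic_energy (\<lambda>i. x i \<omega>) d (Suc L) s \<partial>M) =
        (\<integral>\<omega>. dyadic_energy (\<lambda>i. x i \<omega>) d L s \<partial>M) + (\<integral>\<omega>. dyadic_energy (\<lambda>i. x i \<omega>) d L m \<partial>M)
        + (\<integral>\<omega>. (\<Sum>i\<in>{s..<m}. x i \<omega>)\<^sup>2 \<partial>M) / D"
      by (simp add: int int2 m_def D_def)
    also have "\<dots> \<le> C * real L * ?Q s m + C * real L * ?Q m e + C * (\<Sum>i\<in>{s..<m}. d i) / D"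
      using Suc.IH[of s] Suc.IH[of m] divide_right_mono[OF E[of s m] D0]
      by (simp add: m_def e_def)
    also have "\<dots> \<le> C * real L * ?Q s e + C * ?Q s e"
      using 3 unfolding Q distrib_left times_divide_eq_right by linarith
    also have "\<dots> = C * real (Suc L) * ?Q s e" by (simp add: algebra_simps)
    finally show ?case by (simp only: sm(3))
  qed
qed

text \<open>\<open>W\<close> is fixed before the weights \<open>u\<close> are chosen, so the last
  property may be applied to weights selected from the data. The squared logarithm is the factor
  \<open>L\<close> of the pathwise bound times the factor \<open>L\<close> of the expected
  energy.\<close>

lemma weighted_rademacher_menshov:
  fixes x :: "nat \<Rightarrow> 'a \<Rightarrow> real"
  assumes int: "\<And>a b. b \<le> N \<Longrightarrow> integrable M (\<lambda>\<omega>. (\<Sum>i\<in>{a..<b}. x i \<omega>)\<^sup>2)"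
    and E: "\<And>a b. a \<le> b \<Longrightarrow> b \<le> N \<Longrightarrow> (\<integral>\<omega>. (\<Sum>i\<in>{a..<b}. x i \<omega>)\<^sup>2 \<partial>M) \<le> C * (\<Sum>i\<in>{a..<b}. d i)"
    and d: "\<And>i. i < N \<Longrightarrow> 0 \<le> d i" and C: "0 \<le> C" and N: "1 \<le> N"
    and xd: "\<And>i \<omega>. i < N \<Longrightarrow> d i = 0 \<Longrightarrow> x i \<omega> = 0"
  obtains W where "integrable M W" "\<And>\<omega>. 0 \<le> W \<omega>"
    "(\<integral>\<omega>. W \<omega> \<partial>M) \<le> 9/4 * C * (1 + ln (real N))\<^sup>2 * (\<Sum>i<N. d i / (\<Sum>l<Suc i. d l))"
    "\<And>\<omega> u. (\<And>i j. i \<le> j \<Longrightarrow> j < N \<Longrightarrow> u j \<le> u i) \<Longrightarrow> (\<And>i. i < N \<Longrightarrow> 0 \<le> u i) \<Longrightarrow>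
       (\<Sum>i<N. u i * x i \<omega>)\<^sup>2 \<le> W \<omega> * (\<Sum>i<N. (u i)\<^sup>2 * d i)"
proof -
  define x' where "x' i \<omega> = (if i < N then x i \<omega> else 0)" for i \<omega>
  define d' where "d' i = (if i < N then d i else 0)" for i
  obtain L0 where L0: "2^L0 \<le> N" "N < 2^Suc L0"
    using ex_power_ivl1[of 2 N] N by auto
  define L where "L = Suc L0"
  have d': "0 \<le> d' i" for i using d by (auto simp: d'_def)
  have cut: "(\<Sum>i\<in>{a..<b}. (if i < N then g i else 0)) = (\<Sum>i\<in>{a..<min b N}. g i)"
    for g :: "nat \<Rightarrow> real" and a b
    by (rule sum.mono_neutral_cong_right) auto
  have int': "integrable M (\<lambda>\<omega>. (\<Sum>i\<in>{a..<b}. x' i \<omega>)\<^sup>2)" for a b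
    unfolding x'_def cut by (rule int) simp
  have E': "(\<integral>\<omega>. (\<Sum>i\<in>{a..<b}. x' i \<omega>)\<^sup>2 \<partial>M) \<le> C * (\<Sum>i\<in>{a..<b}. d' i)" for a b
  proof (cases "a \<le> min b N")
    case True then show ?thesis unfolding x'_def d'_def cut by (rule E) simp
  next
    case False
    then have *: "{a..<min b N} = {}" by auto
    show ?thesis unfolding x'_def d'_def cut * by simp
  qed
  define W where "W \<omega> = real L * dyadic_energy (\<lambda>i. x' i \<omega>) d' L 0" for \<omega>
  \<comment> \<open>\<open>L\<close> is the integer part of the binary logarithm of
    \<open>N\<close>, plus one; \<open>ln 2 \<ge> 2/3\<close> yields the factor 3/2, whose square is
    the 9/4 of the statement.\<close>
  have LN: "real L \<le> 3/2 * (1 + ln (real N))"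
  proof -
    have "2/3 * real L0 \<le> ln 2 * real L0" using ln2_ge_two_thirds by (intro mult_right_mono) auto
    also have "\<dots> = ln (real (2^L0))" by (simp add: ln_realpow)
    also have "\<dots> \<le> ln (real N)" using L0(1) N by (subst ln_le_cancel_iff) (auto simp flip: of_nat_le_iff)
    finally have "2/3 * real L0 \<le> ln (real N)" .
    then show ?thesis by (simp add: L_def)
  qed
  show ?thesis
  proof
    show "integrable M W" unfolding W_def
      using dyadic_energy_expectation(1)[of M x' C d', OF int' E' d' C] by simp
    show "0 \<le> W \<omega>" for \<omega> by (simp add: W_def dyadic_energy_nonneg d')
    let ?Q = "\<Sum>i<N. d i / (\<Sum>l<Suc i. d l)"
    have Q0: "0 \<le> ?Q" using d by (intro sum_nonneg divide_nonneg_nonneg) auto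
    have Q: "(\<Sum>i\<in>{0..<0 + 2^L}. d' i / (\<Sum>l<Suc i. d' l)) = ?Q"
      using L0 by (intro sum.mono_neutral_cong_right) (auto simp: d'_def L_def)
    have "(\<integral>\<omega>. W \<omega> \<partial>M) = real L * (\<integral>\<omega>. dyadic_energy (\<lambda>i. x' i \<omega>) d' L 0 \<partial>M)"
      by (simp add: W_def)
    also have "\<dots> \<le> real L * (C * real L * ?Q)"
      using dyadic_energy_expectation(2)[of M x' C d' L 0, OF int' E' d' C]
      by (intro mult_left_mono) (simp_all only: Q of_nat_0_le_iff)
    also have "\<dots> = (real L)\<^sup>2 * (C * ?Q)" by (simp add: power2_eq_square)
    also have "\<dots> \<le> (3/2 * (1 + ln (real N)))\<^sup>2 * (C * ?Q)"
      using LN C Q0 by (intro mult_right_mono power_mono) auto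
    finally show "(\<integral>\<omega>. W \<omega> \<partial>M) \<le> 9/4 * C * (1 + ln (real N))\<^sup>2 * ?Q"
      unfolding power_mult_distrib by (simp add: power2_eq_square mult_ac)
    fix \<omega> and u :: "nat \<Rightarrow> real"
    assume u: "\<And>i j. i \<le> j \<Longrightarrow> j < N \<Longrightarrow> u j \<le> u i" "\<And>i. i < N \<Longrightarrow> 0 \<le> u i"
    have "(\<Sum>i<N. u i * x' i \<omega>)\<^sup>2 \<le> W \<omega> * (\<Sum>i<N. (u i)\<^sup>2 * d' i)"
      unfolding W_def
      by (rule sum_antitone_weights_le) (use u d' L0 xd in \<open>auto simp: x'_def d'_def L_def\<close>)
    then show "(\<Sum>i<N. u i * x i \<omega>)\<^sup>2 \<le> W \<omega> * (\<Sum>i<N. (u i)\<^sup>2 * d i)"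
      by (simp add: x'_def d'_def)
  qed
qed

section \<open>Projections onto nested column spans\<close>

lemma ipn_commute: "ipn n u v = ipn n v u"
  by (simp add: ipn_def mult.commute)

lemma ipn_diff_left: "ipn n (\<lambda>i. u i - v i) w = ipn n u w - ipn n v w"
  by (simp add: ipn_def sum_subtractf left_diff_distrib)

lemma ipn_scale_left: "ipn n (\<lambda>i. c * u i) w = c * ipn n u w"
  by (simp add: ipn_def sum_distrib_left mult.assoc)

lemma ipn_sum_left: "ipn n (\<lambda>i. \<Sum>l\<in>A. c l * e l i) w = (\<Sum>l\<in>A. c l * ipn n (e l) w)"
  by (simp add: ipn_def sum_distrib_left sum_distrib_right mult.assoc) (rule sum.swap)

lemma sqn_nonneg: "0 \<le> sqn n u"
  by (simp add: sqn_def ipn_def sum_nonneg)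

lemma sqn_eq_0_iff: "sqn n u = 0 \<longleftrightarrow> (\<forall>i<n. u i = 0)"
  by (auto simp: sqn_def ipn_def sum_nonneg_eq_0_iff)

lemma sqn_diff: "sqn n (\<lambda>i. u i - v i) = sqn n u - 2 * ipn n u v + sqn n v"
  by (simp add: sqn_def ipn_def sum_subtractf sum.distrib sum_distrib_left algebra_simps)

lemma colspanI: "v = (\<lambda>i. \<Sum>l<j. c l * col n X l i) \<Longrightarrow> v \<in> colspan n X j"
  unfolding colspan_def mem_Collect_eq by (rule exI)

lemma colspan_linear:
  assumes "a \<in> colspan n X j" "b \<in> colspan n X j"
  shows "(\<lambda>i. s * a i + t * b i) \<in> colspan n X j"
proof -
  obtain c c' where "a = (\<lambda>i. \<Sum>l<j. c l * col n X l i)" "b = (\<lambda>i. \<Sum>l<j. c' l * col n X l i)"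
    using assms by (auto simp: colspan_def)
  then have "(\<lambda>i. s * a i + t * b i) = (\<lambda>i. \<Sum>l<j. (s * c l + t * c' l) * col n X l i)"
    by (auto simp: sum_distrib_left sum.distrib algebra_simps)
  then show ?thesis by (rule colspanI)
qed

lemma colspan_Suc_iff:
  "v \<in> colspan n X (Suc j) \<longleftrightarrow> (\<exists>a\<in>colspan n X j. \<exists>t. v = (\<lambda>i. a i + t * col n X j i))"
proof
  assume "v \<in> colspan n X (Suc j)"
  then obtain c where "v = (\<lambda>i. \<Sum>l<Suc j. c l * col n X l i)" by (auto simp: colspan_def)
  then show "\<exists>a\<in>colspan n X j. \<exists>t. v = (\<lambda>i. a i + t * col n X j i)"
    by (intro bexI[of _ "\<lambda>i. \<Sum>l<j. c l * col n X l i"] exI[of _ "c j"]) (auto simp: colspan_def)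
next
  assume "\<exists>a\<in>colspan n X j. \<exists>t. v = (\<lambda>i. a i + t * col n X j i)"
  then obtain c t where "v = (\<lambda>i. (\<Sum>l<j. c l * col n X l i) + t * col n X j i)"
    by (auto simp: colspan_def)
  then have "v = (\<lambda>i. \<Sum>l<Suc j. (if l = j then t else c l) * col n X l i)"
    by (auto intro!: sum.cong)
  then show "v \<in> colspan n X (Suc j)" by (rule colspanI)
qed

lemma colspan_outside: "v \<in> colspan n X j \<Longrightarrow> \<not> i < n \<Longrightarrow> v i = 0"
  by (auto simp: colspan_def col_def)

text \<open>Indexed from 1 to match \<open>phi\<close>, whereas \<open>colspan\<close> numbers the
  columns from 0.\<close>

definition lin_span :: "(nat \<Rightarrow> nat \<Rightarrow> real) \<Rightarrow> nat \<Rightarrow> (nat \<Rightarrow> real) set" where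
  "lin_span e j = {v. \<exists>c. v = (\<lambda>i. \<Sum>l\<in>{1..j}. c l * e l i)}"

lemma lin_spanI: "v = (\<lambda>i. \<Sum>l\<in>{1..j}. c l * e l i) \<Longrightarrow> v \<in> lin_span e j"
  unfolding lin_span_def mem_Collect_eq by (rule exI)

lemma lin_span_Suc_iff:
  "v \<in> lin_span e (Suc j) \<longleftrightarrow> (\<exists>a\<in>lin_span e j. \<exists>t. v = (\<lambda>i. a i + t * e (Suc j) i))"
proof
  assume "v \<in> lin_span e (Suc j)"
  then obtain c where "v = (\<lambda>i. \<Sum>l\<in>{1..Suc j}. c l * e l i)" by (auto simp: lin_span_def)
  then show "\<exists>a\<in>lin_span e j. \<exists>t. v = (\<lambda>i. a i + t * e (Suc j) i)"
    by (intro bexI[of _ "\<lambda>i. \<Sum>l\<in>{1..j}. c l * e l i"] exI[of _ "c (Suc j)"]) (auto simp: lin_span_def)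
next
  assume "\<exists>a\<in>lin_span e j. \<exists>t. v = (\<lambda>i. a i + t * e (Suc j) i)"
  then obtain c t where "v = (\<lambda>i. (\<Sum>l\<in>{1..j}. c l * e l i) + t * e (Suc j) i)"
    by (auto simp: lin_span_def)
  then have "v = (\<lambda>i. \<Sum>l\<in>{1..Suc j}. (if l = Suc j then t else c l) * e l i)"
    by (auto intro!: sum.cong)
  then show "v \<in> lin_span e (Suc j)" by (rule lin_spanI)
qed

definition orthonormal_upto :: "nat \<Rightarrow> (nat \<Rightarrow> nat \<Rightarrow> real) \<Rightarrow> nat \<Rightarrow> bool" where
  "orthonormal_upto n e j \<longleftrightarrow>
     (\<forall>l\<in>{1..j}. \<forall>m\<in>{1..j}. ipn n (e l) (e m) = (if l = m then 1 else 0))"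

lemma ipn_orthonormal_sum:
  assumes "orthonormal_upto n e j" "m \<in> {1..j}"
  shows "ipn n (\<lambda>i. \<Sum>l\<in>{1..j}. c l * e l i) (e m) = c m"
proof -
  have "ipn n (\<lambda>i. \<Sum>l\<in>{1..j}. c l * e l i) (e m) = (\<Sum>l\<in>{1..j}. if l = m then c l else 0)"
    unfolding ipn_sum_left using assms by (intro sum.cong) (auto simp: orthonormal_upto_def)
  then show ?thesis using assms(2) by simp
qed

text \<open>\<open>proj\<close> is a definite description, so existence and uniqueness are both due.
  The Fourier sum is a candidate; the difference of two candidates lies in the column span and is
  orthogonal to that span, hence to itself.\<close>

lemma proj_eq_orthonormal_sum:
  assumes o: "orthonormal_upto n e j" and sp: "colspan n X j = lin_span e j"
  shows "proj n X j y = (\<lambda>i. \<Sum>l\<in>{1..j}. ipn n (e l) y * e l i)"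
  unfolding proj_def
proof (rule the_equality)
  let ?v = "\<lambda>i. \<Sum>l\<in>{1..j}. ipn n (e l) y * e l i"
  have mem: "?v \<in> colspan n X j" unfolding sp by (rule lin_spanI) simp
  have orth: "ipn n (\<lambda>i. y i - ?v i) u = 0" if u: "u \<in> colspan n X j" for u
  proof -
    obtain c where c: "u = (\<lambda>i. \<Sum>l\<in>{1..j}. c l * e l i)" using u by (auto simp: sp lin_span_def)
    have "ipn n u (\<lambda>i. y i - ?v i) = 0"
      unfolding c ipn_sum_left
    proof (rule sum.neutral, rule ballI)
      fix m assume m: "m \<in> {1..j}"
      show "c m * ipn n (e m) (\<lambda>i. y i - ?v i) = 0"
        unfolding ipn_commute[of n "e m"] ipn_diff_left ipn_orthonormal_sum[OF o m] by simp
    qed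
    then show ?thesis by (simp add: ipn_commute)
  qed
  show "?v \<in> colspan n X j \<and> (\<forall>u\<in>colspan n X j. ipn n (\<lambda>i. y i - ?v i) u = 0)"
    using mem orth by blast
  fix v assume v: "v \<in> colspan n X j \<and> (\<forall>u\<in>colspan n X j. ipn n (\<lambda>i. y i - v i) u = 0)"
  define w where "w = (\<lambda>i. v i - ?v i)"
  have w: "w \<in> colspan n X j"
    using colspan_linear[OF conjunct1[OF v] mem, of 1 "-1"] by (simp add: w_def)
  have "sqn n w = ipn n (\<lambda>i. y i - ?v i) w - ipn n (\<lambda>i. y i - v i) w"
    unfolding sqn_def ipn_diff_left[symmetric] by (simp add: w_def)
  also have "\<dots> = 0" using v w orth by simp
  finally have "w i = 0" if "i < n" for i using that by (simp add: sqn_eq_0_iff)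
  \<comment> \<open>\<open>sqn n\<close> does not see coordinates from \<open>n\<close> on; there
    equality of functions comes from \<open>col\<close> being cut off to 0.\<close>
  moreover have "w i = 0" if "\<not> i < n" for i using colspan_outside[OF w that] .
  ultimately have "w i = 0" for i by blast
  then show "v = ?v" by (auto simp: w_def)
qed

text \<open>Full rank keeps the residual of the next column away from 0, so that \<open>phi\<close>
  is really normalised. The two spans agree at each step because residual and column differ by an
  element of the preceding span. Note the offset: \<open>phi n X (Suc j)\<close> is built from
  column \<open>j\<close>.\<close>

lemma gram_schmidt:
  assumes rank: "full_col_rank n p X" and j: "j \<le> p"
  shows "orthonormal_upto n (phi n X) j \<and> colspan n X j = lin_span (phi n X) j"
  using j
proof (induction j)
  case 0
  then show ?case by (auto simp: orthonormal_upto_def colspan_def lin_span_def)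
next
  case (Suc j)
  then have o: "orthonormal_upto n (phi n X) j" and sp: "colspan n X j = lin_span (phi n X) j"
    and jp: "j < p" by auto
  define q where "q = proj n X j (col n X j)"
  define r where "r = (\<lambda>i. col n X j i - q i)"
  define s where "s = sqrt (sqn n r)"
  note pr = proj_eq_orthonormal_sum[OF o sp]
  have phi: "phi n X (Suc j) = (\<lambda>i. r i / s)" by (simp add: phi_def Let_def r_def q_def s_def)
  have q: "q \<in> colspan n X j" unfolding q_def pr sp by (rule lin_spanI) simp
  have "sqn n r \<noteq> 0"
  proof
    assume "sqn n r = 0"
    then have r0: "col n X j i = q i" if "i < n" for i using that by (simp add: sqn_eq_0_iff r_def)
    obtain c where c: "q = (\<lambda>i. \<Sum>l<j. c l * col n X l i)" using q by (auto simp: colspan_def)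
    \<comment> \<open>If column \<open>j\<close> equalled its projection, these would be the
      coefficients of a vanishing combination of columns, with coefficient 1 at
      \<open>j\<close>.\<close>
    define c' where "c' l = (if l < j then - c l else if l = j then 1 else 0)" for l
    have "(\<Sum>l<p. X i l * c' l) = 0" if i: "i < n" for i
    proof -
      have "(\<Sum>l<p. X i l * c' l) = (\<Sum>l<Suc j. X i l * c' l)"
        using jp by (intro sum.mono_neutral_right) (auto simp: c'_def)
      also have "\<dots> = X i j - (\<Sum>l<j. c l * X i l)"
        by (simp add: c'_def sum_negf mult.commute)
      also have "\<dots> = 0" using r0[OF i] i by (simp add: c col_def)
      finally show ?thesis .
    qed
    then have "c' j = 0" using rank jp unfolding full_col_rank_def by blast
    then show False by (simp add: c'_def)
  qed
  then have s0: "s > 0" using sqn_nonneg[of n r] by (simp add: s_def)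
  have rphi: "r = (\<lambda>i. s * phi n X (Suc j) i)" using s0 by (simp add: phi)
  have unit: "ipn n (phi n X (Suc j)) (phi n X (Suc j)) = 1"
  proof -
    have "ipn n (phi n X (Suc j)) (phi n X (Suc j)) = sqn n r / s\<^sup>2"
      by (simp add: phi ipn_def sqn_def sum_divide_distrib power2_eq_square)
    then show ?thesis using s0 sqn_nonneg[of n r] by (simp add: s_def)
  qed
  have orth: "ipn n (phi n X (Suc j)) (phi n X m) = 0" if m: "m \<in> {1..j}" for m
  proof -
    have "ipn n r (phi n X m) = 0"
      unfolding r_def ipn_diff_left q_def pr ipn_orthonormal_sum[OF o m] by (simp add: ipn_commute)
    moreover have "ipn n r (phi n X m) = s * ipn n (phi n X (Suc j)) (phi n X m)"
      by (subst rphi) (rule ipn_scale_left)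
    ultimately show ?thesis using s0 by simp
  qed
  have 1: "orthonormal_upto n (phi n X) (Suc j)"
    using o unit orth ipn_commute unfolding orthonormal_upto_def by (auto simp: le_Suc_eq)
  have 2: "colspan n X (Suc j) = lin_span (phi n X) (Suc j)"
  proof (rule set_eqI, rule iffI)
    fix v assume "v \<in> colspan n X (Suc j)"
    then obtain a t where a: "a \<in> colspan n X j" and v: "v = (\<lambda>i. a i + t * col n X j i)"
      by (auto simp: colspan_Suc_iff)
    have "v = (\<lambda>i. (1 * a i + t * q i) + (t * s) * phi n X (Suc j) i)"
      using fun_cong[OF rphi] by (auto simp: v r_def fun_eq_iff algebra_simps)
    moreover have "(\<lambda>i. 1 * a i + t * q i) \<in> lin_span (phi n X) j"
      using colspan_linear[OF a q] by (simp only: sp)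
    ultimately show "v \<in> lin_span (phi n X) (Suc j)" unfolding lin_span_Suc_iff
      by (intro bexI[of _ "\<lambda>i. 1 * a i + t * q i"] exI[of _ "t * s"])
  next
    fix v assume "v \<in> lin_span (phi n X) (Suc j)"
    then obtain a t where a: "a \<in> colspan n X j" and v: "v = (\<lambda>i. a i + t * phi n X (Suc j) i)"
      by (auto simp: lin_span_Suc_iff sp)
    have "v = (\<lambda>i. (1 * a i + (- (t / s)) * q i) + (t / s) * col n X j i)"
      by (auto simp: v phi r_def fun_eq_iff algebra_simps diff_divide_distrib)
    moreover have "(\<lambda>i. 1 * a i + (- (t / s)) * q i) \<in> colspan n X j"
      by (rule colspan_linear[OF a q])
    ultimately show "v \<in> colspan n X (Suc j)" unfolding colspan_Suc_iff
      by (intro bexI[of _ "\<lambda>i. 1 * a i + (- (t / s)) * q i"] exI[of _ "t / s"])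
  qed
  show ?case using 1 2 by blast
qed

lemma proj_eq_phi_sum:
  assumes "full_col_rank n p X" "j \<le> p"
  shows "proj n X j y = (\<lambda>i. \<Sum>l\<in>{1..j}. ipn n (phi n X l) y * phi n X l i)"
  using gram_schmidt[OF assms] by (intro proj_eq_orthonormal_sum) auto

lemma sqn_orthonormal_sum:
  assumes "orthonormal_upto n e j"
  shows "sqn n (\<lambda>i. \<Sum>l\<in>{1..j}. a l * e l i) = (\<Sum>l\<in>{1..j}. (a l)\<^sup>2)"
  unfolding sqn_def by (subst ipn_sum_left)
    (intro sum.cong refl, simp only: ipn_commute[of n "e _"] ipn_orthonormal_sum[OF assms] power2_eq_square)

text \<open>Here \<open>y\<close> may have a component outside the span, so the same expansion
  serves the loss (with the signal), the criterion (with the data), the residual variance and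
  Bessel's inequality.\<close>

lemma sqn_diff_orthonormal_sum:
  assumes "orthonormal_upto n e j"
  shows "sqn n (\<lambda>i. y i - (\<Sum>l\<in>{1..j}. a l * e l i))
    = sqn n y - 2 * (\<Sum>l\<in>{1..j}. a l * ipn n (e l) y) + (\<Sum>l\<in>{1..j}. (a l)\<^sup>2)"
  unfolding sqn_diff sqn_orthonormal_sum[OF assms] ipn_commute[of n y] ipn_sum_left by simp

text \<open>Parseval's identity: a signal of the form \<open>X \<beta>\<close> has no component
  outside the column space. It feeds the analysis of the residual variance estimator, where such a
  component would act as additional bias.\<close>

lemma sqn_fvec_eq:
  assumes "full_col_rank n p X"
  shows "sqn n (fvec n p X b) = (\<Sum>l\<in>{1..p}. (ipn n (phi n X l) (fvec n p X b))\<^sup>2)"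
proof -
  have "fvec n p X b = (\<lambda>i. \<Sum>l<p. b l * col n X l i)"
    by (auto simp: fvec_def col_def mult.commute)
  then have "fvec n p X b \<in> colspan n X p" by (rule colspanI)
  then obtain c where c: "fvec n p X b = (\<lambda>i. \<Sum>l\<in>{1..p}. c l * phi n X l i)"
    using gram_schmidt[OF assms, of p] by (auto simp: lin_span_def)
  have o: "orthonormal_upto n (phi n X) p" using gram_schmidt[OF assms, of p] by simp
  show ?thesis unfolding c sqn_orthonormal_sum[OF o]
    by (intro sum.cong refl) (simp only: ipn_commute[of n "phi n X _"] ipn_orthonormal_sum[OF o])
qed

section \<open>Second moments of linear and quadratic forms\<close>

definition square_integrable :: "'a measure \<Rightarrow> ('a \<Rightarrow> real) \<Rightarrow> bool" where
  "square_integrable M g \<longleftrightarrow> g \<in> borel_measurable M \<and> integrable M (\<lambda>x. (g x)\<^sup>2)"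

lemma square_integrableD:
  assumes "square_integrable M g"
  shows "g \<in> borel_measurable M" "integrable M (\<lambda>x. (g x)\<^sup>2)"
  using assms by (auto simp: square_integrable_def)

lemma square_integrable_mult:
  assumes "square_integrable M g" "square_integrable M h"
  shows "integrable M (\<lambda>x. g x * h x)"
proof (rule Bochner_Integration.integrable_bound)
  show "integrable M (\<lambda>x. (g x)\<^sup>2 + (h x)\<^sup>2)" using assms by (auto simp: square_integrable_def)
  show "(\<lambda>x. g x * h x) \<in> borel_measurable M" using assms by (auto simp: square_integrable_def)
  have "\<bar>a * b\<bar> \<le> a\<^sup>2 + b\<^sup>2" for a b :: real
  proof -
    have "0 \<le> \<bar>a\<bar> * \<bar>b\<bar>" by simp
    then show ?thesis using sum_squares_bound[of "\<bar>a\<bar>" "\<bar>b\<bar>"] by (simp only: abs_mult power2_abs)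
  qed
  then show "AE x in M. norm (g x * h x) \<le> norm ((g x)\<^sup>2 + (h x)\<^sup>2)" by simp
qed

lemma square_integrable_add:
  assumes "square_integrable M g" "square_integrable M h"
  shows "square_integrable M (\<lambda>x. g x + h x)"
  using assms square_integrable_mult[OF assms]
  by (auto simp: square_integrable_def power2_sum mult.assoc)

lemma square_integrable_scale:
  "square_integrable M g \<Longrightarrow> square_integrable M (\<lambda>x. c * g x)"
  by (auto simp: square_integrable_def power_mult_distrib)

lemma square_integrable_diff:
  assumes "square_integrable M g" "square_integrable M h"
  shows "square_integrable M (\<lambda>x. g x - h x)"
  using square_integrable_add[OF assms(1) square_integrable_scale[OF assms(2), of "-1"]] by simp

lemma square_integrable_sum:
  "(\<And>i. i \<in> A \<Longrightarrow> square_integrable M (g i)) \<Longrightarrow> square_integrable M (\<lambda>x. \<Sum>i\<in>A. g i x)"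
proof (induction A rule: infinite_finite_induct)
  case (insert i A)
  then show ?case using square_integrable_add[of M "g i" "\<lambda>x. \<Sum>i\<in>A. g i x"] by simp
qed (simp_all add: square_integrable_def)

lemma (in finite_measure) square_integrable_const: "square_integrable M (\<lambda>_. c)"
  by (simp add: square_integrable_def)

lemma (in finite_measure) square_integrable_imp_integrable:
  "square_integrable M g \<Longrightarrow> integrable M g"
  using square_integrable_mult[of M g "\<lambda>_. 1"] square_integrable_const[of 1] by simp

text \<open>A quadratic form minus its mean, when the \<open>v i\<close> are uncorrelated, centred
  and of variance \<open>s\<close>.\<close>

definition centred_quad :: "(nat \<Rightarrow> nat \<Rightarrow> real) \<Rightarrow> real \<Rightarrow> nat \<Rightarrow> (nat \<Rightarrow> real) \<Rightarrow> real" where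
  "centred_quad a s n v = (\<Sum>i<n. \<Sum>j<n. a i j * (v i * v j)) - s * (\<Sum>i<n. a i i)"

locale noise_model =
  fixes M :: "'a measure" and \<epsilon> :: "nat \<Rightarrow> 'a \<Rightarrow> real" and \<sigma> :: real
  assumes noise: "iid_noise M \<epsilon> \<sigma>"
begin

sublocale prob_space M using noise by (simp add: iid_noise_def)

lemma noise_indep: "indep_vars (\<lambda>_. borel) \<epsilon> UNIV"
  using noise by (simp add: iid_noise_def)

lemma noise_measurable [measurable]: "\<epsilon> i \<in> borel_measurable M"
  using noise_indep by (auto simp: indep_vars_def)

lemma sigma_pos: "\<sigma> > 0"
  using noise by (simp add: iid_noise_def)

lemma noise_distr: "distr M borel (\<epsilon> i) = distr M borel (\<epsilon> 0)"
  using noise unfolding iid_noise_def by blast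

lemma noise_integrable_iff:
  assumes "g \<in> borel_measurable borel"
  shows "integrable M (\<lambda>x. g (\<epsilon> i x) :: real) \<longleftrightarrow> integrable M (\<lambda>x. g (\<epsilon> 0 x))"
  using assms by (subst (1 2) integrable_distr_eq[symmetric, where N=borel]) (simp_all add: noise_distr[of i])

lemma noise_integral_eq:
  assumes "g \<in> borel_measurable borel"
  shows "(\<integral>x. g (\<epsilon> i x) \<partial>M) = (\<integral>x. g (\<epsilon> 0 x) \<partial>M :: real)"
  using assms by (subst (1 2) integral_distr[symmetric, where N=borel]) (simp_all add: noise_distr[of i])

text \<open>The sub-Gaussian condition supplies exponential moments at 1 and -1, and their sum
  dominates the fourth power.\<close>

lemma noise_fourth_integrable: "integrable M (\<lambda>x. (\<epsilon> i x)^4)"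
proof -
  obtain c where "\<And>t. integrable M (\<lambda>x. exp (t * \<epsilon> 0 x))"
    using noise by (auto simp: iid_noise_def subgaussian_def)
  from this[of 1] this[of "-1"]
  have ie: "integrable M (\<lambda>x. 24 * (exp (\<epsilon> 0 x) + exp (- \<epsilon> 0 x)))" by simp
  have pw: "t^4 \<le> 24 * (exp t + exp (- t))" for t :: real
  proof -
    have "t^4 = \<bar>t\<bar>^4" by simp
    \<comment> \<open>The constant is 4!, from the single term of degree 4 in the exponential
      series.\<close>
    also have "\<bar>t\<bar>^4 \<le> 24 * exp \<bar>t\<bar>"
      using sum_le_suminf[OF summable_exp_generic[of "\<bar>t\<bar>"], of "{4}"]
      by (simp add: exp_def scaleR_conv_of_real fact_numeral field_simps)
    also have "exp \<bar>t\<bar> \<le> exp t + exp (- t)" by (cases "t \<ge> 0") auto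
    finally show ?thesis by simp
  qed
  have "integrable M (\<lambda>x. (\<epsilon> 0 x)^4)"
    by (rule Bochner_Integration.integrable_bound[OF ie]) (use pw in \<open>auto simp: add_nonneg_nonneg\<close>)
  then show ?thesis using noise_integrable_iff[of "\<lambda>y. y^4" i] by simp
qed

definition fourth_moment :: real where "fourth_moment = (\<integral>x. (\<epsilon> 0 x)^4 \<partial>M)"

lemma fourth_moment_nonneg: "0 \<le> fourth_moment"
  by (simp add: fourth_moment_def)

lemma noise_square_sqint: "square_integrable M (\<lambda>x. (\<epsilon> i x)\<^sup>2)"
  using noise_fourth_integrable[of i] by (simp add: square_integrable_def)

lemma noise_sqint: "square_integrable M (\<epsilon> i)"
  using square_integrable_imp_integrable[OF noise_square_sqint] by (simp add: square_integrable_def)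

lemma noise_prod_sqint: "square_integrable M (\<lambda>x. \<epsilon> i x * \<epsilon> j x)"
  using square_integrable_mult[OF noise_square_sqint[of i] noise_square_sqint[of j]]
  by (simp add: square_integrable_def power_mult_distrib)

lemma noise_mean: "(\<integral>x. \<epsilon> i x \<partial>M) = 0"
  using noise noise_integral_eq[of "\<lambda>y. y" i] by (simp add: iid_noise_def)

lemma noise_variance: "(\<integral>x. (\<epsilon> i x)\<^sup>2 \<partial>M) = \<sigma>\<^sup>2"
  using noise noise_integral_eq[of "\<lambda>y. y\<^sup>2" i] by (simp add: iid_noise_def)

lemma noise_square_variance: "(\<integral>x. ((\<epsilon> i x)\<^sup>2 - \<sigma>\<^sup>2)\<^sup>2 \<partial>M) \<le> fourth_moment"
proof -
  have "(\<integral>x. ((\<epsilon> i x)\<^sup>2 - \<sigma>\<^sup>2)\<^sup>2 \<partial>M) = (\<integral>x. (\<epsilon> i x)^4 - 2 * \<sigma>\<^sup>2 * (\<epsilon> i x)\<^sup>2 + \<sigma>^4 \<partial>M)"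
    by (intro Bochner_Integration.integral_cong) (auto simp: power2_diff algebra_simps)
  also have "\<dots> = fourth_moment - 2 * \<sigma>\<^sup>2 * \<sigma>\<^sup>2 + \<sigma>^4"
    using noise_fourth_integrable[of i] noise_integral_eq[of "\<lambda>y. y^4" i]
      square_integrable_imp_integrable[OF noise_square_sqint]
    by (simp add: noise_variance fourth_moment_def prob_space)
  also have "\<dots> \<le> fourth_moment"
  proof -
    have "\<sigma>^4 = \<sigma>\<^sup>2 * \<sigma>\<^sup>2" by (simp add: power4_eq_xxxx power2_eq_square)
    moreover have "0 \<le> \<sigma>\<^sup>2 * \<sigma>\<^sup>2" by simp
    ultimately show ?thesis by linarith
  qed
  finally show ?thesis .
qed

text \<open>Invariance of \<open>F\<close> under restriction says that it is a function of the first
  \<open>n\<close> errors. These are independent of error \<open>n\<close> as a group, so the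
  expectation factorises; with a centred \<open>G\<close> this is the martingale difference
  property.\<close>

lemma expectation_past_mult:
  fixes F :: "(nat \<Rightarrow> real) \<Rightarrow> real" and G :: "real \<Rightarrow> real"
  assumes F: "F \<in> borel_measurable (PiM {..<n} (\<lambda>_. borel))" "\<And>v. F (restrict v {..<n}) = F v"
    and G: "G \<in> borel_measurable borel"
    and int: "integrable M (\<lambda>x. F (\<lambda>i. \<epsilon> i x))" "integrable M (\<lambda>x. G (\<epsilon> n x))"
  shows "(\<integral>x. F (\<lambda>i. \<epsilon> i x) * G (\<epsilon> n x) \<partial>M) = (\<integral>x. F (\<lambda>i. \<epsilon> i x) \<partial>M) * (\<integral>x. G (\<epsilon> n x) \<partial>M)"
proof -
  have "indep_var borel (F \<circ> (\<lambda>x. restrict (\<lambda>i. \<epsilon> i x) {..<n}))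
      borel ((\<lambda>v. G (v n)) \<circ> (\<lambda>x. restrict (\<lambda>i. \<epsilon> i x) {n}))"
    using G F by (intro indep_var_compose[OF indep_var_restrict[OF noise_indep]])
      (auto intro!: measurable_compose[OF measurable_component_singleton])
  then have "indep_var borel (\<lambda>x. F (\<lambda>i. \<epsilon> i x)) borel (\<lambda>x. G (\<epsilon> n x))"
    by (simp add: comp_def F(2))
  then show ?thesis using int by (rule indep_var_lebesgue_integral)
qed

lemma linear_form_sqint: "square_integrable M (\<lambda>x. \<Sum>i<n. b i * \<epsilon> i x)"
  by (intro square_integrable_sum square_integrable_scale noise_sqint)

lemma linear_form_second_moment:
  "(\<integral>x. (\<Sum>i<n. b i * \<epsilon> i x)\<^sup>2 \<partial>M) = \<sigma>\<^sup>2 * (\<Sum>i<n. (b i)\<^sup>2)"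
proof (induction n)
  case 0
  then show ?case by simp
next
  case (Suc n)
  let ?Z = "\<lambda>x. \<Sum>i<n. b i * \<epsilon> i x"
  have "(\<integral>x. ?Z x * \<epsilon> n x \<partial>M) = (\<integral>x. ?Z x \<partial>M) * (\<integral>x. \<epsilon> n x \<partial>M)"
    by (rule expectation_past_mult[of "\<lambda>v. \<Sum>i<n. b i * v i" n "\<lambda>y. y"])
      (simp_all add: square_integrable_imp_integrable[OF linear_form_sqint]
        square_integrable_imp_integrable[OF noise_sqint])
  then have cr: "(\<integral>x. ?Z x * \<epsilon> n x \<partial>M) = 0" by (simp add: noise_mean)
  have "(\<integral>x. (\<Sum>i<Suc n. b i * \<epsilon> i x)\<^sup>2 \<partial>M)
      = (\<integral>x. (?Z x)\<^sup>2 + (2 * b n) * (?Z x * \<epsilon> n x) + (b n)\<^sup>2 * (\<epsilon> n x)\<^sup>2 \<partial>M)"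
    by (intro Bochner_Integration.integral_cong) (auto simp: power2_eq_square algebra_simps)
  also have "\<dots> = \<sigma>\<^sup>2 * (\<Sum>i<n. (b i)\<^sup>2) + (b n)\<^sup>2 * \<sigma>\<^sup>2"
    using square_integrableD(2)[OF linear_form_sqint[of b n]] square_integrableD(2)[OF noise_sqint[of n]]
      square_integrable_mult[OF linear_form_sqint[of b n] noise_sqint[of n]]
    by (simp add: Suc.IH cr noise_variance)
  finally show ?case by (simp add: algebra_simps)
qed

lemma centred_quad_sqint: "square_integrable M (\<lambda>x. centred_quad a (\<sigma>\<^sup>2) n (\<lambda>i. \<epsilon> i x))"
  unfolding centred_quad_def
  by (intro square_integrable_diff square_integrable_sum square_integrable_scale noise_prod_sqint
      square_integrable_const)

text \<open>The increments of the quadratic forms in the first \<open>n\<close> errors are martingale differences,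
  so their second moments add up.\<close>
lemma centred_quad_moments:
  assumes sym: "\<And>i j. a i j = a j i"
  shows "(\<integral>x. centred_quad a (\<sigma>\<^sup>2) n (\<lambda>i. \<epsilon> i x) \<partial>M) = 0
    \<and> (\<integral>x. (centred_quad a (\<sigma>\<^sup>2) n (\<lambda>i. \<epsilon> i x))\<^sup>2 \<partial>M)
      \<le> (4 * \<sigma>^4 + 2 * fourth_moment) * (\<Sum>i<n. \<Sum>j<n. (a i j)\<^sup>2)"
proof (induction n)
  case 0
  then show ?case by (simp add: centred_quad_def)
next
  case (Suc n)
  let ?C = "4 * \<sigma>^4 + 2 * fourth_moment"
  define q where "q v = centred_quad a (\<sigma>\<^sup>2) n v" for v
  define z where "z v = (\<Sum>i<n. a i n * v i)" for v :: "nat \<Rightarrow> real"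
  define Q where "Q x = q (\<lambda>i. \<epsilon> i x)" for x
  define Z where "Z x = z (\<lambda>i. \<epsilon> i x)" for x
  define H where "H x = (\<epsilon> n x)\<^sup>2 - \<sigma>\<^sup>2" for x
  have res: "q (restrict v {..<n}) = q v" "z (restrict v {..<n}) = z v" for v
    by (simp_all add: q_def z_def centred_quad_def)
  have meas: "q \<in> borel_measurable (PiM {..<n} (\<lambda>_. borel))" "z \<in> borel_measurable (PiM {..<n} (\<lambda>_. borel))"
    unfolding q_def[abs_def] z_def[abs_def] centred_quad_def by measurable
  have Qs: "square_integrable M Q" unfolding Q_def[abs_def] q_def by (rule centred_quad_sqint)
  have Zs: "square_integrable M Z" unfolding Z_def[abs_def] z_def by (rule linear_form_sqint)
  have Hs: "square_integrable M H" unfolding H_def[abs_def]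
    by (intro square_integrable_diff noise_square_sqint square_integrable_const)
  have H0: "(\<integral>x. H x \<partial>M) = 0"
    using square_integrable_imp_integrable[OF noise_square_sqint[of n]]
    by (simp add: H_def noise_variance prob_space)
  have ZZ: "(\<integral>x. (Z x)\<^sup>2 \<partial>M) = \<sigma>\<^sup>2 * (\<Sum>i<n. (a i n)\<^sup>2)"
    unfolding Z_def z_def by (rule linear_form_second_moment)
  have HH: "(\<integral>x. (H x)\<^sup>2 \<partial>M) \<le> fourth_moment" unfolding H_def by (rule noise_square_variance)
  have q0: "(\<integral>x. Q x \<partial>M) = 0" and qq: "(\<integral>x. (Q x)\<^sup>2 \<partial>M) \<le> ?C * (\<Sum>i<n. \<Sum>j<n. (a i j)\<^sup>2)"
    using Suc by (simp_all add: Q_def q_def)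
  note ints = square_integrable_imp_integrable[OF Qs] square_integrable_imp_integrable[OF Zs]
    square_integrable_imp_integrable[OF Hs] square_integrable_imp_integrable[OF noise_sqint[of n]]
  have "(\<integral>x. Z x * \<epsilon> n x \<partial>M) = (\<integral>x. Z x \<partial>M) * (\<integral>x. \<epsilon> n x \<partial>M)"
    unfolding Z_def by (rule expectation_past_mult[of z n "\<lambda>y. y"])
      (use meas res ints in \<open>simp_all add: Z_def[abs_def]\<close>)
  then have Ze: "(\<integral>x. Z x * \<epsilon> n x \<partial>M) = 0" by (simp add: noise_mean)
  have "(\<integral>x. (q (\<lambda>i. \<epsilon> i x) * z (\<lambda>i. \<epsilon> i x)) * \<epsilon> n x \<partial>M)
      = (\<integral>x. q (\<lambda>i. \<epsilon> i x) * z (\<lambda>i. \<epsilon> i x) \<partial>M) * (\<integral>x. \<epsilon> n x \<partial>M)"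
    by (rule expectation_past_mult[of "\<lambda>v. q v * z v" n "\<lambda>y. y"])
      (use meas res ints square_integrable_mult[OF Qs Zs] in \<open>simp_all add: Z_def[abs_def] Q_def[abs_def]\<close>)
  then have QZe: "(\<integral>x. (Q x * Z x) * \<epsilon> n x \<partial>M) = 0" by (simp add: Z_def Q_def noise_mean)
  have "(\<integral>x. q (\<lambda>i. \<epsilon> i x) * ((\<epsilon> n x)\<^sup>2 - \<sigma>\<^sup>2) \<partial>M)
      = (\<integral>x. q (\<lambda>i. \<epsilon> i x) \<partial>M) * (\<integral>x. (\<epsilon> n x)\<^sup>2 - \<sigma>\<^sup>2 \<partial>M)"
    by (rule expectation_past_mult[of q n "\<lambda>y. y\<^sup>2 - \<sigma>\<^sup>2"])
      (use meas res ints in \<open>simp_all add: H_def[abs_def] Q_def[abs_def]\<close>)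
  then have QH: "(\<integral>x. Q x * H x \<partial>M) = 0" using H0 by (simp add: H_def Q_def)
  have "(\<integral>x. (z (\<lambda>i. \<epsilon> i x))\<^sup>2 * (\<epsilon> n x)\<^sup>2 \<partial>M)
      = (\<integral>x. (z (\<lambda>i. \<epsilon> i x))\<^sup>2 \<partial>M) * (\<integral>x. (\<epsilon> n x)\<^sup>2 \<partial>M)"
    by (rule expectation_past_mult[of "\<lambda>v. (z v)\<^sup>2" n "\<lambda>y. y\<^sup>2"])
      (use meas res square_integrableD(2)[OF Zs] square_integrableD(2)[OF noise_sqint[of n]] in
        \<open>simp_all add: Z_def[abs_def]\<close>)
  then have ZZee: "(\<integral>x. (Z x)\<^sup>2 * (\<epsilon> n x)\<^sup>2 \<partial>M) = \<sigma>\<^sup>2 * (\<Sum>i<n. (a i n)\<^sup>2) * \<sigma>\<^sup>2"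
    using ZZ by (simp add: Z_def noise_variance)
  have Zes: "square_integrable M (\<lambda>x. Z x * \<epsilon> n x)"
  proof -
    have "square_integrable M (\<lambda>x. \<Sum>i<n. a i n * (\<epsilon> i x * \<epsilon> n x))"
      by (intro square_integrable_sum square_integrable_scale noise_prod_sqint)
    then show ?thesis by (simp add: Z_def z_def sum_distrib_right mult.assoc)
  qed
  \<comment> \<open>The increment when row and column \<open>n\<close> are added: by symmetry both
    give \<open>Z x * \<epsilon> n x\<close>, hence the factor 2, and the diagonal entry meets the
    centred square \<open>H\<close>.\<close>
  define R where "R x = 2 * (Z x * \<epsilon> n x) + a n n * H x" for x
  have Rs: "square_integrable M R" unfolding R_def[abs_def]
    by (intro square_integrable_add square_integrable_scale Zes Hs)
  have sw: "(\<Sum>j<n. a n j * g j) = (\<Sum>j<n. a j n * g j)" for g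
    by (intro sum.cong refl arg_cong2[where f="(*)"] sym)
  have sw2: "(\<Sum>j<n. (a n j)\<^sup>2) = (\<Sum>j<n. (a j n)\<^sup>2)"
    by (intro sum.cong refl arg_cong2[where f=power] sym)
  have e1: "(\<Sum>i<n. a i n * (\<epsilon> i x * \<epsilon> n x)) = Z x * \<epsilon> n x" for x
    by (simp add: Z_def z_def sum_distrib_right mult.assoc)
  have e2: "(\<Sum>j<n. a n j * (\<epsilon> n x * \<epsilon> j x)) = Z x * \<epsilon> n x" for x
    unfolding sw e1[symmetric] by (intro sum.cong refl) (simp add: mult.commute)
  have step: "centred_quad a (\<sigma>\<^sup>2) (Suc n) (\<lambda>i. \<epsilon> i x) = Q x + R x" for x
    unfolding centred_quad_def Q_def q_def R_def H_def
    by (simp add: sum.distrib e1 e2) (simp add: algebra_simps power2_eq_square)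
  have R0: "(\<integral>x. R x \<partial>M) = 0"
    using ints square_integrable_imp_integrable[OF Zes] by (simp add: R_def Ze H0)
  have QR: "(\<integral>x. Q x * R x \<partial>M) = 0"
  proof -
    have "(\<integral>x. Q x * R x \<partial>M) = (\<integral>x. 2 * ((Q x * Z x) * \<epsilon> n x) + a n n * (Q x * H x) \<partial>M)"
      by (intro Bochner_Integration.integral_cong) (auto simp: R_def algebra_simps)
    also have "\<dots> = 2 * (\<integral>x. (Q x * Z x) * \<epsilon> n x \<partial>M) + a n n * (\<integral>x. Q x * H x \<partial>M)"
      using square_integrable_mult[OF Qs Zes] square_integrable_mult[OF Qs Hs]
      by (subst Bochner_Integration.integral_add) (simp_all add: mult.assoc)
    also have "\<dots> = 0" by (simp add: QH QZe)
    finally show ?thesis .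
  qed
  \<comment> \<open>The square of a sum is at most twice the sum of the squares, so the cross part
    costs \<open>8 * \<sigma>^4\<close>. Off-diagonal entries occur twice in the squared Frobenius
    norm, so \<open>4 * \<sigma>^4\<close> is enough in the constant of the lemma.\<close>
  have RR: "(\<integral>x. (R x)\<^sup>2 \<partial>M) \<le> 8 * \<sigma>^4 * (\<Sum>i<n. (a i n)\<^sup>2) + 2 * fourth_moment * (a n n)\<^sup>2"
  proof -
    have "(\<integral>x. (R x)\<^sup>2 \<partial>M) \<le> (\<integral>x. 8 * ((Z x)\<^sup>2 * (\<epsilon> n x)\<^sup>2) + 2 * (a n n)\<^sup>2 * (H x)\<^sup>2 \<partial>M)"
    proof (rule integral_mono)
      show "integrable M (\<lambda>x. 8 * ((Z x)\<^sup>2 * (\<epsilon> n x)\<^sup>2) + 2 * (a n n)\<^sup>2 * (H x)\<^sup>2)"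
        using square_integrableD(2)[OF Zes] square_integrableD(2)[OF Hs] by (simp add: power_mult_distrib)
      fix x
      show "(R x)\<^sup>2 \<le> 8 * ((Z x)\<^sup>2 * (\<epsilon> n x)\<^sup>2) + 2 * (a n n)\<^sup>2 * (H x)\<^sup>2"
        using zero_le_power2[of "2 * (Z x * \<epsilon> n x) - a n n * H x"]
        by (simp add: R_def power2_eq_square algebra_simps)
    qed (rule square_integrableD[OF Rs])
    also have "\<dots> = 8 * (\<sigma>\<^sup>2 * (\<Sum>i<n. (a i n)\<^sup>2) * \<sigma>\<^sup>2) + 2 * (a n n)\<^sup>2 * (\<integral>x. (H x)\<^sup>2 \<partial>M)"
      using square_integrableD(2)[OF Zes] square_integrableD(2)[OF Hs]
      by (simp add: power_mult_distrib ZZee)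
    also have "\<dots> \<le> 8 * (\<sigma>\<^sup>2 * (\<Sum>i<n. (a i n)\<^sup>2) * \<sigma>\<^sup>2) + 2 * (a n n)\<^sup>2 * fourth_moment"
      using HH by (intro add_left_mono mult_left_mono) auto
    finally show ?thesis by (simp add: power2_eq_square power4_eq_xxxx algebra_simps)
  qed
  have "(\<integral>x. (Q x + R x)\<^sup>2 \<partial>M) = (\<integral>x. (Q x)\<^sup>2 + 2 * (Q x * R x) + (R x)\<^sup>2 \<partial>M)"
    by (intro Bochner_Integration.integral_cong) (auto simp: power2_eq_square algebra_simps)
  also have "\<dots> = (\<integral>x. (Q x)\<^sup>2 \<partial>M) + (\<integral>x. (R x)\<^sup>2 \<partial>M)"
    using square_integrableD(2)[OF Qs] square_integrableD(2)[OF Rs] square_integrable_mult[OF Qs Rs]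
    by (simp add: QR)
  also have "\<dots> \<le> ?C * (\<Sum>i<n. \<Sum>j<n. (a i j)\<^sup>2) + ?C * (2 * (\<Sum>i<n. (a i n)\<^sup>2) + (a n n)\<^sup>2)"
  proof -
    have "0 \<le> 4 * fourth_moment * (\<Sum>i<n. (a i n)\<^sup>2) + 4 * \<sigma>^4 * (a n n)\<^sup>2"
      by (intro add_nonneg_nonneg mult_nonneg_nonneg sum_nonneg) (auto simp: fourth_moment_nonneg)
    then show ?thesis using qq RR by (simp add: algebra_simps)
  qed
  also have "\<dots> = ?C * (\<Sum>i<Suc n. \<Sum>j<Suc n. (a i j)\<^sup>2)"
    by (simp add: sum.distrib sw2 algebra_simps)
  finally have "(\<integral>x. (Q x + R x)\<^sup>2 \<partial>M) \<le> ?C * (\<Sum>i<Suc n. \<Sum>j<Suc n. (a i j)\<^sup>2)" .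
  then show ?case using ints(1) square_integrable_imp_integrable[OF Rs]
    unfolding step by (simp add: q0 R0)
qed

end

section \<open>Risk, loss and criterion in the basis\<close>

lemma (in noise_model) ipn_noise_sqint: "square_integrable M (\<lambda>x. ipn n u (\<lambda>i. \<epsilon> i x))"
  unfolding ipn_def by (rule linear_form_sqint)

lemma (in noise_model) ipn_noise_mean: "(\<integral>x. ipn n u (\<lambda>i. \<epsilon> i x) \<partial>M) = 0"
  using square_integrable_imp_integrable[OF noise_sqint] by (simp add: ipn_def noise_mean)

lemma (in noise_model) ipn_noise_second_moment:
  "(\<integral>x. (ipn n u (\<lambda>i. \<epsilon> i x))\<^sup>2 \<partial>M) = \<sigma>\<^sup>2 * sqn n u"
  unfolding ipn_def linear_form_second_moment by (simp add: sqn_def ipn_def power2_eq_square)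

definition (in noise_model) quad_const :: real where "quad_const = 4 * \<sigma>^4 + 2 * fourth_moment"

lemma (in noise_model) quad_const_nonneg: "0 \<le> quad_const"
  using fourth_moment_nonneg sigma_pos by (simp add: quad_const_def)

locale regression_model = noise_model M \<epsilon> \<sigma>
  for M :: "'a measure" and \<epsilon> :: "nat \<Rightarrow> 'a \<Rightarrow> real" and \<sigma> :: real +
  fixes n p :: nat and X :: "nat \<Rightarrow> nat \<Rightarrow> real" and f :: "nat \<Rightarrow> real"
  assumes rank: "full_col_rank n p X" and n_pos: "1 \<le> n"
begin

text \<open>This is \<open>sqrt n\<close> times \<open>theta n X f l\<close>; all quantities are
  kept on the scale of \<open>n\<close> times the risk.\<close>

definition signal_coef :: "nat \<Rightarrow> real" where
  "signal_coef l = ipn n (phi n X l) f"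

definition noise_coef :: "'a \<Rightarrow> nat \<Rightarrow> real" where
  "noise_coef x l = ipn n (phi n X l) (\<lambda>i. \<epsilon> i x)"

definition excess :: "'a \<Rightarrow> nat \<Rightarrow> real" where
  "excess x l = (noise_coef x l)\<^sup>2 - \<sigma>\<^sup>2"

lemma orthonormal: "orthonormal_upto n (phi n X) p"
  using gram_schmidt[OF rank, of p] by simp

lemma ipn_phi: "l \<in> {1..p} \<Longrightarrow> m \<in> {1..p} \<Longrightarrow> ipn n (phi n X l) (phi n X m) = (if l = m then 1 else 0)"
  using orthonormal unfolding orthonormal_upto_def by blast

lemma noisy_coef: "ipn n (phi n X l) (noisy n f \<epsilon> x) = signal_coef l + noise_coef x l"
  by (simp add: ipn_def noisy_def signal_coef_def noise_coef_def distrib_left sum.distrib)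

lemma noise_coef_sqint: "square_integrable M (\<lambda>x. noise_coef x l)"
  unfolding noise_coef_def by (rule ipn_noise_sqint)

lemma noise_coef_integrable: "integrable M (\<lambda>x. noise_coef x l)"
  using square_integrable_imp_integrable[OF noise_coef_sqint] .

lemma noise_coef_mean: "(\<integral>x. noise_coef x l \<partial>M) = 0"
  unfolding noise_coef_def by (rule ipn_noise_mean)

lemma noise_coef_second_moment: "l \<in> {1..p} \<Longrightarrow> (\<integral>x. (noise_coef x l)\<^sup>2 \<partial>M) = \<sigma>\<^sup>2"
  unfolding noise_coef_def ipn_noise_second_moment by (simp add: sqn_def ipn_phi)

lemma signal_noise_sum:
  "(\<Sum>l\<in>L. b l * noise_coef x l) = ipn n (\<lambda>i. \<Sum>l\<in>L. b l * phi n X l i) (\<lambda>i. \<epsilon> i x)"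
  unfolding ipn_sum_left noise_coef_def ..

lemma signal_noise_sqint: "square_integrable M (\<lambda>x. \<Sum>l\<in>L. b l * noise_coef x l)"
  unfolding signal_noise_sum by (rule ipn_noise_sqint)

lemma signal_noise_second_moment:
  assumes "L \<subseteq> {1..p}"
  shows "(\<integral>x. (\<Sum>l\<in>L. b l * noise_coef x l)\<^sup>2 \<partial>M) = \<sigma>\<^sup>2 * (\<Sum>l\<in>L. (b l)\<^sup>2)"
proof -
  have L_ext: "(\<Sum>l\<in>L. g l) = (\<Sum>l\<in>{1..p}. if l \<in> L then g l else 0)" for g :: "nat \<Rightarrow> real"
    using assms by (intro sum.mono_neutral_cong_left) auto
  have "sqn n (\<lambda>i. \<Sum>l\<in>L. b l * phi n X l i)
      = sqn n (\<lambda>i. \<Sum>l\<in>{1..p}. (if l \<in> L then b l else 0) * phi n X l i)"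
    unfolding L_ext by (intro arg_cong[where f="sqn n"] ext sum.cong) auto
  also have "\<dots> = (\<Sum>l\<in>L. (b l)\<^sup>2)"
    unfolding sqn_orthonormal_sum[OF orthonormal] L_ext by (intro sum.cong) auto
  finally show ?thesis unfolding signal_noise_sum ipn_noise_second_moment by simp
qed

text \<open>The noise coordinates are uncorrelated but in general not independent. The sum of their
  centred squares is therefore read as a quadratic form in the independent errors, whose matrix is
  the orthogonal projection onto the span of the vectors \<open>phi n X l\<close> and has trace
  \<open>card L\<close>.\<close>

lemma excess_sum_eq:
  assumes "L \<subseteq> {1..p}"
  shows "(\<Sum>l\<in>L. excess x l)
    = centred_quad (\<lambda>i j. \<Sum>l\<in>L. phi n X l i * phi n X l j) (\<sigma>\<^sup>2) n (\<lambda>i. \<epsilon> i x)"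
proof -
  have "(\<Sum>i<n. \<Sum>j<n. (\<Sum>l\<in>L. phi n X l i * phi n X l j) * (\<epsilon> i x * \<epsilon> j x))
      = (\<Sum>i<n. \<Sum>l\<in>L. \<Sum>j<n. phi n X l i * phi n X l j * (\<epsilon> i x * \<epsilon> j x))"
    by (simp add: sum_distrib_right) (intro sum.cong refl sum.swap)
  also have "\<dots> = (\<Sum>l\<in>L. \<Sum>i<n. \<Sum>j<n. phi n X l i * phi n X l j * (\<epsilon> i x * \<epsilon> j x))"
    by (rule sum.swap)
  also have "\<dots> = (\<Sum>l\<in>L. (noise_coef x l)\<^sup>2)"
    by (intro sum.cong refl)
      (simp add: noise_coef_def ipn_def power2_eq_square sum_product mult_ac)
  finally have 1: "(\<Sum>i<n. \<Sum>j<n. (\<Sum>l\<in>L. phi n X l i * phi n X l j) * (\<epsilon> i x * \<epsilon> j x))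
      = (\<Sum>l\<in>L. (noise_coef x l)\<^sup>2)" .
  have "(\<Sum>i<n. \<Sum>l\<in>L. phi n X l i * phi n X l i) = (\<Sum>l\<in>L. ipn n (phi n X l) (phi n X l))"
    unfolding ipn_def by (rule sum.swap)
  also have "\<dots> = (\<Sum>l\<in>L. 1)" using assms by (intro sum.cong) (auto simp: ipn_phi subset_eq)
  finally show ?thesis unfolding centred_quad_def 1 by (simp add: excess_def sum_subtractf mult.commute)
qed

lemma excess_sum_sqint: "L \<subseteq> {1..p} \<Longrightarrow> square_integrable M (\<lambda>x. \<Sum>l\<in>L. excess x l)"
  using centred_quad_sqint by (simp add: excess_sum_eq)

text \<open>The squared Frobenius norm of an orthogonal projection is its rank, so the second moment
  is linear in the number of coordinates.\<close>

lemma excess_sum_second_moment: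
  assumes "L \<subseteq> {1..p}"
  shows "(\<integral>x. (\<Sum>l\<in>L. excess x l)\<^sup>2 \<partial>M) \<le> quad_const * real (card L)"
proof -
  let ?\<phi> = "phi n X"
  have fin: "finite L" using assms finite_subset by blast
  have "(\<Sum>i<n. \<Sum>j<n. (\<Sum>l\<in>L. ?\<phi> l i * ?\<phi> l j)\<^sup>2)
      = (\<Sum>i<n. \<Sum>j<n. \<Sum>l\<in>L. \<Sum>m\<in>L. (?\<phi> l i * ?\<phi> m i) * (?\<phi> l j * ?\<phi> m j))"
    by (simp add: power2_eq_square sum_product mult_ac)
  also have "\<dots> = (\<Sum>i<n. \<Sum>l\<in>L. \<Sum>j<n. \<Sum>m\<in>L. (?\<phi> l i * ?\<phi> m i) * (?\<phi> l j * ?\<phi> m j))"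
    by (intro sum.cong refl sum.swap)
  also have "\<dots> = (\<Sum>i<n. \<Sum>l\<in>L. \<Sum>m\<in>L. \<Sum>j<n. (?\<phi> l i * ?\<phi> m i) * (?\<phi> l j * ?\<phi> m j))"
    by (intro sum.cong refl sum.swap)
  also have "\<dots> = (\<Sum>l\<in>L. \<Sum>i<n. \<Sum>m\<in>L. \<Sum>j<n. (?\<phi> l i * ?\<phi> m i) * (?\<phi> l j * ?\<phi> m j))"
    by (rule sum.swap)
  also have "\<dots> = (\<Sum>l\<in>L. \<Sum>m\<in>L. \<Sum>i<n. \<Sum>j<n. (?\<phi> l i * ?\<phi> m i) * (?\<phi> l j * ?\<phi> m j))"
    by (intro sum.cong refl sum.swap)
  also have "\<dots> = (\<Sum>l\<in>L. \<Sum>m\<in>L. (ipn n (?\<phi> l) (?\<phi> m))\<^sup>2)"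
    by (simp add: ipn_def power2_eq_square sum_product)
  also have "\<dots> = (\<Sum>l\<in>L. \<Sum>m\<in>L. if l = m then 1 else 0)"
    using assms by (intro sum.cong refl) (auto simp: ipn_phi subset_eq)
  also have "\<dots> = real (card L)" using fin by simp
  finally have fro: "(\<Sum>i<n. \<Sum>j<n. (\<Sum>l\<in>L. ?\<phi> l i * ?\<phi> l j)\<^sup>2) = real (card L)" .
  have "(\<integral>x. (centred_quad (\<lambda>i j. \<Sum>l\<in>L. ?\<phi> l i * ?\<phi> l j) (\<sigma>\<^sup>2) n (\<lambda>i. \<epsilon> i x))\<^sup>2 \<partial>M)
    \<le> quad_const * (\<Sum>i<n. \<Sum>j<n. (\<Sum>l\<in>L. ?\<phi> l i * ?\<phi> l j)\<^sup>2)"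
    unfolding quad_const_def
    by (rule conjunct2[OF centred_quad_moments]) (simp add: mult.commute)
  then show ?thesis unfolding fro excess_sum_eq[OF assms] .
qed

definition coord_weight :: "(nat \<Rightarrow> nat) \<Rightarrow> nat \<Rightarrow> (nat \<Rightarrow> real) \<Rightarrow> nat \<Rightarrow> real" where
  "coord_weight k N w l = (\<Sum>m\<in>{1..N}. if l \<le> k m then w m else 0)"

lemma ma_fit_eq:
  assumes "\<forall>m\<in>{1..N}. k m \<le> p"
  shows "ma_fit n X k N w y
    = (\<lambda>i. \<Sum>l\<in>{1..p}. (coord_weight k N w l * ipn n (phi n X l) y) * phi n X l i)"
proof
  fix i
  have "ma_fit n X k N w y i
      = (\<Sum>m\<in>{1..N}. \<Sum>l\<in>{1..p}. (if l \<le> k m then w m else 0) * (ipn n (phi n X l) y * phi n X l i))"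
    unfolding ma_fit_def
  proof (rule sum.cong[OF refl])
    fix m assume m: "m \<in> {1..N}"
    have "w m * proj n X (k m) y i = (\<Sum>l\<in>{1..k m}. w m * (ipn n (phi n X l) y * phi n X l i))"
      by (simp add: proj_eq_phi_sum[OF rank bspec[OF assms m]] sum_distrib_left)
    also have "\<dots> = (\<Sum>l\<in>{1..p}. (if l \<le> k m then w m else 0) * (ipn n (phi n X l) y * phi n X l i))"
      using bspec[OF assms m] by (intro sum.mono_neutral_cong_left) auto
    finally show "w m * proj n X (k m) y i = \<dots>" .
  qed
  also have "\<dots> = (\<Sum>l\<in>{1..p}. \<Sum>m\<in>{1..N}. (if l \<le> k m then w m else 0) * (ipn n (phi n X l) y * phi n X l i))"
    by (rule sum.swap)
  finally show "ma_fit n X k N w y i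
      = (\<Sum>l\<in>{1..p}. (coord_weight k N w l * ipn n (phi n X l) y) * phi n X l i)"
    by (simp add: coord_weight_def sum_distrib_right mult.assoc)
qed

text \<open>\<open>n\<close> times the risk of coordinate weights \<open>g\<close>; the leading difference is the part of the signal
  outside the column space.\<close>
definition total_risk :: "(nat \<Rightarrow> real) \<Rightarrow> real" where
  "total_risk g = sqn n f - (\<Sum>l\<in>{1..p}. (signal_coef l)\<^sup>2)
     + (\<Sum>l\<in>{1..p}. (1 - g l)\<^sup>2 * (signal_coef l)\<^sup>2 + \<sigma>\<^sup>2 * (g l)\<^sup>2)"

lemma bessel: "(\<Sum>l\<in>{1..p}. (signal_coef l)\<^sup>2) \<le> sqn n f"
  using sqn_nonneg[of n "\<lambda>i. f i - (\<Sum>l\<in>{1..p}. signal_coef l * phi n X l i)"]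
  unfolding sqn_diff_orthonormal_sum[OF orthonormal] by (simp add: signal_coef_def power2_eq_square)

text \<open>Each coordinate of the error is expanded, and the squared noise is split into
  \<open>\<sigma>\<^sup>2\<close> and its excess. All deterministic terms gather in
  \<open>total_risk\<close>; the two sums left over have mean 0, which yields
  \<open>risk_eq\<close>.\<close>

lemma loss_eq:
  fixes w :: "nat \<Rightarrow> real"
  assumes "\<forall>m\<in>{1..N}. k m \<le> p"
  defines "g \<equiv> coord_weight k N w"
  shows "sqn n (\<lambda>i. ma_fit n X k N w (noisy n f \<epsilon> x) i - f i)
    = total_risk g + (\<Sum>l\<in>{1..p}. (g l)\<^sup>2 * excess x l)
      - 2 * (\<Sum>l\<in>{1..p}. (g l * (1 - g l)) * (signal_coef l * noise_coef x l))"
proof -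
  let ?c = signal_coef and ?e = "noise_coef x"
  have "sqn n (\<lambda>i. ma_fit n X k N w (noisy n f \<epsilon> x) i - f i)
      = sqn n (\<lambda>i. f i - (\<Sum>l\<in>{1..p}. (g l * (?c l + ?e l)) * phi n X l i))"
    unfolding ma_fit_eq[OF assms(1)] noisy_coef g_def
    unfolding sqn_def ipn_def
    by (intro sum.cong refl) (simp add: algebra_simps)
  also have "\<dots> = sqn n f - 2 * (\<Sum>l\<in>{1..p}. g l * (?c l + ?e l) * ?c l) + (\<Sum>l\<in>{1..p}. (g l * (?c l + ?e l))\<^sup>2)"
    unfolding sqn_diff_orthonormal_sum[OF orthonormal] signal_coef_def ..
  also have "\<dots> = sqn n f + (\<Sum>l\<in>{1..p}. (g l * (?c l + ?e l))\<^sup>2 - 2 * (g l * (?c l + ?e l) * ?c l))"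
    by (simp add: sum_subtractf sum_distrib_left)
  also have "(\<Sum>l\<in>{1..p}. (g l * (?c l + ?e l))\<^sup>2 - 2 * (g l * (?c l + ?e l) * ?c l))
    = (\<Sum>l\<in>{1..p}. ((1 - g l)\<^sup>2 * (?c l)\<^sup>2 + \<sigma>\<^sup>2 * (g l)\<^sup>2) + (g l)\<^sup>2 * excess x l
       - 2 * (g l * (1 - g l) * (?c l * ?e l)) - (?c l)\<^sup>2)"
    by (intro sum.cong refl) (simp add: excess_def power2_eq_square algebra_simps)
  also have "\<dots> = (\<Sum>l\<in>{1..p}. (1 - g l)\<^sup>2 * (?c l)\<^sup>2 + \<sigma>\<^sup>2 * (g l)\<^sup>2) + (\<Sum>l\<in>{1..p}. (g l)\<^sup>2 * excess x l)
      - 2 * (\<Sum>l\<in>{1..p}. (g l * (1 - g l)) * (?c l * ?e l)) - (\<Sum>l\<in>{1..p}. (?c l)\<^sup>2)"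
    by (simp only: sum.distrib sum_subtractf sum_distrib_left)
  finally show ?thesis by (simp add: total_risk_def)
qed

lemma risk_eq:
  assumes "\<forall>m\<in>{1..N}. k m \<le> p"
  shows "risk M \<epsilon> n X k N f w = total_risk (coord_weight k N w) / real n"
proof -
  let ?g = "coord_weight k N w"
  have ex: "integrable M (\<lambda>x. excess x l)" "(\<integral>x. excess x l \<partial>M) = 0" if "l \<in> {1..p}" for l
    using that square_integrableD(2)[OF noise_coef_sqint]
    by (simp_all add: excess_def noise_coef_second_moment prob_space)
  have "(\<integral>x. sqn n (\<lambda>i. ma_fit n X k N w (noisy n f \<epsilon> x) i - f i) \<partial>M) = total_risk ?g"
  proof -
    have 1: "integrable M (\<lambda>x. \<Sum>l\<in>{1..p}. (?g l)\<^sup>2 * excess x l)"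
      "(\<integral>x. (\<Sum>l\<in>{1..p}. (?g l)\<^sup>2 * excess x l) \<partial>M) = 0"
    proof -
      show "integrable M (\<lambda>x. \<Sum>l\<in>{1..p}. (?g l)\<^sup>2 * excess x l)"
        by (intro Bochner_Integration.integrable_sum integrable_mult_right ex)
      have "(\<integral>x. (\<Sum>l\<in>{1..p}. (?g l)\<^sup>2 * excess x l) \<partial>M) = (\<Sum>l\<in>{1..p}. \<integral>x. (?g l)\<^sup>2 * excess x l \<partial>M)"
        by (intro Bochner_Integration.integral_sum integrable_mult_right ex)
      also have "\<dots> = (\<Sum>l\<in>{1..p}. (?g l)\<^sup>2 * 0)"
        by (intro sum.cong refl) (simp only: integral_mult_right_zero ex)
      finally show "(\<integral>x. (\<Sum>l\<in>{1..p}. (?g l)\<^sup>2 * excess x l) \<partial>M) = 0" by simp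
    qed
    have 2: "integrable M (\<lambda>x. \<Sum>l\<in>{1..p}. (?g l * (1 - ?g l)) * (signal_coef l * noise_coef x l))"
      "(\<integral>x. (\<Sum>l\<in>{1..p}. (?g l * (1 - ?g l)) * (signal_coef l * noise_coef x l)) \<partial>M) = 0"
      using noise_coef_integrable by (simp_all add: noise_coef_mean)
    show ?thesis unfolding loss_eq[OF assms] using 1 2 by (simp add: prob_space)
  qed
  then show ?thesis by (simp add: risk_def)
qed

text \<open>Counting each coordinate once for every model containing it turns the penalty into
  \<open>2 * s\<close> times the sum of the coordinate weights. With
  \<open>s = \<sigma>\<^sup>2\<close> this cancels the optimism of the residual sum of squares, as
  in Mallows' criterion; the error of \<open>s\<close> remains as the last term. The constant
  depends on the data but not on \<open>w\<close>, so it drops out of comparisons.\<close>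

lemma criterion_eq:
  assumes kp: "\<forall>m\<in>{1..N}. k m \<le> p"
  shows "\<exists>c. \<forall>w. real n * mma_crit n X k N s (noisy n f \<epsilon> x) w
    = c + total_risk (coord_weight k N w)
      + 2 * (\<Sum>l\<in>{1..p}. ((1 - coord_weight k N w l)\<^sup>2 - 1) * (signal_coef l * noise_coef x l))
      + (\<Sum>l\<in>{1..p}. ((coord_weight k N w l)\<^sup>2 - 2 * coord_weight k N w l) * excess x l)
      + 2 * (s - \<sigma>\<^sup>2) * (\<Sum>l\<in>{1..p}. coord_weight k N w l)"
proof (intro exI allI)
  fix w
  let ?g = "coord_weight k N w" and ?c = signal_coef and ?e = "noise_coef x" and ?y = "noisy n f \<epsilon> x"
  have km: "(\<Sum>m\<in>{1..N}. real (k m) * w m) = (\<Sum>l\<in>{1..p}. ?g l)"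
  proof -
    have "(\<Sum>m\<in>{1..N}. real (k m) * w m) = (\<Sum>m\<in>{1..N}. \<Sum>l\<in>{1..p}. if l \<le> k m then w m else 0)"
    proof (rule sum.cong[OF refl])
      fix m assume m: "m \<in> {1..N}"
      have "(\<Sum>l\<in>{1..p}. if l \<le> k m then w m else 0) = (\<Sum>l\<in>{1..k m}. w m)"
        using bspec[OF kp m] by (intro sum.mono_neutral_cong_right) auto
      then show "real (k m) * w m = (\<Sum>l\<in>{1..p}. if l \<le> k m then w m else 0)" by simp
    qed
    then show ?thesis unfolding coord_weight_def by (subst sum.swap)
  qed
  have "sqn n (\<lambda>i. ?y i - ma_fit n X k N w ?y i)
     = sqn n ?y - 2 * (\<Sum>l\<in>{1..p}. ?g l * (?c l + ?e l) * (?c l + ?e l)) + (\<Sum>l\<in>{1..p}. (?g l * (?c l + ?e l))\<^sup>2)"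
    unfolding ma_fit_eq[OF kp] sqn_diff_orthonormal_sum[OF orthonormal] noisy_coef ..
  also have "\<dots> = sqn n ?y + (\<Sum>l\<in>{1..p}. (?g l * (?c l + ?e l))\<^sup>2 - 2 * (?g l * (?c l + ?e l) * (?c l + ?e l)))"
    by (simp add: sum_subtractf sum_distrib_left)
  also have "(\<Sum>l\<in>{1..p}. (?g l * (?c l + ?e l))\<^sup>2 - 2 * (?g l * (?c l + ?e l) * (?c l + ?e l)))
    = (\<Sum>l\<in>{1..p}. ((1 - ?g l)\<^sup>2 * (?c l)\<^sup>2 + \<sigma>\<^sup>2 * (?g l)\<^sup>2) + 2 * (((1 - ?g l)\<^sup>2 - 1) * (?c l * ?e l))
       + ((?g l)\<^sup>2 - 2 * ?g l) * excess x l - 2 * \<sigma>\<^sup>2 * ?g l - (?c l)\<^sup>2)"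
    by (intro sum.cong refl) (simp add: excess_def power2_eq_square algebra_simps)
  also have "\<dots> = (\<Sum>l\<in>{1..p}. (1 - ?g l)\<^sup>2 * (?c l)\<^sup>2 + \<sigma>\<^sup>2 * (?g l)\<^sup>2)
       + 2 * (\<Sum>l\<in>{1..p}. ((1 - ?g l)\<^sup>2 - 1) * (?c l * ?e l))
       + (\<Sum>l\<in>{1..p}. ((?g l)\<^sup>2 - 2 * ?g l) * excess x l) - 2 * \<sigma>\<^sup>2 * (\<Sum>l\<in>{1..p}. ?g l) - (\<Sum>l\<in>{1..p}. (?c l)\<^sup>2)"
    by (simp only: sum.distrib sum_subtractf sum_distrib_left)
  finally have "sqn n (\<lambda>i. ?y i - ma_fit n X k N w ?y i) = sqn n ?y - sqn n f + total_risk ?g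
      + 2 * (\<Sum>l\<in>{1..p}. ((1 - ?g l)\<^sup>2 - 1) * (?c l * ?e l))
      + (\<Sum>l\<in>{1..p}. ((?g l)\<^sup>2 - 2 * ?g l) * excess x l) - 2 * \<sigma>\<^sup>2 * (\<Sum>l\<in>{1..p}. ?g l)"
    by (simp add: total_risk_def)
  moreover have "real n * mma_crit n X k N s ?y w
      = sqn n (\<lambda>i. ?y i - ma_fit n X k N w ?y i) + 2 * s * (\<Sum>l\<in>{1..p}. ?g l)"
    using n_pos unfolding mma_crit_def km by (simp add: field_simps)
  ultimately show "real n * mma_crit n X k N s ?y w = (sqn n ?y - sqn n f) + total_risk ?g
      + 2 * (\<Sum>l\<in>{1..p}. ((1 - ?g l)\<^sup>2 - 1) * (?c l * ?e l))
      + (\<Sum>l\<in>{1..p}. ((?g l)\<^sup>2 - 2 * ?g l) * excess x l) + 2 * (s - \<sigma>\<^sup>2) * (\<Sum>l\<in>{1..p}. ?g l)"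
    by (simp add: algebra_simps)
qed

end

section \<open>Nested candidate sets\<close>

locale nested_model = regression_model M \<epsilon> \<sigma> n p X f
  for M :: "'a measure" and \<epsilon> \<sigma> n p X f +
  fixes k :: "nat \<Rightarrow> nat" and N :: nat
  assumes N_pos: "1 \<le> N" and k1: "1 \<le> k 1" and k_mono: "strict_mono_on {1..N} k" and kN: "k N \<le> p"
begin

text \<open>Enforces the convention that the size number 0 is 0, whatever value \<open>k 0\<close>
  has. Blocks are numbered from 0 to \<open>N - 1\<close>, and block \<open>j\<close> holds the
  coordinates that model \<open>Suc j\<close> adds to model \<open>j\<close>.\<close>

definition edge :: "nat \<Rightarrow> nat" where "edge j = (if j = 0 then 0 else k j)"
definition block :: "nat \<Rightarrow> nat set" where "block j = {edge j + 1..edge (Suc j)}"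
definition block_size :: "nat \<Rightarrow> real" where "block_size j = real (edge (Suc j)) - real (edge j)"
definition block_signal :: "nat \<Rightarrow> real" where "block_signal j = (\<Sum>l\<in>block j. (signal_coef l)\<^sup>2)"
definition block_cross :: "'a \<Rightarrow> nat \<Rightarrow> real" where
  "block_cross x j = (\<Sum>l\<in>block j. signal_coef l * noise_coef x l)"
definition block_excess :: "'a \<Rightarrow> nat \<Rightarrow> real" where "block_excess x j = (\<Sum>l\<in>block j. excess x l)"
definition tail_weight :: "(nat \<Rightarrow> real) \<Rightarrow> nat \<Rightarrow> real" where
  "tail_weight w j = (\<Sum>m\<in>{Suc j..N}. w m)"
definition tail_signal :: "nat \<Rightarrow> real" where
  "tail_signal j = (\<Sum>l\<in>{edge j + 1..edge N}. (signal_coef l)\<^sup>2)"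

lemma k_less: "1 \<le> i \<Longrightarrow> i < j \<Longrightarrow> j \<le> N \<Longrightarrow> k i < k j"
  using k_mono by (auto simp: strict_mono_on_def)

lemma k_le: "1 \<le> i \<Longrightarrow> i \<le> j \<Longrightarrow> j \<le> N \<Longrightarrow> k i \<le> k j"
  using k_less[of i j] by (cases "i = j") auto

lemma edge_less: "i < j \<Longrightarrow> j \<le> N \<Longrightarrow> edge i < edge j"
  using k_less[of i j] k_le[of 1 j] k1 by (auto simp: edge_def)

lemma edge_le: "i \<le> j \<Longrightarrow> j \<le> N \<Longrightarrow> edge i \<le> edge j"
  using edge_less[of i j] by (cases "i = j") auto

lemma edge_N: "edge N = k N" using N_pos by (simp add: edge_def)

lemma k_le_p: "\<forall>m\<in>{1..N}. k m \<le> p"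
  using k_le[of _ N] kN by fastforce

lemma block_size_pos: "j < N \<Longrightarrow> 0 < block_size j"
  using edge_less[of j "Suc j"] by (simp add: block_size_def)

lemma block_signal_nonneg: "0 \<le> block_signal j" by (simp add: block_signal_def sum_nonneg)

lemma tail_signal_nonneg: "0 \<le> tail_signal j" by (simp add: tail_signal_def sum_nonneg)

lemma sum_blocks:
  assumes "a \<le> b" "b \<le> N"
  shows "(\<Sum>j\<in>{a..<b}. \<Sum>l\<in>block j. h l) = (\<Sum>l\<in>{edge a + 1..edge b}. h l :: real)"
  using assms
proof (induction b rule: dec_induct)
  case base
  then show ?case by simp
next
  case (step b)
  then have le: "edge a \<le> edge b" "edge b \<le> edge (Suc b)" by (simp_all add: edge_le)
  have "{edge a + 1..edge (Suc b)} = {edge a + 1..edge b} \<union> block b"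
    using le by (auto simp: block_def)
  then have "(\<Sum>l\<in>{edge a + 1..edge (Suc b)}. h l) = (\<Sum>l\<in>{edge a + 1..edge b}. h l) + (\<Sum>l\<in>block b. h l)"
    by (simp only:) (rule sum.union_disjoint, auto simp: block_def)
  then show ?case using step by simp
qed

lemma coord_weight_block:
  assumes "j < N" "l \<in> block j"
  shows "coord_weight k N w l = tail_weight w j"
  unfolding coord_weight_def tail_weight_def
proof (rule sum.mono_neutral_cong_right)
  have "l \<le> k m \<longleftrightarrow> Suc j \<le> m" if m: "m \<in> {1..N}" for m
  proof
    assume "Suc j \<le> m"
    then have "edge (Suc j) \<le> edge m" using m by (intro edge_le) auto
    then show "l \<le> k m" using assms m by (auto simp: block_def edge_def)
  next
    assume l: "l \<le> k m"
    show "Suc j \<le> m"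
    proof (rule ccontr)
      assume "\<not> Suc j \<le> m"
      then have "edge m \<le> edge j" using assms by (intro edge_le) auto
      then show False using l assms m by (auto simp: block_def edge_def split: if_splits)
    qed
  qed
  then show "\<forall>i\<in>{1..N} - {Suc j..N}. (if l \<le> k i then w i else 0) = 0"
    "\<And>m. m \<in> {Suc j..N} \<Longrightarrow> (if l \<le> k m then w m else 0) = w m" by auto
qed auto

lemma coord_weight_outside: "k N < l \<Longrightarrow> coord_weight k N w l = 0"
  unfolding coord_weight_def using k_le[of _ N] by (intro sum.neutral) fastforce

lemma sum_coord_weight:
  "(\<Sum>l\<in>{1..k N}. F (coord_weight k N w l) * h l) = (\<Sum>j<N. F (tail_weight w j) * (\<Sum>l\<in>block j. h l :: real))"
proof -
  have "(\<Sum>l\<in>{1..k N}. F (coord_weight k N w l) * h l)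
      = (\<Sum>j\<in>{0..<N}. \<Sum>l\<in>block j. F (coord_weight k N w l) * h l)"
    using sum_blocks[of 0 N "\<lambda>l. F (coord_weight k N w l) * h l"] N_pos by (simp add: edge_def)
  also have "\<dots> = (\<Sum>j\<in>{0..<N}. F (tail_weight w j) * (\<Sum>l\<in>block j. h l))"
    by (intro sum.cong refl) (simp add: sum_distrib_left coord_weight_block)
  finally show ?thesis by (simp add: atLeast0LessThan)
qed

text \<open>Beyond \<open>k N\<close> all coordinate weights are 0, so functions vanishing at 0 may
  be summed up to \<open>p\<close>. Functions such as \<open>(1 - t)\<^sup>2\<close> do not vanish
  there and are summed only up to \<open>k N\<close>.\<close>

lemma sum_coord_weight':
  assumes "F 0 = 0"
  shows "(\<Sum>l\<in>{1..p}. F (coord_weight k N w l) * h l) = (\<Sum>j<N. F (tail_weight w j) * (\<Sum>l\<in>block j. h l :: real))"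
proof -
  have "(\<Sum>l\<in>{1..p}. F (coord_weight k N w l) * h l) = (\<Sum>l\<in>{1..k N}. F (coord_weight k N w l) * h l)"
    using kN by (intro sum.mono_neutral_right) (auto simp: coord_weight_outside assms)
  then show ?thesis by (simp only: sum_coord_weight)
qed

lemma tail_weight_bounds:
  assumes w: "w \<in> wsimplex N"
  shows "0 \<le> tail_weight w j" "tail_weight w j \<le> 1" "i \<le> j \<Longrightarrow> tail_weight w j \<le> tail_weight w i"
proof -
  have w0: "0 \<le> w m" if "m \<in> {1..N}" for m using w that by (auto simp: wsimplex_def)
  show "0 \<le> tail_weight w j" unfolding tail_weight_def by (intro sum_nonneg w0) auto
  have "tail_weight w j \<le> (\<Sum>m\<in>{1..N}. w m)" unfolding tail_weight_def
    by (intro sum_mono2) (auto intro!: w0)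
  then show "tail_weight w j \<le> 1" using w by (simp add: wsimplex_def)
  show "tail_weight w j \<le> tail_weight w i" if "i \<le> j" unfolding tail_weight_def
    using that by (intro sum_mono2) (auto intro!: w0)
qed

text \<open>The first two left-hand sides are the quadratic functionals against which the cross
  products and the squared noise are normalised: parts of squared bias and of variance. The third
  serves the error of the variance estimator.\<close>

lemma total_risk_lower:
  "(\<Sum>j<N. (1 - tail_weight w j)\<^sup>2 * block_signal j) \<le> total_risk (coord_weight k N w)"
  "\<sigma>\<^sup>2 * (\<Sum>j<N. (tail_weight w j)\<^sup>2 * block_size j) \<le> total_risk (coord_weight k N w)"
  "\<sigma>\<^sup>2 * (\<Sum>l\<in>{1..p}. (coord_weight k N w l)\<^sup>2) \<le> total_risk (coord_weight k N w)"
  "0 \<le> total_risk (coord_weight k N w)"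
proof -
  let ?g = "coord_weight k N w" and ?c = signal_coef
  have 1: "(\<Sum>l\<in>{1..p}. (1 - ?g l)\<^sup>2 * (?c l)\<^sup>2) + \<sigma>\<^sup>2 * (\<Sum>l\<in>{1..p}. (?g l)\<^sup>2) \<le> total_risk ?g"
    using bessel unfolding total_risk_def by (simp add: sum.distrib sum_distrib_left)
  have 2: "(\<Sum>l\<in>{1..k N}. (1 - ?g l)\<^sup>2 * (?c l)\<^sup>2) \<le> (\<Sum>l\<in>{1..p}. (1 - ?g l)\<^sup>2 * (?c l)\<^sup>2)"
    using kN by (intro sum_mono2) auto
  have n1: "0 \<le> (\<Sum>l\<in>{1..p}. (1 - ?g l)\<^sup>2 * (?c l)\<^sup>2)" by (simp add: sum_nonneg)
  have n2: "0 \<le> \<sigma>\<^sup>2 * (\<Sum>l\<in>{1..p}. (?g l)\<^sup>2)" by (simp add: sum_nonneg)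
  have "(\<Sum>l\<in>{1..k N}. (1 - ?g l)\<^sup>2 * (?c l)\<^sup>2) = (\<Sum>j<N. (1 - tail_weight w j)\<^sup>2 * block_signal j)"
    unfolding block_signal_def by (rule sum_coord_weight[of "\<lambda>t. (1 - t)\<^sup>2"])
  then show "(\<Sum>j<N. (1 - tail_weight w j)\<^sup>2 * block_signal j) \<le> total_risk ?g" using 1 2 n2 by linarith
  show s: "\<sigma>\<^sup>2 * (\<Sum>l\<in>{1..p}. (?g l)\<^sup>2) \<le> total_risk ?g" using 1 n1 by linarith
  then show "0 \<le> total_risk ?g" using n2 by linarith
  have "(\<Sum>l\<in>{1..p}. (?g l)\<^sup>2 * 1) = (\<Sum>j<N. (tail_weight w j)\<^sup>2 * (\<Sum>l\<in>block j. 1))"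
    by (rule sum_coord_weight'[of "\<lambda>t. t\<^sup>2"]) simp
  also have "\<dots> = (\<Sum>j<N. (tail_weight w j)\<^sup>2 * block_size j)"
    using edge_le by (intro sum.cong refl) (simp add: block_def block_size_def of_nat_diff)
  finally show "\<sigma>\<^sup>2 * (\<Sum>j<N. (tail_weight w j)\<^sup>2 * block_size j) \<le> total_risk ?g" using s by simp
qed

section \<open>The factor \<open>psi\<close> in terms of blocks\<close>

lemma tail_signal_Suc: "j < N \<Longrightarrow> tail_signal j = block_signal j + tail_signal (Suc j)"
  unfolding tail_signal_def block_signal_def
  using sum_blocks[of j N "\<lambda>l. (signal_coef l)\<^sup>2"] sum_blocks[of "Suc j" N "\<lambda>l. (signal_coef l)\<^sup>2"]
  by (simp add: sum.atLeast_Suc_lessThan)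

text \<open>Both the signal ratios and the index at which the tail first vanishes are invariant
  under rescaling, so the factor \<open>n\<close> between squared \<open>signal_coef\<close> and
  squared \<open>theta\<close> disappears.\<close>

lemma psi_eq:
  fixes M' :: nat
  defines "M' \<equiv> (LEAST j. 1 \<le> j \<and> j \<le> N \<and> tail_signal j = 0)"
  shows "psi (theta n X f) k N = min (real N) (1 + (\<Sum>j\<in>{1..<N}. block_size j / (4 * real (edge j)))
      + (\<Sum>j\<in>{1..<M'}. (tail_signal (j - 1) - tail_signal j) / (4 * tail_signal j))) * (1 + ln (real N))\<^sup>2"
proof -
  have S: "(\<Sum>l\<in>{(if j = 0 then 0 else k j) + 1..(if N = 0 then 0 else k N)}. (theta n X f l)\<^sup>2)
      = tail_signal j / real n" for j
    unfolding tail_signal_def edge_def[symmetric] sum_divide_distrib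
    using n_pos by (intro sum.cong refl) (simp add: theta_def signal_coef_def power_divide)
  have S0: "tail_signal j / real n = 0 \<longleftrightarrow> tail_signal j = 0" for j using n_pos by simp
  have r: "(a / real n - b / real n) / (4 * (b / real n)) = (a - b) / (4 * b)" for a b :: real
    using n_pos by (cases "b = 0") (auto simp: field_simps)
  have e: "(\<Sum>j\<in>{1..<N}. real ((if Suc j = 0 then 0 else k (Suc j)) - (if j = 0 then 0 else k j))
      / (4 * real (if j = 0 then 0 else k j))) = (\<Sum>j\<in>{1..<N}. block_size j / (4 * real (edge j)))"
    unfolding edge_def[symmetric] block_size_def
    by (intro sum.cong refl) (simp add: of_nat_diff edge_le)
  show ?thesis unfolding psi_def Let_def S S0 r e M'_def ..
qed

text \<open>As \<open>psi\<close> contains a minimum, two bounds are combined: every ratio is at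
  most 1, and after the first one, which equals 1, the denominator \<open>k (Suc j)\<close> may be
  lowered to \<open>k j\<close>. The factor 4 undoes the quarter in \<open>psi\<close>.\<close>

lemma size_ratio_sum_le:
  "(\<Sum>j<N. block_size j / real (edge (Suc j))) * (1 + ln (real N))\<^sup>2 \<le> 4 * psi (theta n X f) k N"
proof -
  let ?P = "\<Sum>j\<in>{1..<N}. block_size j / (4 * real (edge j))"
  let ?M = "LEAST j. 1 \<le> j \<and> j \<le> N \<and> tail_signal j = 0"
  let ?P' = "\<Sum>j\<in>{1..<?M}. (tail_signal (j - 1) - tail_signal j) / (4 * tail_signal j)"
  let ?R = "\<Sum>j<N. block_size j / real (edge (Suc j))"
  have bs: "0 \<le> block_size j" if "j < N" for j using block_size_pos[OF that] by simp
  have ep: "0 < edge (Suc j)" if "j < N" for j using that edge_less[of 0 "Suc j"] by simp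
  have M_le: "?M \<le> N"
    by (rule Least_le) (use N_pos in \<open>auto simp: tail_signal_def\<close>)
  have "0 \<le> ?P'"
  proof (intro sum_nonneg divide_nonneg_nonneg)
    fix j assume j: "j \<in> {1..<?M}"
    then show "0 \<le> tail_signal (j - 1) - tail_signal j"
      using tail_signal_Suc[of "j - 1"] block_signal_nonneg[of "j - 1"] M_le by auto
  qed (simp add: tail_signal_nonneg)
  moreover have "?R \<le> real N"
  proof -
    have "?R \<le> (\<Sum>j<N. 1)"
      using ep by (intro sum_mono) (simp add: block_size_def)
    then show ?thesis by simp
  qed
  moreover have "?R \<le> 1 + 4 * ?P"
  proof -
    have "?R = block_size 0 / real (edge 1) + (\<Sum>j\<in>{1..<N}. block_size j / real (edge (Suc j)))"
      using N_pos by (simp add: atLeast0LessThan[symmetric] sum.atLeast_Suc_lessThan)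
    also have "block_size 0 / real (edge 1) = 1" using ep[of 0] N_pos by (simp add: block_size_def edge_def)
    also have "(\<Sum>j\<in>{1..<N}. block_size j / real (edge (Suc j))) \<le> (\<Sum>j\<in>{1..<N}. block_size j / real (edge j))"
    proof (rule sum_mono)
      fix j assume j: "j \<in> {1..<N}"
      have "0 < edge j" "edge j \<le> edge (Suc j)" using j edge_less[of 0 j] edge_le[of j "Suc j"] by auto
      then show "block_size j / real (edge (Suc j)) \<le> block_size j / real (edge j)"
        using j by (intro divide_left_mono bs) auto
    qed
    also have "\<dots> = 4 * ?P" by (simp add: sum_distrib_left)
    finally show ?thesis by simp
  qed
  moreover have "0 \<le> ?P" using bs by (intro sum_nonneg) auto
  ultimately have "?R \<le> 4 * min (real N) (1 + ?P + ?P')" by (auto simp: min_def)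
  then have "?R * (1 + ln (real N))\<^sup>2 \<le> 4 * min (real N) (1 + ?P + ?P') * (1 + ln (real N))\<^sup>2"
    by (rule mult_right_mono) simp
  then show ?thesis unfolding psi_eq by (simp only: mult.assoc)
qed

text \<open>Where the tail signal vanishes the ratio is 0 because division by 0 gives 0.\<close>
lemma signal_ratio_sum_le:
  "(\<Sum>j<N. block_signal j / tail_signal j) * (1 + ln (real N))\<^sup>2 \<le> 4 * psi (theta n X f) k N"
proof -
  let ?P = "\<Sum>j\<in>{1..<N}. block_size j / (4 * real (edge j))"
  define M' where "M' = (LEAST j. 1 \<le> j \<and> j \<le> N \<and> tail_signal j = 0)"
  let ?P' = "\<Sum>j\<in>{1..<M'}. (tail_signal (j - 1) - tail_signal j) / (4 * tail_signal j)"
  let ?R = "\<Sum>j<N. block_signal j / tail_signal j"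
  have ex: "1 \<le> N \<and> N \<le> N \<and> tail_signal N = 0" using N_pos by (simp add: tail_signal_def)
  have M_le: "M' \<le> N" unfolding M'_def by (rule Least_le) (rule ex)
  have M': "1 \<le> M'" "tail_signal M' = 0"
    using LeastI[of "\<lambda>j. 1 \<le> j \<and> j \<le> N \<and> tail_signal j = 0" N, OF ex] by (auto simp: M'_def)
  have anti: "tail_signal j \<le> tail_signal i" if "i \<le> j" "j \<le> N" for i j
    unfolding tail_signal_def using edge_le[OF that] by (intro sum_mono2) auto
  have le1: "block_signal j / tail_signal j \<le> 1" if "j < N" for j
    using tail_signal_Suc[OF that] tail_signal_nonneg[of j] tail_signal_nonneg[of "Suc j"]
    by (auto simp: divide_le_eq_1)
  have cancel: "4 * (a / (4 * b)) = a / b" for a b :: real by simp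
  have P'0: "0 \<le> ?P'"
  proof (intro sum_nonneg divide_nonneg_nonneg)
    fix j assume j: "j \<in> {1..<M'}"
    then show "0 \<le> tail_signal (j - 1) - tail_signal j" using anti[of "j - 1" j] M_le by auto
  qed (simp add: tail_signal_nonneg)
  have P0: "0 \<le> ?P" using block_size_pos by (intro sum_nonneg) (auto simp: less_imp_le)
  have "?R \<le> (\<Sum>j<N. 1)" by (intro sum_mono le1) simp
  then have RN: "?R \<le> real N" by simp
  have "?R = (\<Sum>j<M'. block_signal j / tail_signal j)"
  proof (rule sum.mono_neutral_right)
    show "\<forall>j\<in>{..<N} - {..<M'}. block_signal j / tail_signal j = 0"
    proof
      fix j assume "j \<in> {..<N} - {..<M'}"
      then have "tail_signal j \<le> tail_signal M'" by (intro anti) auto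
      then show "block_signal j / tail_signal j = 0" using M' tail_signal_nonneg[of j] by simp
    qed
  qed (use M_le in auto)
  also have "\<dots> = (\<Sum>j<M' - 1. block_signal j / tail_signal j)
      + block_signal (M' - 1) / tail_signal (M' - 1)"
    using M'(1) by (cases M') auto
  \<comment> \<open>The index \<open>M' - 1\<close> is split off: its successor tail is 0, so its
    ratio has no counterpart in \<open>psi\<close> and is bounded by 1, the leading summand
    there.\<close>
  also have "\<dots> \<le> (\<Sum>j<M' - 1. block_signal j / tail_signal j) + 1"
    using le1[of "M' - 1"] M' M_le by auto
  also have "(\<Sum>j<M' - 1. block_signal j / tail_signal j)
      \<le> (\<Sum>j<M' - 1. (tail_signal (Suc j - 1) - tail_signal (Suc j)) / tail_signal (Suc j))"
  proof (rule sum_mono)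
    fix j assume j: "j \<in> {..<M' - 1}"
    then have jN: "j < N" "Suc j < M'" using M_le by auto
    \<comment> \<open>Minimality of \<open>M'\<close> makes the denominators of \<open>psi\<close>
      positive at all smaller indices.\<close>
    have "tail_signal (Suc j) \<noteq> 0"
      using not_less_Least[of "Suc j" "\<lambda>j. 1 \<le> j \<and> j \<le> N \<and> tail_signal j = 0", folded M'_def, OF jN(2)]
        jN M_le by auto
    then have "0 < tail_signal (Suc j)" using tail_signal_nonneg[of "Suc j"] by simp
    moreover have "tail_signal (Suc j) \<le> tail_signal j" using jN by (intro anti) auto
    ultimately have "block_signal j / tail_signal j \<le> block_signal j / tail_signal (Suc j)"
      using block_signal_nonneg by (intro divide_left_mono) auto
    then show "block_signal j / tail_signal j
      \<le> (tail_signal (Suc j - 1) - tail_signal (Suc j)) / tail_signal (Suc j)"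
      using tail_signal_Suc[OF jN(1)] by simp
  qed
  also have "(\<Sum>j<M' - 1. (tail_signal (Suc j - 1) - tail_signal (Suc j)) / tail_signal (Suc j)) = 4 * ?P'"
    using M'(1) unfolding sum_distrib_left cancel
    by (intro sum.reindex_bij_witness[of _ "\<lambda>j. j - 1" Suc]) auto
  finally have "?R \<le> 1 + 4 * ?P'" by simp
  with RN P0 P'0 have "?R \<le> 4 * min (real N) (1 + ?P + ?P')" by (auto simp: min_def)
  then have "?R * (1 + ln (real N))\<^sup>2 \<le> 4 * min (real N) (1 + ?P + ?P') * (1 + ln (real N))\<^sup>2"
    by (rule mult_right_mono) simp
  then show ?thesis unfolding psi_eq M'_def by (simp only: mult.assoc)
qed

end

section \<open>Random envelopes for the two noise processes\<close>

lemma sum_reverse_interval: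
  fixes h :: "nat \<Rightarrow> real"
  assumes "b \<le> N"
  shows "(\<Sum>i\<in>{a..<b}. h (N - Suc i)) = (\<Sum>j\<in>{N - b..<N - a}. h j)"
  using assms by (intro sum.reindex_bij_witness[of _ "\<lambda>j. N - Suc j" "\<lambda>i. N - Suc i"]) auto

context nested_model begin

lemma block_subset: "a \<le> b \<Longrightarrow> b \<le> N \<Longrightarrow> {edge a + 1..edge b} \<subseteq> {1..p}"
  using edge_le[of b N] edge_N kN by auto

text \<open>The maximal inequality with \<open>d = block_size\<close>, whose prefix sums telescope
  to the model sizes. The constant 9 is 9/4 times the 4 of \<open>size_ratio_sum_le\<close>.\<close>

lemma noise_envelope:
  obtains W where "integrable M W" "\<And>x. 0 \<le> W x"
    "(\<integral>x. W x \<partial>M) \<le> 9 * quad_const * psi (theta n X f) k N"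
    "\<And>x u. (\<And>i j. i \<le> j \<Longrightarrow> j < N \<Longrightarrow> u j \<le> u i) \<Longrightarrow> (\<And>i. i < N \<Longrightarrow> 0 \<le> u i) \<Longrightarrow>
       (\<Sum>j<N. u j * block_excess x j)\<^sup>2 \<le> W x * (\<Sum>j<N. (u j)\<^sup>2 * block_size j)"
proof -
  have sumE: "(\<Sum>j\<in>{a..<b}. block_excess x j) = (\<Sum>l\<in>{edge a + 1..edge b}. excess x l)"
    if "a \<le> b" "b \<le> N" for a b x
    unfolding block_excess_def by (rule sum_blocks[OF that])
  have sumS: "(\<Sum>j\<in>{a..<b}. block_size j) = real (card {edge a + 1..edge b})" if "a \<le> b" "b \<le> N" for a b
    unfolding block_size_def using sum_Suc_diff'[OF that(1), of "\<lambda>j. real (edge j)"] edge_le[OF that]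
    by (simp add: of_nat_diff)
  have int: "integrable M (\<lambda>x. (\<Sum>j\<in>{a..<b}. block_excess x j)\<^sup>2)" if "b \<le> N" for a b
  proof (cases "a \<le> b")
    case True
    then show ?thesis unfolding sumE[OF True that]
      by (intro square_integrableD(2) excess_sum_sqint block_subset that)
  qed simp
  have E: "(\<integral>x. (\<Sum>j\<in>{a..<b}. block_excess x j)\<^sup>2 \<partial>M) \<le> quad_const * (\<Sum>j\<in>{a..<b}. block_size j)"
    if "a \<le> b" "b \<le> N" for a b
    unfolding sumE[OF that] sumS[OF that] by (intro excess_sum_second_moment block_subset that)
  obtain W where W: "integrable M W" "\<And>x. 0 \<le> W x"
    "(\<integral>x. W x \<partial>M) \<le> 9/4 * quad_const * (1 + ln (real N))\<^sup>2 * (\<Sum>i<N. block_size i / (\<Sum>l<Suc i. block_size l))"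
    "\<And>x u. (\<And>i j. i \<le> j \<Longrightarrow> j < N \<Longrightarrow> u j \<le> u i) \<Longrightarrow> (\<And>i. i < N \<Longrightarrow> 0 \<le> u i) \<Longrightarrow>
       (\<Sum>i<N. u i * block_excess x i)\<^sup>2 \<le> W x * (\<Sum>i<N. (u i)\<^sup>2 * block_size i)"
  proof (rule weighted_rademacher_menshov[of N M "\<lambda>j x. block_excess x j" quad_const block_size])
    show "integrable M (\<lambda>x. (\<Sum>j\<in>{a..<b}. block_excess x j)\<^sup>2)" if "b \<le> N" for a b by (rule int[OF that])
    show "(\<integral>x. (\<Sum>j\<in>{a..<b}. block_excess x j)\<^sup>2 \<partial>M) \<le> quad_const * (\<Sum>j\<in>{a..<b}. block_size j)"
      if "a \<le> b" "b \<le> N" for a b by (rule E[OF that])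
    show "0 \<le> block_size i" if "i < N" for i using block_size_pos[OF that] by simp
    show "block_excess x i = 0" if "i < N" "block_size i = 0" for i x using block_size_pos[OF that(1)] that(2) by simp
  qed (use quad_const_nonneg N_pos in auto)
  have "(\<Sum>l<Suc i. block_size l) = real (edge (Suc i))" for i
    unfolding block_size_def using sum_lessThan_telescope[of "\<lambda>j. real (edge j)" "Suc i"]
    by (simp add: edge_def)
  then have "(\<integral>x. W x \<partial>M) \<le> 9/4 * quad_const * ((\<Sum>i<N. block_size i / real (edge (Suc i))) * (1 + ln (real N))\<^sup>2)"
    using W(3) by (simp add: mult_ac)
  also have "\<dots> \<le> 9/4 * quad_const * (4 * psi (theta n X f) k N)"
    using quad_const_nonneg by (intro mult_left_mono size_ratio_sum_le) auto
  finally have "(\<integral>x. W x \<partial>M) \<le> 9 * quad_const * psi (theta n X f) k N" by simp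
  then show ?thesis using W that by blast
qed

text \<open>The weights in question are increasing, so the maximal inequality is applied to the
  blocks in reverse order. Prefix sums of \<open>block_signal\<close> then become
  \<open>tail_signal\<close>, and the ratios are those of
  \<open>signal_ratio_sum_le\<close>.\<close>

lemma signal_envelope:
  obtains W where "integrable M W" "\<And>x. 0 \<le> W x"
    "(\<integral>x. W x \<partial>M) \<le> 9 * \<sigma>\<^sup>2 * psi (theta n X f) k N"
    "\<And>x u. (\<And>i j. i \<le> j \<Longrightarrow> j < N \<Longrightarrow> u i \<le> u j) \<Longrightarrow> (\<And>i. i < N \<Longrightarrow> 0 \<le> u i) \<Longrightarrow>
       (\<Sum>j<N. u j * block_cross x j)\<^sup>2 \<le> W x * (\<Sum>j<N. (u j)\<^sup>2 * block_signal j)"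
proof -
  have rev0: "(\<Sum>i<N. h (N - Suc i)) = (\<Sum>j<N. h j)" for h :: "nat \<Rightarrow> real"
    by (rule sum.nat_diff_reindex)
  have sumE: "(\<Sum>i\<in>{a..<b}. block_cross x (N - Suc i))
      = (\<Sum>l\<in>{edge (N - b) + 1..edge (N - a)}. signal_coef l * noise_coef x l)"
    if "a \<le> b" "b \<le> N" for a b x
    unfolding sum_reverse_interval[OF that(2), of "block_cross x"]
    unfolding block_cross_def by (rule sum_blocks) (use that in auto)
  have sumS: "(\<Sum>i\<in>{a..<b}. block_signal (N - Suc i))
      = (\<Sum>l\<in>{edge (N - b) + 1..edge (N - a)}. (signal_coef l)\<^sup>2)"
    if "a \<le> b" "b \<le> N" for a b
    unfolding sum_reverse_interval[OF that(2), of block_signal]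
    unfolding block_signal_def by (rule sum_blocks) (use that in auto)
  have int: "integrable M (\<lambda>x. (\<Sum>i\<in>{a..<b}. block_cross x (N - Suc i))\<^sup>2)" if "b \<le> N" for a b
  proof (cases "a \<le> b")
    case True
    then show ?thesis unfolding sumE[OF True that]
      by (intro square_integrableD(2) signal_noise_sqint)
  qed simp
  have E: "(\<integral>x. (\<Sum>i\<in>{a..<b}. block_cross x (N - Suc i))\<^sup>2 \<partial>M) \<le> \<sigma>\<^sup>2 * (\<Sum>i\<in>{a..<b}. block_signal (N - Suc i))"
    if "a \<le> b" "b \<le> N" for a b
    unfolding sumE[OF that] sumS[OF that]
    by (rule eq_refl, rule signal_noise_second_moment, rule block_subset) (use that in auto)
  \<comment> \<open>Block sizes are positive, but a whole block may carry no signal; its cross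
    product must then vanish for the maximal inequality to apply.\<close>
  have zero: "block_cross x j = 0" if "block_signal j = 0" for x j
  proof -
    have "signal_coef l = 0" if "l \<in> block j" for l
      using that \<open>block_signal j = 0\<close> by (auto simp: block_signal_def sum_nonneg_eq_0_iff block_def)
    then show ?thesis by (simp add: block_cross_def)
  qed
  obtain W where W: "integrable M W" "\<And>x. 0 \<le> W x"
    "(\<integral>x. W x \<partial>M) \<le> 9/4 * \<sigma>\<^sup>2 * (1 + ln (real N))\<^sup>2
       * (\<Sum>i<N. block_signal (N - Suc i) / (\<Sum>l<Suc i. block_signal (N - Suc l)))"
    "\<And>x u. (\<And>i j. i \<le> j \<Longrightarrow> j < N \<Longrightarrow> u j \<le> u i) \<Longrightarrow> (\<And>i. i < N \<Longrightarrow> 0 \<le> u i) \<Longrightarrow>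
       (\<Sum>i<N. u i * block_cross x (N - Suc i))\<^sup>2 \<le> W x * (\<Sum>i<N. (u i)\<^sup>2 * block_signal (N - Suc i))"
  proof (rule weighted_rademacher_menshov[of N M "\<lambda>j x. block_cross x (N - Suc j)" "\<sigma>\<^sup>2"
        "\<lambda>j. block_signal (N - Suc j)"])
    show "integrable M (\<lambda>x. (\<Sum>i\<in>{a..<b}. block_cross x (N - Suc i))\<^sup>2)" if "b \<le> N" for a b
      by (rule int[OF that])
    show "(\<integral>x. (\<Sum>i\<in>{a..<b}. block_cross x (N - Suc i))\<^sup>2 \<partial>M)
        \<le> \<sigma>\<^sup>2 * (\<Sum>i\<in>{a..<b}. block_signal (N - Suc i))"
      if "a \<le> b" "b \<le> N" for a b by (rule E[OF that])
  qed (use block_signal_nonneg zero N_pos in auto)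
  have "(\<Sum>l<Suc i. block_signal (N - Suc l)) = tail_signal (N - Suc i)" if "i < N" for i
    using sumS[of 0 "Suc i"] that by (simp add: tail_signal_def atLeast0LessThan)
  then have "(\<Sum>i<N. block_signal (N - Suc i) / (\<Sum>l<Suc i. block_signal (N - Suc l)))
      = (\<Sum>i<N. block_signal (N - Suc i) / tail_signal (N - Suc i))"
    by (intro sum.cong refl) simp
  also have "\<dots> = (\<Sum>j<N. block_signal j / tail_signal j)" by (rule rev0)
  finally have "(\<integral>x. W x \<partial>M) \<le> 9/4 * \<sigma>\<^sup>2 * ((\<Sum>j<N. block_signal j / tail_signal j) * (1 + ln (real N))\<^sup>2)"
    using W(3) by (simp only: mult_ac)
  also have "\<dots> \<le> 9/4 * \<sigma>\<^sup>2 * (4 * psi (theta n X f) k N)"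
    by (intro mult_left_mono signal_ratio_sum_le) auto
  finally have W3: "(\<integral>x. W x \<partial>M) \<le> 9 * \<sigma>\<^sup>2 * psi (theta n X f) k N" by simp
  have "(\<Sum>j<N. u j * block_cross x j)\<^sup>2 \<le> W x * (\<Sum>j<N. (u j)\<^sup>2 * block_signal j)"
    if u: "\<And>i j. i \<le> j \<Longrightarrow> j < N \<Longrightarrow> u i \<le> u j" "\<And>i. i < N \<Longrightarrow> 0 \<le> u i" for x u
  proof -
    have "(\<Sum>i<N. u (N - Suc i) * block_cross x (N - Suc i))\<^sup>2
        \<le> W x * (\<Sum>i<N. (u (N - Suc i))\<^sup>2 * block_signal (N - Suc i))"
      by (rule W(4)) (auto intro!: u)
    then show ?thesis unfolding rev0[of "\<lambda>j. u j * block_cross x j"] rev0[of "\<lambda>j. (u j)\<^sup>2 * block_signal j"] .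
  qed
  then show ?thesis using W(1,2) W3 that by blast
qed

text \<open>The factor \<open>(1 - g)\<^sup>2 - 1\<close> of the cross products in \<open>criterion_eq\<close> is replaced by \<open>(1 - g)\<^sup>2\<close>, which
  changes the criterion by a constant and makes the factor small where the risk is small.\<close>
definition criterion_dev :: "'a \<Rightarrow> real \<Rightarrow> (nat \<Rightarrow> real) \<Rightarrow> real" where
  "criterion_dev x s w = 2 * (\<Sum>j<N. (1 - tail_weight w j)\<^sup>2 * block_cross x j)
     - (\<Sum>j<N. (2 * tail_weight w j - (tail_weight w j)\<^sup>2) * block_excess x j)
     + 2 * (s - \<sigma>\<^sup>2) * (\<Sum>l\<in>{1..p}. coord_weight k N w l)"

section \<open>Deviations of criterion and loss from the risk\<close>

lemma criterion_le_imp: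
  assumes "mma_crit n X k N s (noisy n f \<epsilon> x) w' \<le> mma_crit n X k N s (noisy n f \<epsilon> x) w"
  shows "total_risk (coord_weight k N w') + criterion_dev x s w'
    \<le> total_risk (coord_weight k N w) + criterion_dev x s w"
proof -
  obtain c where c: "\<And>w. real n * mma_crit n X k N s (noisy n f \<epsilon> x) w
    = c + total_risk (coord_weight k N w)
      + 2 * (\<Sum>l\<in>{1..p}. ((1 - coord_weight k N w l)\<^sup>2 - 1) * (signal_coef l * noise_coef x l))
      + (\<Sum>l\<in>{1..p}. ((coord_weight k N w l)\<^sup>2 - 2 * coord_weight k N w l) * excess x l)
      + 2 * (s - \<sigma>\<^sup>2) * (\<Sum>l\<in>{1..p}. coord_weight k N w l)"
    using criterion_eq[OF k_le_p, of s x] by blast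
  have "real n * mma_crit n X k N s (noisy n f \<epsilon> x) w
    = (c - 2 * (\<Sum>j<N. block_cross x j)) + (total_risk (coord_weight k N w) + criterion_dev x s w)" for w
  proof -
    have 1: "(\<Sum>l\<in>{1..p}. ((1 - coord_weight k N w l)\<^sup>2 - 1) * (signal_coef l * noise_coef x l))
        = (\<Sum>j<N. ((1 - tail_weight w j)\<^sup>2 - 1) * block_cross x j)"
      unfolding block_cross_def by (rule sum_coord_weight'[of "\<lambda>t. (1 - t)\<^sup>2 - 1"]) simp
    have 2: "(\<Sum>l\<in>{1..p}. ((coord_weight k N w l)\<^sup>2 - 2 * coord_weight k N w l) * excess x l)
        = (\<Sum>j<N. ((tail_weight w j)\<^sup>2 - 2 * tail_weight w j) * block_excess x j)"
      unfolding block_excess_def by (rule sum_coord_weight'[of "\<lambda>t. t\<^sup>2 - 2 * t"]) simp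
    show ?thesis unfolding c 1 2 criterion_dev_def
      by (simp add: left_diff_distrib sum_subtractf)
  qed
  then show ?thesis using mult_left_mono[OF assms, of "real n"] by simp
qed

text \<open>Every weight function that occurs is monotone in the tail weight, and it is dominated by
  \<open>1 - t\<close> (cross products) or by \<open>t\<close> or \<open>2 * t\<close> (squared
  noise); the envelopes and \<open>total_risk_lower\<close> then give a multiple of
  \<open>r\<close>. The factor \<open>b\<close> is free of \<open>w\<close>, so one random variable
  serves all weights.\<close>

lemma deviation_bounds:
  fixes s :: real
  assumes w: "w \<in> wsimplex N" and W1: "0 \<le> W1" and W2: "0 \<le> W2"
    and E: "\<And>u. (\<And>i j. i \<le> j \<Longrightarrow> j < N \<Longrightarrow> u j \<le> u i) \<Longrightarrow> (\<And>i. i < N \<Longrightarrow> 0 \<le> u i) \<Longrightarrow>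
       (\<Sum>j<N. u j * block_excess x j)\<^sup>2 \<le> W1 * (\<Sum>j<N. (u j)\<^sup>2 * block_size j)"
    and S: "\<And>u. (\<And>i j. i \<le> j \<Longrightarrow> j < N \<Longrightarrow> u i \<le> u j) \<Longrightarrow> (\<And>i. i < N \<Longrightarrow> 0 \<le> u i) \<Longrightarrow>
       (\<Sum>j<N. u j * block_cross x j)\<^sup>2 \<le> W2 * (\<Sum>j<N. (u j)\<^sup>2 * block_signal j)"
  defines "r \<equiv> sqrt (total_risk (coord_weight k N w))"
    and "b \<equiv> 4 * sqrt W2 + 2 * sqrt W1 / \<sigma> + 2 * \<bar>s - \<sigma>\<^sup>2\<bar> * sqrt (real (k N)) / \<sigma>"
  shows "\<bar>criterion_dev x s w\<bar> \<le> b * r"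
    and "\<bar>(\<Sum>j<N. (tail_weight w j)\<^sup>2 * block_excess x j)
      - 2 * (\<Sum>j<N. (tail_weight w j * (1 - tail_weight w j)) * block_cross x j)\<bar> \<le> b * r"
proof -
  let ?t = "tail_weight w" and ?\<rho> = "total_risk (coord_weight k N w)"
  note t = tail_weight_bounds[OF w]
  have t01: "0 \<le> ?t j" "?t j \<le> 1" "0 \<le> 1 - ?t j" "1 - ?t j \<le> 1" for j using t by auto
  have \<rho>0: "0 \<le> ?\<rho>" by (rule total_risk_lower)
  have r0: "0 \<le> r" by (simp add: r_def \<rho>0)
  have size_le: "(\<Sum>j<N. (?t j)\<^sup>2 * block_size j) \<le> ?\<rho> / \<sigma>\<^sup>2"
    using total_risk_lower(2)[of w] sigma_pos by (simp add: pos_le_divide_eq mult.commute)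
  have X: "\<bar>\<Sum>j<N. u j * block_cross x j\<bar> \<le> sqrt W2 * r"
    if u: "\<And>i j. i \<le> j \<Longrightarrow> j < N \<Longrightarrow> u i \<le> u j" "\<And>i. 0 \<le> u i" "\<And>i. u i \<le> 1 - ?t i" for u
  proof -
    have "(\<Sum>j<N. (u j)\<^sup>2 * block_signal j) \<le> (\<Sum>j<N. (1 - ?t j)\<^sup>2 * block_signal j)"
      using u(2,3) by (intro sum_mono mult_right_mono power_mono) (auto simp: block_signal_nonneg)
    also have "\<dots> \<le> ?\<rho>" by (rule total_risk_lower)
    finally have "(\<Sum>j<N. u j * block_cross x j)\<^sup>2 \<le> W2 * ?\<rho>"
      using S[of u, OF u(1,2)] mult_left_mono[OF _ W2] by (meson order_trans)
    then show ?thesis unfolding r_def real_sqrt_mult[symmetric] by (rule real_le_rsqrt[of "\<bar>_\<bar>", unfolded power2_abs])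
  qed
  have Eb: "\<bar>\<Sum>j<N. u j * block_excess x j\<bar> \<le> c * (sqrt W1 * r / \<sigma>)"
    if u: "\<And>i j. i \<le> j \<Longrightarrow> j < N \<Longrightarrow> u j \<le> u i" "\<And>i. 0 \<le> u i" "\<And>i. u i \<le> c * ?t i" and c: "0 \<le> c" for u c
  proof -
    have "(\<Sum>j<N. (u j)\<^sup>2 * block_size j) \<le> (\<Sum>j<N. (c * ?t j)\<^sup>2 * block_size j)"
      using u(2,3) block_size_pos by (intro sum_mono mult_right_mono power_mono) (auto simp: less_imp_le)
    also have "\<dots> = c\<^sup>2 * (\<Sum>j<N. (?t j)\<^sup>2 * block_size j)"
      by (simp add: power_mult_distrib sum_distrib_left mult.assoc)
    also have "\<dots> \<le> c\<^sup>2 * (?\<rho> / \<sigma>\<^sup>2)" by (intro mult_left_mono size_le) simp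
    finally have "(\<Sum>j<N. u j * block_excess x j)\<^sup>2 \<le> W1 * (c\<^sup>2 * (?\<rho> / \<sigma>\<^sup>2))"
      using E[of u, OF u(1,2)] mult_left_mono[OF _ W1] by (meson order_trans)
    then have "\<bar>\<Sum>j<N. u j * block_excess x j\<bar> \<le> sqrt (W1 * (c\<^sup>2 * (?\<rho> / \<sigma>\<^sup>2)))"
      by (rule real_le_rsqrt[of "\<bar>_\<bar>", unfolded power2_abs])
    also have "\<dots> = c * (sqrt W1 * r / \<sigma>)"
      using c sigma_pos by (simp add: r_def real_sqrt_mult real_sqrt_divide)
    finally show ?thesis .
  qed
  have X1: "\<bar>\<Sum>j<N. (1 - ?t j)\<^sup>2 * block_cross x j\<bar> \<le> sqrt W2 * r"
  proof (rule X)
    show "(1 - ?t i)\<^sup>2 \<le> (1 - ?t j)\<^sup>2" if "i \<le> j" for i j using t(3)[OF that] t01 by (intro power_mono) auto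
    show "(1 - ?t i)\<^sup>2 \<le> 1 - ?t i" for i
      using mult_right_mono[OF t01(4)[of i] t01(3)[of i]] by (simp add: power2_eq_square)
  qed simp
  have X2: "\<bar>\<Sum>j<N. (1 - ?t j) * block_cross x j\<bar> \<le> sqrt W2 * r"
    by (rule X) (use t01 t(3) in auto)
  have E1: "\<bar>\<Sum>j<N. (?t j)\<^sup>2 * block_excess x j\<bar> \<le> 1 * (sqrt W1 * r / \<sigma>)"
  proof (rule Eb)
    show "(?t j)\<^sup>2 \<le> (?t i)\<^sup>2" if "i \<le> j" for i j using t(3)[OF that] t01 by (intro power_mono) auto
    show "(?t i)\<^sup>2 \<le> 1 * ?t i" for i
      using mult_right_mono[OF t01(2)[of i] t01(1)[of i]] by (simp add: power2_eq_square)
  qed auto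
  have E2: "\<bar>\<Sum>j<N. (2 * ?t j - (?t j)\<^sup>2) * block_excess x j\<bar> \<le> 2 * (sqrt W1 * r / \<sigma>)"
  proof (rule Eb)
    show "2 * ?t j - (?t j)\<^sup>2 \<le> 2 * ?t i - (?t i)\<^sup>2" if "i \<le> j" for i j
    proof -
      have "0 \<le> (?t i - ?t j) * ((1 - ?t i) + (1 - ?t j))"
        using t(3)[OF that] t01 by (intro mult_nonneg_nonneg add_nonneg_nonneg) auto
      then show ?thesis by (simp add: power2_eq_square algebra_simps)
    qed
    show "0 \<le> 2 * ?t i - (?t i)\<^sup>2" for i
    proof -
      have "(?t i)\<^sup>2 \<le> ?t i"
        using mult_right_mono[OF t01(2)[of i] t01(1)[of i]] by (simp add: power2_eq_square)
      then show ?thesis using t01(1)[of i] by linarith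
    qed
  qed auto
  \<comment> \<open>Cauchy-Schwarz over the \<open>k N\<close> coordinates that can carry weight;
    this produces the factor \<open>k N\<close> in front of the mean squared error of the variance
    estimator.\<close>
  have P: "\<bar>\<Sum>l\<in>{1..p}. coord_weight k N w l\<bar> \<le> sqrt (real (k N)) * r / \<sigma>"
  proof -
    have "(\<Sum>l\<in>{1..p}. coord_weight k N w l) = (\<Sum>l\<in>{1..k N}. 1 * coord_weight k N w l)"
      using kN by (simp, intro sum.mono_neutral_right) (auto simp: coord_weight_outside)
    then have "(\<Sum>l\<in>{1..p}. coord_weight k N w l)\<^sup>2
        \<le> (\<Sum>l\<in>{1..k N}. 1\<^sup>2) * (\<Sum>l\<in>{1..k N}. (coord_weight k N w l)\<^sup>2)"
      by (simp only: Cauchy_Schwarz_ineq_sum)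
    also have "\<dots> \<le> real (k N) * (\<Sum>l\<in>{1..p}. (coord_weight k N w l)\<^sup>2)"
      using kN by (simp, intro mult_left_mono sum_mono2) auto
    also have "\<dots> \<le> real (k N) * (?\<rho> / \<sigma>\<^sup>2)"
      using total_risk_lower(3)[of w] sigma_pos
      by (intro mult_left_mono) (simp_all add: pos_le_divide_eq mult.commute)
    finally have "\<bar>\<Sum>l\<in>{1..p}. coord_weight k N w l\<bar> \<le> sqrt (real (k N) * (?\<rho> / \<sigma>\<^sup>2))"
      by (rule real_le_rsqrt[of "\<bar>_\<bar>", unfolded power2_abs])
    then show ?thesis using sigma_pos by (simp add: r_def real_sqrt_mult real_sqrt_divide)
  qed
  have P': "\<bar>2 * (s - \<sigma>\<^sup>2) * (\<Sum>l\<in>{1..p}. coord_weight k N w l)\<bar>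
      \<le> 2 * \<bar>s - \<sigma>\<^sup>2\<bar> * (sqrt (real (k N)) * r / \<sigma>)"
    unfolding abs_mult using P by (intro mult_mono) auto
  have br: "b * r = 4 * (sqrt W2 * r) + 2 * (sqrt W1 * r / \<sigma>) + 2 * \<bar>s - \<sigma>\<^sup>2\<bar> * (sqrt (real (k N)) * r / \<sigma>)"
    by (simp add: b_def algebra_simps)
  have n1: "0 \<le> sqrt W2 * r" "0 \<le> sqrt W1 * r / \<sigma>" "0 \<le> 2 * \<bar>s - \<sigma>\<^sup>2\<bar> * (sqrt (real (k N)) * r / \<sigma>)"
    using W1 W2 r0 sigma_pos by auto
  show "\<bar>criterion_dev x s w\<bar> \<le> b * r"
    unfolding criterion_dev_def br using X1 E2 P' n1 by linarith
  \<comment> \<open>\<open>t * (1 - t)\<close> is not monotone in \<open>t\<close>, but it is a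
    difference of two monotone functions. Two terms with factor 2 each account for
    \<open>4 * sqrt W2\<close> in \<open>b\<close>.\<close>
  have split: "(\<Sum>j<N. (?t j * (1 - ?t j)) * block_cross x j)
      = (\<Sum>j<N. (1 - ?t j) * block_cross x j) - (\<Sum>j<N. (1 - ?t j)\<^sup>2 * block_cross x j)"
    unfolding sum_subtractf[symmetric] by (intro sum.cong refl) (simp add: power2_eq_square algebra_simps)
  show "\<bar>(\<Sum>j<N. (?t j)\<^sup>2 * block_excess x j) - 2 * (\<Sum>j<N. (?t j * (1 - ?t j)) * block_cross x j)\<bar> \<le> b * r"
    unfolding split br
  proof -
    have gen: "\<bar>e - 2 * (x2 - x1)\<bar> \<le> 4 * A + 2 * B + C"
      if "\<bar>x1\<bar> \<le> A" "\<bar>x2\<bar> \<le> A" "\<bar>e\<bar> \<le> 1 * B" "0 \<le> B" "0 \<le> C" for x1 x2 e A B C :: real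
      using that by (auto simp: abs_le_iff)
    show "\<bar>(\<Sum>j<N. (?t j)\<^sup>2 * block_excess x j) - 2 * ((\<Sum>j<N. (1 - ?t j) * block_cross x j)
        - (\<Sum>j<N. (1 - ?t j)\<^sup>2 * block_cross x j))\<bar>
      \<le> 4 * (sqrt W2 * r) + 2 * (sqrt W1 * r / \<sigma>) + 2 * \<bar>s - \<sigma>\<^sup>2\<bar> * (sqrt (real (k N)) * r / \<sigma>)"
      by (rule gen[OF X1 X2 E1 n1(2,3)])
  qed
qed

lemma loss_eq_blocks:
  "sqn n (\<lambda>i. ma_fit n X k N w (noisy n f \<epsilon> x) i - f i) = total_risk (coord_weight k N w)
    + ((\<Sum>j<N. (tail_weight w j)\<^sup>2 * block_excess x j)
      - 2 * (\<Sum>j<N. (tail_weight w j * (1 - tail_weight w j)) * block_cross x j))"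
proof -
  have 1: "(\<Sum>l\<in>{1..p}. (coord_weight k N w l)\<^sup>2 * excess x l) = (\<Sum>j<N. (tail_weight w j)\<^sup>2 * block_excess x j)"
    unfolding block_excess_def by (rule sum_coord_weight'[of "\<lambda>t. t\<^sup>2"]) simp
  have 2: "(\<Sum>l\<in>{1..p}. (coord_weight k N w l * (1 - coord_weight k N w l)) * (signal_coef l * noise_coef x l))
     = (\<Sum>j<N. (tail_weight w j * (1 - tail_weight w j)) * block_cross x j)"
    unfolding block_cross_def by (rule sum_coord_weight'[of "\<lambda>t. t * (1 - t)"]) simp
  show ?thesis unfolding loss_eq[OF k_le_p] 1 2 by simp
qed

end

section \<open>Asymptotic optimality\<close>

text \<open>The difference of squares factors as \<open>(r' - r) * (r' + r)\<close> and is at most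
  \<open>b * (r' + r)\<close>; the common factor is divided out. This works because the deviations
  are proportional to the roots of the risks.\<close>

lemma quadratic_oracle_le:
  fixes r r' b d d' :: real
  assumes "r'\<^sup>2 + d' \<le> r\<^sup>2 + d" "\<bar>d\<bar> \<le> b * r" "\<bar>d'\<bar> \<le> b * r'" "0 \<le> r" "0 \<le> b"
  shows "r' \<le> r + b"
proof (rule ccontr)
  assume *: "\<not> r' \<le> r + b"
  have "(r' - r) * (r' + r) \<le> b * (r' + r)"
    using assms(1-3) by (auto simp: abs_le_iff power2_eq_square algebra_simps)
  moreover have "b * (r' + r) < (r' - r) * (r' + r)"
    using * assms(4,5) by (intro mult_strict_right_mono) auto
  ultimately show False by simp
qed

text \<open>Young's inequality with a free \<open>t\<close>: the factor of the main term has to tend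
  to 1, so the large factor \<open>1 + 1/t\<close> is put on the negligible term.\<close>

lemma square_add_le_weighted:
  fixes a b t :: real
  assumes "0 < t"
  shows "(a + b)\<^sup>2 \<le> (1 + t) * a\<^sup>2 + (1 + 1/t) * b\<^sup>2"
proof -
  have "0 \<le> (t * a - b)\<^sup>2 / t" using assms by simp
  also have "\<dots> = t * a\<^sup>2 - 2 * a * b + b\<^sup>2 / t"
    using assms by (simp add: power2_eq_square field_simps)
  finally show ?thesis by (simp add: power2_sum algebra_simps)
qed

lemma square_sum3_le: "(a + b + c)\<^sup>2 \<le> 3 * (a\<^sup>2 + b\<^sup>2 + c\<^sup>2)" for a b c :: real
  using zero_le_power2[of "a - b"] zero_le_power2[of "b - c"] zero_le_power2[of "a - c"]
  by (simp add: power2_eq_square algebra_simps)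

section \<open>Oracle inequality at a fixed sample size\<close>

context noise_model begin

text \<open>12 is 4 from \<open>(2 * b)\<^sup>2\<close> times 3 from squaring three summands.
  Inside, 144 = 16 * 9 and 36 = 4 * 9 combine the squared coefficients in \<open>b\<close> with the
  9 of the envelopes; the last 4 belongs to the variance estimator.\<close>

definition risk_const :: real where
  "risk_const = 12 * (144 * \<sigma>\<^sup>2 + 36 * quad_const / \<sigma>\<^sup>2 + 4 / \<sigma>\<^sup>2)"

lemma risk_const_pos: "0 < risk_const"
proof -
  have "0 < 144 * \<sigma>\<^sup>2" "0 \<le> 36 * quad_const / \<sigma>\<^sup>2" "0 < 4 / \<sigma>\<^sup>2"
    using sigma_pos quad_const_nonneg by auto
  then show ?thesis unfolding risk_const_def by (intro mult_pos_pos add_pos_pos add_pos_nonneg) simp_all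
qed

end

context nested_model begin

lemma psi_nonneg: "0 \<le> psi (theta n X f) k N"
proof -
  have "0 \<le> (\<Sum>j<N. block_signal j / tail_signal j) * (1 + ln (real N))\<^sup>2"
    by (intro mult_nonneg_nonneg sum_nonneg divide_nonneg_nonneg)
      (auto simp: block_signal_nonneg tail_signal_nonneg)
  then show ?thesis using signal_ratio_sum_le by linarith
qed

lemma wsimplex_nonempty: "wsimplex N \<noteq> {}"
proof -
  have "(\<lambda>m. if m = 1 then 1 else 0) \<in> wsimplex N"
    using N_pos by (simp add: wsimplex_def)
  then show ?thesis by blast
qed

text \<open>\<open>opt_risk\<close> is an infimum, so comparisons with the optimum are proved for
  each fixed \<open>w\<close> and transferred here.\<close>

lemma le_opt_risk:
  assumes "\<And>w. w \<in> wsimplex N \<Longrightarrow> c \<le> total_risk (coord_weight k N w)"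
  shows "c \<le> real n * opt_risk M \<epsilon> n X k N f"
proof -
  have "c / real n \<le> opt_risk M \<epsilon> n X k N f"
    unfolding opt_risk_def using assms n_pos
    by (intro cINF_greatest wsimplex_nonempty) (simp add: risk_eq[OF k_le_p] divide_right_mono)
  then show ?thesis using n_pos by (simp add: pos_divide_le_eq mult.commute)
qed

lemma opt_risk_nonneg: "0 \<le> real n * opt_risk M \<epsilon> n X k N f"
  by (rule le_opt_risk) (rule total_risk_lower)

text \<open>Pathwise, risk and loss at the selected weights are both at most
  \<open>(sqrt (\<rho> w) + 2 * b)\<^sup>2\<close> for every \<open>w\<close>. Young's inequality
  separates the deterministic \<open>\<rho> w\<close> from \<open>b\<^sup>2\<close>, and only then
  is the expectation taken.\<close>

lemma Q_bounds:
  fixes sh :: "(nat \<Rightarrow> real) \<Rightarrow> real" and what :: "(nat \<Rightarrow> real) \<Rightarrow> nat \<Rightarrow> real"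
  assumes what: "\<And>y. what y \<in> wsimplex N"
    "\<And>y w. w \<in> wsimplex N \<Longrightarrow> mma_crit n X k N (sh y) y (what y) \<le> mma_crit n X k N (sh y) y w"
    and int: "integrable M (\<lambda>x. (sh (noisy n f \<epsilon> x) - \<sigma>\<^sup>2)\<^sup>2)" and t: "0 < t"
  defines "c \<equiv> (1 + 1/t) * (risk_const * (psi (theta n X f) k N
      + real (k N) * (\<integral>x. (sh (noisy n f \<epsilon> x) - \<sigma>\<^sup>2)\<^sup>2 \<partial>M)))"
  shows "real n * Q_loss M \<epsilon> n X k N f what \<le> (1 + t) * (real n * opt_risk M \<epsilon> n X k N f) + c"
    and "real n * Q_risk M \<epsilon> n X k N f what \<le> (1 + t) * (real n * opt_risk M \<epsilon> n X k N f) + c"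
proof -
  obtain W1 where W1: "integrable M W1" "\<And>x. 0 \<le> W1 x"
    "(\<integral>x. W1 x \<partial>M) \<le> 9 * quad_const * psi (theta n X f) k N"
    "\<And>x u. (\<And>i j. i \<le> j \<Longrightarrow> j < N \<Longrightarrow> u j \<le> u i) \<Longrightarrow> (\<And>i. i < N \<Longrightarrow> 0 \<le> u i) \<Longrightarrow>
       (\<Sum>j<N. u j * block_excess x j)\<^sup>2 \<le> W1 x * (\<Sum>j<N. (u j)\<^sup>2 * block_size j)"
    using noise_envelope by blast
  obtain W2 where W2: "integrable M W2" "\<And>x. 0 \<le> W2 x"
    "(\<integral>x. W2 x \<partial>M) \<le> 9 * \<sigma>\<^sup>2 * psi (theta n X f) k N"
    "\<And>x u. (\<And>i j. i \<le> j \<Longrightarrow> j < N \<Longrightarrow> u i \<le> u j) \<Longrightarrow> (\<And>i. i < N \<Longrightarrow> 0 \<le> u i) \<Longrightarrow>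
       (\<Sum>j<N. u j * block_cross x j)\<^sup>2 \<le> W2 x * (\<Sum>j<N. (u j)\<^sup>2 * block_signal j)"
    using signal_envelope by blast
  define y where "y x = noisy n f \<epsilon> x" for x
  define v where "v x = (sh (y x) - \<sigma>\<^sup>2)\<^sup>2" for x
  define \<rho> where "\<rho> w = total_risk (coord_weight k N w)" for w
  define b where "b x = 4 * sqrt (W2 x) + 2 * sqrt (W1 x) / \<sigma>
    + 2 * \<bar>sh (y x) - \<sigma>\<^sup>2\<bar> * sqrt (real (k N)) / \<sigma>" for x
  define H where "H x = 12 * (16 * W2 x + 4 * W1 x / \<sigma>\<^sup>2 + 4 * real (k N) * v x / \<sigma>\<^sup>2)" for x
  have \<rho>0: "0 \<le> \<rho> w" for w unfolding \<rho>_def by (rule total_risk_lower)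
  have b0: "0 \<le> b x" for x
    unfolding b_def using W1(2) W2(2) sigma_pos by (intro add_nonneg_nonneg divide_nonneg_nonneg) auto
  have bH: "(2 * b x)\<^sup>2 \<le> H x" for x
  proof -
    have "(b x)\<^sup>2 \<le> 3 * ((4 * sqrt (W2 x))\<^sup>2 + (2 * sqrt (W1 x) / \<sigma>)\<^sup>2
      + (2 * \<bar>sh (y x) - \<sigma>\<^sup>2\<bar> * sqrt (real (k N)) / \<sigma>)\<^sup>2)"
      unfolding b_def by (rule square_sum3_le)
    also have "\<dots> = 3 * (16 * W2 x + 4 * W1 x / \<sigma>\<^sup>2 + 4 * real (k N) * v x / \<sigma>\<^sup>2)"
      using W1(2)[of x] W2(2)[of x] by (simp add: power_mult_distrib power_divide v_def)
    finally show ?thesis by (simp add: H_def power_mult_distrib)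
  qed
  have vint: "integrable M v" unfolding v_def[abs_def] y_def by (rule int)
  have Hint: "integrable M H" unfolding H_def[abs_def] using W1(1) W2(1) vint by simp
  have H0: "0 \<le> H x" for x using bH[of x] zero_le_power2 order_trans by blast
  have EH: "(\<integral>x. H x \<partial>M) \<le> risk_const * (psi (theta n X f) k N + real (k N) * (\<integral>x. v x \<partial>M))"
  proof -
    let ?\<psi> = "psi (theta n X f) k N" and ?V = "real (k N) * (\<integral>x. v x \<partial>M)"
    have V0: "0 \<le> ?V" by (simp add: v_def)
    have q: "0 \<le> 36 * quad_const / \<sigma>\<^sup>2" "0 \<le> 4 / \<sigma>\<^sup>2" "0 \<le> 144 * \<sigma>\<^sup>2" using quad_const_nonneg by auto
    have "(\<integral>x. H x \<partial>M) = 12 * (16 * (\<integral>x. W2 x \<partial>M) + 4 * (\<integral>x. W1 x \<partial>M) / \<sigma>\<^sup>2 + 4 / \<sigma>\<^sup>2 * ?V)"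
      unfolding H_def using W1(1) W2(1) vint by simp
    also have "\<dots> \<le> 12 * (16 * (9 * \<sigma>\<^sup>2 * ?\<psi>) + 4 * (9 * quad_const * ?\<psi>) / \<sigma>\<^sup>2 + 4 / \<sigma>\<^sup>2 * ?V)"
      using W1(3) W2(3) sigma_pos by (intro mult_left_mono add_mono divide_right_mono) auto
    also have "\<dots> = 12 * (144 * \<sigma>\<^sup>2 * ?\<psi> + 36 * quad_const / \<sigma>\<^sup>2 * ?\<psi> + 4 / \<sigma>\<^sup>2 * ?V)" by simp
    also have "\<dots> \<le> 12 * ((144 * \<sigma>\<^sup>2 + 36 * quad_const / \<sigma>\<^sup>2 + 4 / \<sigma>\<^sup>2) * (?\<psi> + ?V))"
      using mult_nonneg_nonneg[OF q(1) V0] mult_nonneg_nonneg[OF q(3) V0] mult_nonneg_nonneg[OF q(2) psi_nonneg]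
      by (simp add: distrib_left distrib_right)
    finally show ?thesis by (simp only: risk_const_def mult.assoc)
  qed
  have main: "\<rho> (what (y x)) \<le> (1 + t) * \<rho> w + (1 + 1/t) * H x
     \<and> sqn n (\<lambda>i. ma_fit n X k N (what (y x)) (y x) i - f i) \<le> (1 + t) * \<rho> w + (1 + 1/t) * H x"
    if w: "w \<in> wsimplex N" for w x
  proof -
    define r where "r = sqrt (\<rho> w)"
    define r' where "r' = sqrt (\<rho> (what (y x)))"
    have sq: "r\<^sup>2 = \<rho> w" "r'\<^sup>2 = \<rho> (what (y x))" by (simp_all add: r_def r'_def \<rho>0)
    have nn: "0 \<le> r" "0 \<le> r'" by (simp_all add: r_def r'_def \<rho>0)
    have dev: "\<bar>criterion_dev x (sh (y x)) w'\<bar> \<le> b x * sqrt (\<rho> w')"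
      "\<bar>(\<Sum>j<N. (tail_weight w' j)\<^sup>2 * block_excess x j)
        - 2 * (\<Sum>j<N. (tail_weight w' j * (1 - tail_weight w' j)) * block_cross x j)\<bar> \<le> b x * sqrt (\<rho> w')"
      if "w' \<in> wsimplex N" for w'
      unfolding b_def \<rho>_def
      by (rule deviation_bounds[OF that W1(2) W2(2)], fact W1(4), fact W2(4))+
    have le: "r' \<le> r + b x"
    proof (rule quadratic_oracle_le[OF _ _ _ nn(1) b0])
      show "r'\<^sup>2 + criterion_dev x (sh (y x)) (what (y x)) \<le> r\<^sup>2 + criterion_dev x (sh (y x)) w"
        unfolding sq \<rho>_def y_def by (rule criterion_le_imp[OF what(2)[OF w]])
      show "\<bar>criterion_dev x (sh (y x)) w\<bar> \<le> b x * r" unfolding r_def by (rule dev(1)[OF w])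
      show "\<bar>criterion_dev x (sh (y x)) (what (y x))\<bar> \<le> b x * r'" unfolding r'_def by (rule dev(1)[OF what(1)])
    qed
    have up: "(r + 2 * b x)\<^sup>2 \<le> (1 + t) * \<rho> w + (1 + 1/t) * H x"
    proof -
      have "(r + 2 * b x)\<^sup>2 \<le> (1 + t) * r\<^sup>2 + (1 + 1/t) * (2 * b x)\<^sup>2" by (rule square_add_le_weighted[OF t])
      also have "\<dots> \<le> (1 + t) * r\<^sup>2 + (1 + 1/t) * H x"
        using t bH[of x] by (intro add_left_mono mult_left_mono) auto
      finally show ?thesis by (simp only: sq)
    qed
    \<comment> \<open>The loss exceeds the risk \<open>r'\<^sup>2\<close> by at most
      \<open>b * r'\<close>, which completing the square absorbs into one \<open>b\<close>; the
      other \<open>b\<close> comes from \<open>r' \<le> r + b\<close>.\<close>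
    have "sqn n (\<lambda>i. ma_fit n X k N (what (y x)) (y x) i - f i) \<le> r'\<^sup>2 + b x * r'"
      unfolding sq y_def loss_eq_blocks
      using dev(2)[OF what(1), of "y x"] unfolding y_def \<rho>_def r'_def by linarith
    also have "\<dots> \<le> (r' + b x)\<^sup>2" using nn b0[of x] by (simp add: power2_sum)
    also have "\<dots> \<le> (r + 2 * b x)\<^sup>2" using nn b0[of x] le by (intro power_mono) auto
    finally have 1: "sqn n (\<lambda>i. ma_fit n X k N (what (y x)) (y x) i - f i) \<le> (r + 2 * b x)\<^sup>2" .
    have "r'\<^sup>2 \<le> (r + 2 * b x)\<^sup>2" using nn b0[of x] le by (intro power_mono) auto
    then show ?thesis using 1 up unfolding sq by linarith
  qed
  have bound: "(\<integral>x. g x \<partial>M) \<le> (1 + t) * (real n * opt_risk M \<epsilon> n X k N f) + c"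
    if g: "\<And>w x. w \<in> wsimplex N \<Longrightarrow> g x \<le> (1 + t) * \<rho> w + (1 + 1/t) * H x" for g
  proof -
    have "((\<integral>x. g x \<partial>M) - c) / (1 + t) \<le> real n * opt_risk M \<epsilon> n X k N f"
    proof (rule le_opt_risk)
      fix w assume w: "w \<in> wsimplex N"
      \<comment> \<open>\<open>integral_mono'\<close> rests on the integrable nonnegative majorant;
        a \<open>g\<close> that is not integrable has integral 0.\<close>
      have "(\<integral>x. g x \<partial>M) \<le> (\<integral>x. (1 + t) * \<rho> w + (1 + 1/t) * H x \<partial>M)"
        using g[OF w] t H0 \<rho>0 Hint by (intro integral_mono') auto
      also have "\<dots> = (1 + t) * \<rho> w + (1 + 1/t) * (\<integral>x. H x \<partial>M)"
        using Hint by (simp add: prob_space)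
      also have "\<dots> \<le> (1 + t) * \<rho> w + c"
        unfolding c_def using EH t by (intro add_left_mono mult_left_mono) (auto simp: v_def y_def)
      finally show "((\<integral>x. g x \<partial>M) - c) / (1 + t) \<le> total_risk (coord_weight k N w)"
        using t by (simp add: pos_divide_le_eq \<rho>_def mult.commute)
    qed
    then show ?thesis using t by (simp add: pos_divide_le_eq mult.commute)
  qed
  have "real n * Q_loss M \<epsilon> n X k N f what
      = (\<integral>x. sqn n (\<lambda>i. ma_fit n X k N (what (y x)) (y x) i - f i) \<partial>M)"
    using n_pos by (simp add: Q_loss_def y_def)
  then show "real n * Q_loss M \<epsilon> n X k N f what \<le> (1 + t) * (real n * opt_risk M \<epsilon> n X k N f) + c"
    using bound main by simp
  have "real n * Q_risk M \<epsilon> n X k N f what = (\<integral>x. \<rho> (what (y x)) \<partial>M)"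
    using n_pos by (simp add: Q_risk_def y_def risk_eq[OF k_le_p] \<rho>_def)
  then show "real n * Q_risk M \<epsilon> n X k N f what \<le> (1 + t) * (real n * opt_risk M \<epsilon> n X k N f) + c"
    using bound main by simp
qed

end

section \<open>Passage to the limit\<close>

lemma exists_vanishing_factor:
  fixes q1 q2 r :: "nat \<Rightarrow> real"
  assumes r: "\<forall>\<^sub>F n in sequentially. 0 \<le> r n"
    and q: "\<And>\<delta>. 0 < \<delta> \<Longrightarrow> \<forall>\<^sub>F n in sequentially. q1 n \<le> (1 + \<delta>) * r n \<and> q2 n \<le> (1 + \<delta>) * r n"
  shows "\<exists>a. a \<longlonglongrightarrow> 0 \<and> (\<forall>\<^sub>F n in sequentially. q1 n \<le> (1 + a n) * r n \<and> q2 n \<le> (1 + a n) * r n)"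
proof -
  \<comment> \<open>The least nonnegative factor that works for both quantities wherever
    \<open>r n\<close> is positive; the hypothesis for each \<open>\<delta>\<close> is what makes it
    tend to 0.\<close>
  define a where "a n = (if 0 < r n then max 0 (max (q1 n) (q2 n) / r n - 1) else 0)" for n
  have "a \<longlonglongrightarrow> 0"
  proof (rule tendstoI)
    fix e :: real assume e: "0 < e"
    from q[of "e/2"] e have "\<forall>\<^sub>F n in sequentially. q1 n \<le> (1 + e/2) * r n \<and> q2 n \<le> (1 + e/2) * r n" by simp
    then show "\<forall>\<^sub>F n in sequentially. dist (a n) 0 < e"
    proof eventually_elim
      case (elim n)
      show ?case
      proof (cases "0 < r n")
        case True
        then have "max (q1 n) (q2 n) / r n \<le> 1 + e/2" using elim by (simp add: pos_divide_le_eq)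
        then show ?thesis using e True by (simp add: a_def)
      qed (simp add: a_def e)
    qed
  qed
  moreover have "\<forall>\<^sub>F n in sequentially. q1 n \<le> (1 + a n) * r n \<and> q2 n \<le> (1 + a n) * r n"
    \<comment> \<open>The instance \<open>\<delta> = 1\<close> covers the indices with
      \<open>r n = 0\<close>: there it says that both quantities are at most 0, so
      \<open>a n = 0\<close> suffices.\<close>
    using r q[of 1, OF zero_less_one]
  proof eventually_elim
    case (elim n)
    show ?case
    proof (cases "0 < r n")
      case True
      have "max (q1 n) (q2 n) / r n \<le> 1 + a n" by (simp add: a_def True)
      then show ?thesis using True by (simp add: pos_divide_le_eq)
    qed (use elim in \<open>auto simp: a_def\<close>)
  qed
  ultimately show ?thesis by blast
qed

lemma (in noise_model) mma_asymptotically_optimal: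
  fixes p :: "nat \<Rightarrow> nat" and X :: "nat \<Rightarrow> nat \<Rightarrow> nat \<Rightarrow> real" and f :: "nat \<Rightarrow> nat \<Rightarrow> real"
    and k :: "nat \<Rightarrow> nat \<Rightarrow> nat" and N :: "nat \<Rightarrow> nat"
  assumes model: "\<And>n. 1 \<le> n \<Longrightarrow> nested_model M \<epsilon> \<sigma> n (p n) (X n) (k n) (N n)"
    and int: "\<forall>\<^sub>F n in sequentially. integrable M (\<lambda>x. (sh n (noisy n (f n) \<epsilon> x) - \<sigma>\<^sup>2)\<^sup>2)"
    and what: "\<And>n y. 1 \<le> n \<Longrightarrow> what n y \<in> wsimplex (N n)"
      "\<And>n y w. 1 \<le> n \<Longrightarrow> w \<in> wsimplex (N n) \<Longrightarrow>
        mma_crit n (X n) (k n) (N n) (sh n y) y (what n y) \<le> mma_crit n (X n) (k n) (N n) (sh n y) y w"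
    and var: "(\<lambda>n. real (k n (N n)) * (\<integral>x. (sh n (noisy n (f n) \<epsilon> x) - \<sigma>\<^sup>2)\<^sup>2 \<partial>M))
      \<in> o(\<lambda>n. real n * opt_risk M \<epsilon> n (X n) (k n) (N n) (f n))"
    and psi: "(\<lambda>n. psi (theta n (X n) (f n)) (k n) (N n))
      \<in> o(\<lambda>n. real n * opt_risk M \<epsilon> n (X n) (k n) (N n) (f n))"
  shows "\<exists>a. a \<longlonglongrightarrow> 0 \<and> (\<forall>\<^sub>F n in sequentially.
      Q_loss M \<epsilon> n (X n) (k n) (N n) (f n) (what n) \<le> (1 + a n) * opt_risk M \<epsilon> n (X n) (k n) (N n) (f n)
    \<and> Q_risk M \<epsilon> n (X n) (k n) (N n) (f n) (what n) \<le> (1 + a n) * opt_risk M \<epsilon> n (X n) (k n) (N n) (f n))"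
proof (rule exists_vanishing_factor)
  let ?R = "\<lambda>n. opt_risk M \<epsilon> n (X n) (k n) (N n) (f n)"
  have R0: "0 \<le> ?R n" if "1 \<le> n" for n
    using nested_model.opt_risk_nonneg[OF model[OF that], of "f n"] that by (simp add: zero_le_mult_iff)
  show "\<forall>\<^sub>F n in sequentially. 0 \<le> ?R n"
    using eventually_ge_at_top[of 1] by eventually_elim (rule R0)
  fix \<delta> :: real assume \<delta>: "0 < \<delta>"
  \<comment> \<open>Half of the slack pays for the factor \<open>1 + t\<close> of the oracle
    inequality, the other half for its remainder, which is eventually at most \<open>t\<close> times
    \<open>n\<close> times the optimal risk.\<close>
  define t where "t = \<delta> / 2"
  define c where "c = (1 + 1/t) * risk_const"
  have t: "0 < t" using \<delta> by (simp add: t_def)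
  then have c: "0 < c" using risk_const_pos unfolding c_def by (intro mult_pos_pos add_pos_pos) auto
  have "(\<lambda>n. psi (theta n (X n) (f n)) (k n) (N n)
      + real (k n (N n)) * (\<integral>x. (sh n (noisy n (f n) \<epsilon> x) - \<sigma>\<^sup>2)\<^sup>2 \<partial>M)) \<in> o(\<lambda>n. real n * ?R n)"
    using psi var by (rule sum_in_smallo)
  then have "\<forall>\<^sub>F n in sequentially. norm (psi (theta n (X n) (f n)) (k n) (N n)
      + real (k n (N n)) * (\<integral>x. (sh n (noisy n (f n) \<epsilon> x) - \<sigma>\<^sup>2)\<^sup>2 \<partial>M)) \<le> t / c * norm (real n * ?R n)"
    by (rule landau_o.smallD) (use t c in simp)
  then show "\<forall>\<^sub>F n in sequentially. Q_loss M \<epsilon> n (X n) (k n) (N n) (f n) (what n) \<le> (1 + \<delta>) * ?R n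
      \<and> Q_risk M \<epsilon> n (X n) (k n) (N n) (f n) (what n) \<le> (1 + \<delta>) * ?R n"
    using int eventually_ge_at_top[of 1]
  proof eventually_elim
    case (elim n)
    interpret nested_model M \<epsilon> \<sigma> n "p n" "X n" "f n" "k n" "N n" using model[OF elim(3)] .
    let ?v = "psi (theta n (X n) (f n)) (k n) (N n)
      + real (k n (N n)) * (\<integral>x. (sh n (noisy n (f n) \<epsilon> x) - \<sigma>\<^sup>2)\<^sup>2 \<partial>M)"
    have "c * ?v \<le> c * (t / c * (real n * ?R n))"
      using elim(1) opt_risk_nonneg c by (intro mult_left_mono) (auto simp: abs_le_iff)
    also have "\<dots> = t * (real n * ?R n)" using c by simp
    finally have cv: "(1 + 1/t) * (risk_const * ?v) \<le> t * (real n * ?R n)" by (simp add: c_def mult.assoc)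
    have "real n * Q \<le> (1 + t) * (real n * ?R n) + (1 + 1/t) * (risk_const * ?v) \<Longrightarrow> Q \<le> (1 + \<delta>) * ?R n" for Q
    proof -
      assume "real n * Q \<le> (1 + t) * (real n * ?R n) + (1 + 1/t) * (risk_const * ?v)"
      then have "real n * Q \<le> (1 + t) * (real n * ?R n) + t * (real n * ?R n)" using cv by linarith
      also have "\<dots> = real n * ((1 + \<delta>) * ?R n)" by (simp add: t_def distrib_right distrib_left)
      finally show ?thesis using elim(3) by simp
    qed
    note this[OF Q_bounds(1)[OF what(1)[OF elim(3)] what(2)[OF elim(3)] elim(2) t]]
      this[OF Q_bounds(2)[OF what(1)[OF elim(3)] what(2)[OF elim(3)] elim(2) t]]
    then show ?case by blast
  qed
qed

section \<open>Mean squared error of the residual variance estimator\<close>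

context regression_model begin

text \<open>The residual is the signal beyond coordinate \<open>m\<close> plus all noise outside the
  first \<open>m\<close> directions. As \<open>phi\<close> need not span the whole of R^n, that
  noise is written as the full sum of squared errors (identity matrix) minus its part in the first
  \<open>m\<close> directions, both centred forms with known moments.\<close>

lemma variance_estimator_eq:
  assumes f: "sqn n f = (\<Sum>l\<in>{1..p}. (signal_coef l)\<^sup>2)" and m: "m \<le> p"
  defines "g \<equiv> \<lambda>i. f i - (\<Sum>l\<in>{1..m}. signal_coef l * phi n X l i)"
  shows "sqn n g = (\<Sum>l\<in>{m + 1..p}. (signal_coef l)\<^sup>2)"
    and "sqn n (\<lambda>i. noisy n f \<epsilon> x i - proj n X m (noisy n f \<epsilon> x) i) - (real n - real m) * \<sigma>\<^sup>2
      = sqn n g + 2 * ipn n g (\<lambda>i. \<epsilon> i x)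
        + centred_quad (\<lambda>i j. if i = j then 1 else 0) (\<sigma>\<^sup>2) n (\<lambda>i. \<epsilon> i x)
        - (\<Sum>l\<in>{1..m}. excess x l)"
proof -
  let ?c = signal_coef and ?e = "noise_coef x" and ?y = "noisy n f \<epsilon> x" and ?\<epsilon> = "\<lambda>i. \<epsilon> i x"
  have o: "orthonormal_upto n (phi n X) m" using gram_schmidt[OF rank m] by simp
  have "(\<Sum>l\<in>{1..p}. (?c l)\<^sup>2) = (\<Sum>l\<in>{1..m}. (?c l)\<^sup>2) + (\<Sum>l\<in>{m + 1..p}. (?c l)\<^sup>2)"
    using m by (subst sum.union_disjoint[symmetric]) (auto intro!: sum.cong)
  moreover have "sqn n g = sqn n f - 2 * (\<Sum>l\<in>{1..m}. ?c l * ?c l) + (\<Sum>l\<in>{1..m}. (?c l)\<^sup>2)"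
    unfolding g_def sqn_diff_orthonormal_sum[OF o] signal_coef_def ..
  ultimately show g: "sqn n g = (\<Sum>l\<in>{m + 1..p}. (?c l)\<^sup>2)"
    by (simp add: f power2_eq_square)
  have "sqn n (\<lambda>i. ?y i - proj n X m ?y i)
      = sqn n ?y - 2 * (\<Sum>l\<in>{1..m}. (?c l + ?e l) * (?c l + ?e l)) + (\<Sum>l\<in>{1..m}. (?c l + ?e l)\<^sup>2)"
    unfolding proj_eq_phi_sum[OF rank m] sqn_diff_orthonormal_sum[OF o] noisy_coef ..
  also have "\<dots> = sqn n ?y - (\<Sum>l\<in>{1..m}. (?c l + ?e l)\<^sup>2)" by (simp add: power2_eq_square)
  also have "sqn n ?y = sqn n f + 2 * ipn n f ?\<epsilon> + sqn n ?\<epsilon>"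
    by (simp add: sqn_def ipn_def noisy_def sum.distrib sum_distrib_left algebra_simps)
  also have "(\<Sum>l\<in>{1..m}. (?c l + ?e l)\<^sup>2)
      = (\<Sum>l\<in>{1..m}. (?c l)\<^sup>2) + 2 * (\<Sum>l\<in>{1..m}. ?c l * ?e l) + (\<Sum>l\<in>{1..m}. (?e l)\<^sup>2)"
    by (simp add: power2_sum sum.distrib sum_distrib_left mult.assoc)
  finally have 1: "sqn n (\<lambda>i. ?y i - proj n X m ?y i) = (sqn n f - (\<Sum>l\<in>{1..m}. (?c l)\<^sup>2))
      + 2 * (ipn n f ?\<epsilon> - (\<Sum>l\<in>{1..m}. ?c l * ?e l)) + sqn n ?\<epsilon> - (\<Sum>l\<in>{1..m}. (?e l)\<^sup>2)" by simp
  have 2: "ipn n f ?\<epsilon> - (\<Sum>l\<in>{1..m}. ?c l * ?e l) = ipn n g ?\<epsilon>"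
    unfolding g_def ipn_diff_left ipn_sum_left noise_coef_def ..
  have 3: "sqn n f - (\<Sum>l\<in>{1..m}. (?c l)\<^sup>2) = sqn n g"
    unfolding g_def sqn_diff_orthonormal_sum[OF o] signal_coef_def by (simp add: power2_eq_square)
  have "(\<Sum>i<n. \<Sum>j<n. (if i = j then 1 else 0) * (\<epsilon> i x * \<epsilon> j x)) = (\<Sum>i<n. \<epsilon> i x * \<epsilon> i x)"
  proof (rule sum.cong[OF refl])
    fix i assume i: "i \<in> {..<n}"
    have "(\<Sum>j<n. (if i = j then 1 else 0) * (\<epsilon> i x * \<epsilon> j x)) = (\<Sum>j<n. if i = j then \<epsilon> i x * \<epsilon> j x else 0)"
      by (intro sum.cong) auto
    then show "(\<Sum>j<n. (if i = j then 1 else 0) * (\<epsilon> i x * \<epsilon> j x)) = \<epsilon> i x * \<epsilon> i x" using i by simp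
  qed
  then have 4: "centred_quad (\<lambda>i j. if i = j then 1 else 0) (\<sigma>\<^sup>2) n ?\<epsilon> = sqn n ?\<epsilon> - real n * \<sigma>\<^sup>2"
    by (simp add: centred_quad_def sqn_def ipn_def mult.commute)
  have 5: "(\<Sum>l\<in>{1..m}. excess x l) = (\<Sum>l\<in>{1..m}. (?e l)\<^sup>2) - real m * \<sigma>\<^sup>2"
    by (simp add: excess_def sum_subtractf)
  show "sqn n (\<lambda>i. ?y i - proj n X m ?y i) - (real n - real m) * \<sigma>\<^sup>2
      = sqn n g + 2 * ipn n g ?\<epsilon> + centred_quad (\<lambda>i j. if i = j then 1 else 0) (\<sigma>\<^sup>2) n ?\<epsilon>
        - (\<Sum>l\<in>{1..m}. excess x l)"
    unfolding 1 2 3 4 5 by (simp add: algebra_simps)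
qed

text \<open>Squaring four summands costs the factor 4: squared bias \<open>T\<^sup>2\<close>, the
  linear form with \<open>4 * \<sigma>\<^sup>2 * T\<close>, and two quadratic forms of order
  \<open>n\<close> each.\<close>

lemma variance_estimator_mse:
  assumes f: "sqn n f = (\<Sum>l\<in>{1..p}. (signal_coef l)\<^sup>2)" and m: "m \<le> p" and mn: "m < n"
  defines "s \<equiv> \<lambda>x. sqn n (\<lambda>i. noisy n f \<epsilon> x i - proj n X m (noisy n f \<epsilon> x) i) / (real n - real m)"
    and "T \<equiv> \<Sum>l\<in>{m + 1..p}. (signal_coef l)\<^sup>2"
  shows "square_integrable M (\<lambda>x. s x - \<sigma>\<^sup>2)"
    and "(\<integral>x. (s x - \<sigma>\<^sup>2)\<^sup>2 \<partial>M)
      \<le> 4 * (T\<^sup>2 + 4 * \<sigma>\<^sup>2 * T + 2 * quad_const * real n) / (real n - real m)\<^sup>2"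
proof -
  define g where "g = (\<lambda>i. f i - (\<Sum>l\<in>{1..m}. signal_coef l * phi n X l i))"
  define Z where "Z x = ipn n g (\<lambda>i. \<epsilon> i x)" for x
  define U where "U x = centred_quad (\<lambda>i j. if i = j then 1 else 0) (\<sigma>\<^sup>2) n (\<lambda>i. \<epsilon> i x)" for x
  define V where "V x = (\<Sum>l\<in>{1..m}. excess x l)" for x
  define d where "d = real n - real m"
  have d: "0 < d" using mn by (simp add: d_def)
  note ve = variance_estimator_eq[OF f m, folded g_def]
  have gT: "sqn n g = T" unfolding T_def by (rule ve)
  have s_eq: "s x - \<sigma>\<^sup>2 = (1 / d) * (T + 2 * Z x + U x - V x)" for x
  proof -
    have "s x - \<sigma>\<^sup>2 = (sqn n (\<lambda>i. noisy n f \<epsilon> x i - proj n X m (noisy n f \<epsilon> x) i) - d * \<sigma>\<^sup>2) / d"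
      using d by (simp add: s_def d_def[symmetric] diff_divide_distrib)
    then show ?thesis unfolding d_def ve(2) gT Z_def U_def V_def by simp
  qed
  have mp: "{1..m} \<subseteq> {1..p}" using m by auto
  have sqi: "square_integrable M Z" "square_integrable M U" "square_integrable M V"
    unfolding Z_def[abs_def] U_def[abs_def] V_def[abs_def]
    by (rule ipn_noise_sqint, rule centred_quad_sqint, rule excess_sum_sqint[OF mp])
  show s_sqi: "square_integrable M (\<lambda>x. s x - \<sigma>\<^sup>2)"
    unfolding s_eq by (intro square_integrable_scale square_integrable_diff square_integrable_add
        square_integrable_const sqi)
  have EZ: "(\<integral>x. (Z x)\<^sup>2 \<partial>M) = \<sigma>\<^sup>2 * T" unfolding Z_def ipn_noise_second_moment gT ..
  have "(\<Sum>i<n. \<Sum>j<n. (if i = j then 1 else 0 :: real)\<^sup>2) = real n"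
  proof -
    have "(\<Sum>i<n. \<Sum>j<n. (if i = j then 1 else 0 :: real)\<^sup>2) = (\<Sum>i<n. \<Sum>j<n. if i = j then 1 else 0)"
      by (intro sum.cong) auto
    also have "\<dots> = (\<Sum>i<n. 1)" by (intro sum.cong) auto
    finally show ?thesis by simp
  qed
  then have EU: "(\<integral>x. (U x)\<^sup>2 \<partial>M) \<le> quad_const * real n"
    using conjunct2[OF centred_quad_moments[of "\<lambda>i j. if i = j then 1 else 0" n]]
    unfolding U_def quad_const_def by auto
  have EV: "(\<integral>x. (V x)\<^sup>2 \<partial>M) \<le> quad_const * real n"
  proof -
    have "(\<integral>x. (V x)\<^sup>2 \<partial>M) \<le> quad_const * real m"
      using excess_sum_second_moment[OF mp] by (simp add: V_def)
    also have "\<dots> \<le> quad_const * real n" using mn quad_const_nonneg by (intro mult_left_mono) auto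
    finally show ?thesis .
  qed
  have sq4: "(a + b + c - e)\<^sup>2 \<le> 4 * (a\<^sup>2 + b\<^sup>2 + c\<^sup>2 + e\<^sup>2)" for a b c e :: real
    using zero_le_power2[of "a - b"] zero_le_power2[of "a - c"] zero_le_power2[of "a + e"]
      zero_le_power2[of "b - c"] zero_le_power2[of "b + e"] zero_le_power2[of "c + e"]
    by (simp add: power2_eq_square algebra_simps)
  have "(\<integral>x. (s x - \<sigma>\<^sup>2)\<^sup>2 \<partial>M)
      \<le> (\<integral>x. (1 / d\<^sup>2) * (4 * (T\<^sup>2 + 4 * (Z x)\<^sup>2 + (U x)\<^sup>2 + (V x)\<^sup>2)) \<partial>M)"
  proof (rule integral_mono)
    show "integrable M (\<lambda>x. (s x - \<sigma>\<^sup>2)\<^sup>2)" by (rule square_integrableD[OF s_sqi])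
    show "integrable M (\<lambda>x. (1 / d\<^sup>2) * (4 * (T\<^sup>2 + 4 * (Z x)\<^sup>2 + (U x)\<^sup>2 + (V x)\<^sup>2)))"
      using square_integrableD(2)[OF sqi(1)] square_integrableD(2)[OF sqi(2)] square_integrableD(2)[OF sqi(3)]
      by simp
    fix x
    have "(s x - \<sigma>\<^sup>2)\<^sup>2 = (1 / d\<^sup>2) * (T + 2 * Z x + U x - V x)\<^sup>2"
      unfolding s_eq by (simp add: power_mult_distrib power_divide)
    also have "\<dots> \<le> (1 / d\<^sup>2) * (4 * (T\<^sup>2 + (2 * Z x)\<^sup>2 + (U x)\<^sup>2 + (V x)\<^sup>2))"
      by (intro mult_left_mono sq4) simp
    finally show "(s x - \<sigma>\<^sup>2)\<^sup>2 \<le> (1 / d\<^sup>2) * (4 * (T\<^sup>2 + 4 * (Z x)\<^sup>2 + (U x)\<^sup>2 + (V x)\<^sup>2))"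
      by (simp add: power_mult_distrib)
  qed
  also have "\<dots> = (1 / d\<^sup>2) * (4 * (T\<^sup>2 + 4 * (\<integral>x. (Z x)\<^sup>2 \<partial>M) + (\<integral>x. (U x)\<^sup>2 \<partial>M) + (\<integral>x. (V x)\<^sup>2 \<partial>M)))"
    using square_integrableD(2)[OF sqi(1)] square_integrableD(2)[OF sqi(2)] square_integrableD(2)[OF sqi(3)]
    by (simp add: prob_space)
  also have "\<dots> \<le> (1 / d\<^sup>2) * (4 * (T\<^sup>2 + 4 * (\<sigma>\<^sup>2 * T) + quad_const * real n + quad_const * real n))"
    using EU EV by (intro mult_left_mono add_mono) (auto simp: EZ)
  also have "\<dots> = 4 * (T\<^sup>2 + 4 * \<sigma>\<^sup>2 * T + 2 * quad_const * real n) / (real n - real m)\<^sup>2"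
    by (simp add: d_def)
  finally show "(\<integral>x. (s x - \<sigma>\<^sup>2)\<^sup>2 \<partial>M)
      \<le> 4 * (T\<^sup>2 + 4 * \<sigma>\<^sup>2 * T + 2 * quad_const * real n) / (real n - real m)\<^sup>2" .
qed

text \<open>\<open>m \<le> \<kappa> n\<close> keeps the denominator of order \<open>n\<close>, and
  \<open>T\<close> is \<open>n\<close> times the tail sum \<open>\<Theta>\<close>. The mixed term
  \<open>\<Theta> / n\<close> is at most \<open>\<Theta>\<^sup>2 + 1 / n\<^sup>2\<close>, hence at
  most twice the maximum.\<close>

lemma variance_estimator_mse_le:
  assumes f: "sqn n f = (\<Sum>l\<in>{1..p}. (signal_coef l)\<^sup>2)" and m: "m \<le> p"
    and \<kappa>: "real m \<le> \<kappa> * real n" "\<kappa> < 1"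
  shows "(\<integral>x. (sqn n (\<lambda>i. noisy n f \<epsilon> x i - proj n X m (noisy n f \<epsilon> x) i) / (real n - real m) - \<sigma>\<^sup>2)\<^sup>2 \<partial>M)
    \<le> 4 * (1 + 8 * \<sigma>\<^sup>2 + 2 * quad_const) / (1 - \<kappa>)\<^sup>2
      * max (1 / real n) ((\<Sum>l\<in>{m + 1..p}. (theta n X f l)\<^sup>2)\<^sup>2)"
proof -
  define T where "T = (\<Sum>l\<in>{m + 1..p}. (signal_coef l)\<^sup>2)"
  define \<Theta> where "\<Theta> = (\<Sum>l\<in>{m + 1..p}. (theta n X f l)\<^sup>2)"
  define B where "B = max (1 / real n) (\<Theta>\<^sup>2)"
  have n: "0 < real n" using n_pos by simp
  have T: "T = real n * \<Theta>"
    unfolding T_def \<Theta>_def sum_distrib_left using n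
    by (intro sum.cong refl) (simp add: theta_def signal_coef_def power_divide)
  have gap: "(1 - \<kappa>) * real n \<le> real n - real m" using \<kappa>(1) by (simp add: left_diff_distrib)
  have gap0: "0 < (1 - \<kappa>) * real n" using \<kappa>(2) n by simp
  have mn: "m < n" using gap gap0 by simp
  have B: "1 / real n \<le> B" "\<Theta>\<^sup>2 \<le> B" by (auto simp: B_def)
  have "\<Theta> / real n \<le> \<Theta>\<^sup>2 + (1 / real n)\<^sup>2"
  proof -
    have "2 * (\<Theta> * (1 / real n)) \<le> \<Theta>\<^sup>2 + (1 / real n)\<^sup>2"
      using sum_squares_bound[of \<Theta> "1 / real n"] by (simp only: mult.assoc)
    moreover have "0 \<le> \<Theta> * (1 / real n)" by (simp add: \<Theta>_def sum_nonneg)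
    ultimately show ?thesis by simp
  qed
  also have "(1 / real n)\<^sup>2 \<le> 1 / real n"
    using n_pos mult_left_mono[of "1 / real n" 1 "1 / real n"] by (simp add: power2_eq_square)
  finally have \<Theta>n: "\<Theta> / real n \<le> 2 * B" using B by simp
  have "(\<integral>x. (sqn n (\<lambda>i. noisy n f \<epsilon> x i - proj n X m (noisy n f \<epsilon> x) i) / (real n - real m) - \<sigma>\<^sup>2)\<^sup>2 \<partial>M)
      \<le> 4 * (T\<^sup>2 + 4 * \<sigma>\<^sup>2 * T + 2 * quad_const * real n) / (real n - real m)\<^sup>2"
    unfolding T_def by (rule variance_estimator_mse(2)[OF f m mn])
  also have "\<dots> \<le> 4 * (T\<^sup>2 + 4 * \<sigma>\<^sup>2 * T + 2 * quad_const * real n) / ((1 - \<kappa>) * real n)\<^sup>2"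
  proof (rule divide_left_mono)
    show "((1 - \<kappa>) * real n)\<^sup>2 \<le> (real n - real m)\<^sup>2" using gap gap0 by (intro power_mono) auto
    show "0 \<le> 4 * (T\<^sup>2 + 4 * \<sigma>\<^sup>2 * T + 2 * quad_const * real n)"
      using quad_const_nonneg by (intro mult_nonneg_nonneg add_nonneg_nonneg) (auto simp: T_def sum_nonneg)
    show "0 < (real n - real m)\<^sup>2 * ((1 - \<kappa>) * real n)\<^sup>2"
      using mn n \<kappa>(2) by (intro mult_pos_pos zero_less_power) auto
  qed
  also have "\<dots> = 4 / (1 - \<kappa>)\<^sup>2 * (\<Theta>\<^sup>2 + 4 * \<sigma>\<^sup>2 * (\<Theta> / real n) + 2 * quad_const * (1 / real n))"
  proof -
    have "T\<^sup>2 + 4 * \<sigma>\<^sup>2 * T + 2 * quad_const * real n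
        = (real n)\<^sup>2 * (\<Theta>\<^sup>2 + 4 * \<sigma>\<^sup>2 * (\<Theta> / real n) + 2 * quad_const * (1 / real n))"
      using n by (simp add: T power2_eq_square distrib_left)
    then show ?thesis using n by (simp add: power_mult_distrib)
  qed
  also have "\<dots> \<le> 4 / (1 - \<kappa>)\<^sup>2 * (B + 4 * \<sigma>\<^sup>2 * (2 * B) + 2 * quad_const * B)"
    using B \<Theta>n quad_const_nonneg by (intro mult_left_mono add_mono) auto
  also have "\<dots> = 4 * (1 + 8 * \<sigma>\<^sup>2 + 2 * quad_const) / (1 - \<kappa>)\<^sup>2 * B"
    by (simp add: algebra_simps add_divide_distrib)
  finally show ?thesis by (simp only: B_def \<Theta>_def)
qed

end

section \<open>The set of all nested models\<close>

lemma varphi_nonneg: "0 \<le> varphi th p"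
  by (auto simp: varphi_def Let_def intro!: sum_nonneg divide_nonneg_nonneg)

lemma sum_inverse_le_ln:
  assumes "1 \<le> p"
  shows "(\<Sum>j\<in>{1..p}. 1 / real j) \<le> 1 + ln (real p)"
  using assms
proof (induction p rule: dec_induct)
  case (step p)
  have p: "0 < real p" using step by simp
  have "ln (real p / real (Suc p)) \<le> real p / real (Suc p) - 1" using p by (intro ln_le_minus_one) simp
  also have "\<dots> = - (1 / real (Suc p))" by (simp add: field_simps)
  finally have "1 / real (Suc p) \<le> ln (real (Suc p)) - ln (real p)" using p by (simp add: ln_div)
  then show ?case using step by simp
qed simp

text \<open>With unit steps the size ratios form a harmonic sum, and consecutive tails differ by one
  squared coefficient, which gives \<open>varphi\<close> over 4. The additive 1 covers
  \<open>p = 1\<close>, where the logarithm is 0; for \<open>p \<ge> 2\<close> the bound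
  \<open>ln p \<ge> 2/3\<close> absorbs all constants.\<close>

lemma psi_all_models_le:
  assumes p: "1 \<le> p"
  shows "psi th id p \<le> 1 + 14 * ((ln (real p) + varphi th p) * (ln (real p))\<^sup>2)"
proof -
  define L where "L = ln (real p)"
  define P where "P = (\<Sum>j\<in>{1..<p}. 1 / (4 * real j))"
  have L0: "0 \<le> L" using p by (simp add: L_def)
  have kk: "(if j = 0 then 0 else id j) = j" for j :: nat by simp
  have T: "(\<Sum>l\<in>{j - 1 + 1..p}. (th l)\<^sup>2) - (\<Sum>l\<in>{j + 1..p}. (th l)\<^sup>2) = (th j)\<^sup>2"
    if "1 \<le> j" "j \<le> p" for j
    using that by (simp add: sum.atLeast_Suc_atMost)
  define p' where "p' = (LEAST j. 1 \<le> j \<and> j \<le> p \<and> (\<Sum>l\<in>{j + 1..p}. (th l)\<^sup>2) = 0)"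
  have p': "p' \<le> p" unfolding p'_def by (rule Least_le) (use p in auto)
  have phi: "(\<Sum>j\<in>{1..<p'}. ((\<Sum>l\<in>{j - 1 + 1..p}. (th l)\<^sup>2) - (\<Sum>l\<in>{j + 1..p}. (th l)\<^sup>2))
      / (4 * (\<Sum>l\<in>{j + 1..p}. (th l)\<^sup>2))) = varphi th p / 4"
    unfolding varphi_def Let_def p'_def[symmetric] sum_divide_distrib using p'
    by (intro sum.cong refl, subst T) auto
  have P: "(\<Sum>j\<in>{1..<p}. real (Suc j - j) / (4 * real j)) = P" by (simp add: P_def)
  have eq: "psi th id p = min (real p) (1 + P + varphi th p / 4) * (1 + L)\<^sup>2"
    unfolding psi_def Let_def kk p'_def[symmetric] phi P L_def ..
  have P_le: "P \<le> (1 + L) / 4"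
  proof -
    have "P = (\<Sum>j\<in>{1..<p}. 1 / real j) / 4" unfolding P_def sum_divide_distrib by (simp add: mult.commute)
    moreover have "(\<Sum>j\<in>{1..<p}. 1 / real j) \<le> (\<Sum>j\<in>{1..p}. 1 / real j)" by (intro sum_mono2) auto
    ultimately show ?thesis using sum_inverse_le_ln[OF p] by (simp add: L_def)
  qed
  have v0: "0 \<le> varphi th p" by (rule varphi_nonneg)
  show ?thesis
  proof (cases "p = 1")
    case True
    then show ?thesis unfolding eq by (simp add: L_def)
  next
    case False
    then have "ln 2 \<le> L" using p by (simp add: L_def)
    then have L: "2/3 \<le> L" using ln2_ge_two_thirds by linarith
    have "psi th id p \<le> (1 + P + varphi th p / 4) * (1 + L)\<^sup>2"
      unfolding eq by (intro mult_right_mono) auto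
    \<comment> \<open>From \<open>L \<ge> 2/3\<close>: \<open>5/4 \<le> 15/8 * L\<close>, which with
      the \<open>L/4\<close> in \<open>P\<close> gives 17/8, and \<open>1 + L \<le> 5/2 * L\<close>.
      The product of constants, 425/32, is below 14.\<close>
    also have "\<dots> \<le> (17/8 * (L + varphi th p)) * (5/2 * L)\<^sup>2"
      using P_le L v0 by (intro mult_mono power_mono) (auto simp: P_def intro!: sum_nonneg)
    also have "\<dots> \<le> 14 * ((L + varphi th p) * L\<^sup>2)"
    proof -
      have "0 \<le> (L + varphi th p) * L\<^sup>2" using L0 v0 by simp
      moreover have "17/8 * (L + varphi th p) * (5/2 * L)\<^sup>2 = 425/32 * ((L + varphi th p) * L\<^sup>2)"
        by (simp add: power2_eq_square)
      ultimately show ?thesis by linarith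
    qed
    finally show ?thesis by (simp add: L_def)
  qed
qed

text \<open>The largest model has size \<open>p n \<le> n\<close>, so the condition on the variance
  estimator reduces to \<open>n\<close> times the bound of \<open>variance_estimator_mse_le\<close>,
  which the tail assumption controls.\<close>

lemma (in noise_model) mma_all_models_asymptotically_optimal:
  fixes p :: "nat \<Rightarrow> nat" and X :: "nat \<Rightarrow> nat \<Rightarrow> nat \<Rightarrow> real" and \<beta> :: "nat \<Rightarrow> nat \<Rightarrow> real" and \<kappa> :: real
  assumes design: "\<And>n. 1 \<le> n \<Longrightarrow> p n \<le> n \<and> full_col_rank n (p n) (X n)"
  defines "f \<equiv> \<lambda>n. fvec n (p n) (X n) (\<beta> n)"
    and "m \<equiv> \<lambda>n. min (nat \<lfloor>\<kappa> * real n\<rfloor>) (p n)"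
  defines "sh \<equiv> \<lambda>n y. sqn n (\<lambda>i. y i - proj n (X n) (m n) y i) / (real n - real (m n))"
  assumes \<kappa>: "0 < \<kappa>" "\<kappa> < 1"
    and what: "\<And>n y. 1 \<le> n \<Longrightarrow> what n y \<in> wsimplex (p n)"
      "\<And>n y w. 1 \<le> n \<Longrightarrow> w \<in> wsimplex (p n) \<Longrightarrow>
        mma_crit n (X n) id (p n) (sh n y) y (what n y) \<le> mma_crit n (X n) id (p n) (sh n y) y w"
    and tail: "(\<lambda>n. max (1 / real n) ((\<Sum>l\<in>{m n + 1..p n}. (theta n (X n) (f n) l)\<^sup>2)\<^sup>2))
      \<in> o(\<lambda>n. opt_risk M \<epsilon> n (X n) id (p n) (f n))"
    and growth: "(\<lambda>n. (ln (real (p n)) + varphi (theta n (X n) (f n)) (p n)) * (ln (real (p n)))\<^sup>2)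
      \<in> o(\<lambda>n. real n * opt_risk M \<epsilon> n (X n) id (p n) (f n))"
  shows "\<exists>a. a \<longlonglongrightarrow> 0 \<and> (\<forall>\<^sub>F n in sequentially.
      Q_loss M \<epsilon> n (X n) id (p n) (f n) (what n) \<le> (1 + a n) * opt_risk M \<epsilon> n (X n) id (p n) (f n)
    \<and> Q_risk M \<epsilon> n (X n) id (p n) (f n) (what n) \<le> (1 + a n) * opt_risk M \<epsilon> n (X n) id (p n) (f n))"
proof (rule mma_asymptotically_optimal[where k="\<lambda>_. id" and sh=sh])
  let ?R = "\<lambda>n. opt_risk M \<epsilon> n (X n) id (p n) (f n)"
  let ?B = "\<lambda>n. max (1 / real n) ((\<Sum>l\<in>{m n + 1..p n}. (theta n (X n) (f n) l)\<^sup>2)\<^sup>2)"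
  let ?\<Phi> = "\<lambda>n. (ln (real (p n)) + varphi (theta n (X n) (f n)) (p n)) * (ln (real (p n)))\<^sup>2"
  let ?V = "\<lambda>n. \<integral>x. (sh n (noisy n (f n) \<epsilon> x) - \<sigma>\<^sup>2)\<^sup>2 \<partial>M"
  \<comment> \<open>With \<open>p n = 0\<close> the simplex would be empty, as the empty sum is 0
    and not 1; so the existence of selected weights forces \<open>p n \<ge> 1\<close>.\<close>
  have p1: "1 \<le> p n" if "1 \<le> n" for n
    using what(1)[OF that, of "\<lambda>_. 0"] by (cases "p n") (auto simp: wsimplex_def)
  have reg: "regression_model M \<epsilon> \<sigma> n (p n) (X n)" if "1 \<le> n" for n
    using design[OF that] that by unfold_locales auto
  show nested: "nested_model M \<epsilon> \<sigma> n (p n) (X n) id (p n)" if n: "1 \<le> n" for n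
    using reg[OF n] p1[OF n] by (auto intro!: nested_model.intro nested_model_axioms.intro simp: strict_mono_on_def)
  have m: "m n \<le> p n" "real (m n) \<le> \<kappa> * real n" for n
  proof -
    have "real (nat \<lfloor>\<kappa> * real n\<rfloor>) \<le> \<kappa> * real n" using \<kappa> by (simp add: of_nat_floor)
    moreover have "real (m n) \<le> real (nat \<lfloor>\<kappa> * real n\<rfloor>)" by (simp add: m_def)
    ultimately show "real (m n) \<le> \<kappa> * real n" by linarith
  qed (simp add: m_def)
  have mn: "m n < n" if "1 \<le> n" for n
  proof -
    have "\<kappa> * real n < 1 * real n" using \<kappa> that by (intro mult_strict_right_mono) auto
    then show ?thesis using m(2)[of n] by simp
  qed
  have span: "sqn n (f n) = (\<Sum>l\<in>{1..p n}. (ipn n (phi n (X n) l) (f n))\<^sup>2)" if "1 \<le> n" for n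
    unfolding f_def by (rule sqn_fvec_eq) (use design[OF that] in blast)
  show "\<forall>\<^sub>F n in sequentially. integrable M (\<lambda>x. (sh n (noisy n (f n) \<epsilon> x) - \<sigma>\<^sup>2)\<^sup>2)"
    using eventually_ge_at_top[of 1]
  proof eventually_elim
    case (elim n)
    interpret regression_model M \<epsilon> \<sigma> n "p n" "X n" "f n" by (rule reg[OF elim])
    show ?case unfolding sh_def
      by (rule square_integrableD(2)[OF variance_estimator_mse(1)[OF _ m(1) mn[OF elim]]])
        (simp add: span[OF elim] signal_coef_def)
  qed
  show "what n y \<in> wsimplex (p n)" if "1 \<le> n" for n y by (rule what(1)[OF that])
  show "mma_crit n (X n) id (p n) (sh n y) y (what n y) \<le> mma_crit n (X n) id (p n) (sh n y) y w"
    if "1 \<le> n" "w \<in> wsimplex (p n)" for n y w by (rule what(2)[OF that])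
  define C where "C = 4 * (1 + 8 * \<sigma>\<^sup>2 + 2 * quad_const) / (1 - \<kappa>)\<^sup>2"
  have C0: "0 \<le> C" using quad_const_nonneg by (simp add: C_def)
  have nB: "(\<lambda>n. real n * ?B n) \<in> o(\<lambda>n. real n * ?R n)" by (rule landau_o.small.mult_left[OF tail])
  have "(\<lambda>n. real (p n) * ?V n) \<in> O(\<lambda>n. real n * ?B n)"
  proof (rule bigoI[where c=C])
    show "\<forall>\<^sub>F n in sequentially. norm (real (p n) * ?V n) \<le> C * norm (real n * ?B n)"
      using eventually_ge_at_top[of 1]
    proof eventually_elim
      case (elim n)
      interpret regression_model M \<epsilon> \<sigma> n "p n" "X n" "f n" by (rule reg[OF elim])
      have V: "?V n \<le> C * ?B n" unfolding sh_def C_def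
        by (rule variance_estimator_mse_le[OF _ m \<kappa>(2)]) (simp add: span[OF elim] signal_coef_def)
      have "real (p n) * ?V n \<le> real n * (C * ?B n)"
        using V design[OF elim] by (intro mult_mono) auto
      moreover have "0 \<le> ?B n" by (simp add: le_max_iff_disj)
      ultimately show ?case by (simp add: abs_mult mult_ac)
    qed
  qed
  then show "(\<lambda>n. real (id (p n)) * ?V n) \<in> o(\<lambda>n. real n * ?R n)"
    using nB by (simp add: landau_o.big_small_trans)
  \<comment> \<open>Since 1/n is negligible against the optimal risk, \<open>n\<close> times that
    risk dominates constants; this absorbs the additive 1 in the bound on
    \<open>psi\<close>.\<close>
  have one: "(\<lambda>n. 1) \<in> o(\<lambda>n. real n * ?R n)"
  proof (rule landau_o.big_small_trans[OF _ nB], rule bigoI[where c=1])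
    show "\<forall>\<^sub>F n in sequentially. norm (1::real) \<le> 1 * norm (real n * ?B n)"
      using eventually_ge_at_top[of 1]
    proof eventually_elim
      case (elim n)
      have "real n * (1 / real n) \<le> real n * ?B n" by (intro mult_left_mono) auto
      then show ?case using elim by simp
    qed
  qed
  have "(\<lambda>n. psi (theta n (X n) (f n)) id (p n)) \<in> O(\<lambda>n. 1 + 14 * ?\<Phi> n)"
  proof (rule bigoI[where c=1])
    show "\<forall>\<^sub>F n in sequentially. norm (psi (theta n (X n) (f n)) id (p n)) \<le> 1 * norm (1 + 14 * ?\<Phi> n)"
      using eventually_ge_at_top[of 1]
    proof eventually_elim
      case (elim n)
      interpret nested_model M \<epsilon> \<sigma> n "p n" "X n" "f n" id "p n" by (rule nested[OF elim])
      show ?case using psi_nonneg psi_all_models_le[OF p1[OF elim], of "theta n (X n) (f n)"] by simp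
    qed
  qed
  moreover have "(\<lambda>n. 1 + 14 * ?\<Phi> n) \<in> o(\<lambda>n. real n * ?R n)"
    using one growth by (intro sum_in_smallo) simp_all
  ultimately show "(\<lambda>n. psi (theta n (X n) (f n)) id (p n)) \<in> o(\<lambda>n. real n * ?R n)"
    by (rule landau_o.big_small_trans)
qed

theorem theorem2:
  fixes M :: "'a measure" and \<epsilon> :: "nat \<Rightarrow> 'a \<Rightarrow> real" and \<sigma> :: real
    and p :: "nat \<Rightarrow> nat" and X :: "nat \<Rightarrow> nat \<Rightarrow> nat \<Rightarrow> real" and \<beta> :: "nat \<Rightarrow> nat \<Rightarrow> real"
  assumes noise: "iid_noise M \<epsilon> \<sigma>"
    and design: "\<forall>n\<ge>1. p n \<le> n \<and> full_col_rank n (p n) (X n)"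
    and A1: "\<exists>C. \<forall>\<^sub>F n in sequentially. sqn n (fvec n (p n) (X n) (\<beta> n)) / real n \<le> C"
  shows
   "(\<forall>(k :: nat \<Rightarrow> nat \<Rightarrow> nat) (Mn :: nat \<Rightarrow> nat)
        (sh :: nat \<Rightarrow> (nat \<Rightarrow> real) \<Rightarrow> real) (what :: nat \<Rightarrow> (nat \<Rightarrow> real) \<Rightarrow> nat \<Rightarrow> real).
      (\<forall>n\<ge>1. 1 \<le> Mn n \<and> 1 \<le> k n 1 \<and> strict_mono_on {1..Mn n} (k n) \<and> k n (Mn n) \<le> p n)
      \<and> (\<forall>n. (\<lambda>x. sh n (noisy n (fvec n (p n) (X n) (\<beta> n)) \<epsilon> x)) \<in> borel_measurable M)
      \<and> (\<forall>\<^sub>F n in sequentially.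
           integrable M (\<lambda>x. (sh n (noisy n (fvec n (p n) (X n) (\<beta> n)) \<epsilon> x) - \<sigma>^2)^2))
      \<and> (\<forall>n\<ge>1. \<forall>y. what n y \<in> wsimplex (Mn n) \<and>
           (\<forall>w\<in>wsimplex (Mn n). mma_crit n (X n) (k n) (Mn n) (sh n y) y (what n y)
                                 \<le> mma_crit n (X n) (k n) (Mn n) (sh n y) y w))
      \<and> (\<forall>n m. (\<lambda>x. what n (noisy n (fvec n (p n) (X n) (\<beta> n)) \<epsilon> x) m) \<in> borel_measurable M)
      \<and> (\<lambda>n. real (k n (Mn n)) *
            (\<integral>x. (sh n (noisy n (fvec n (p n) (X n) (\<beta> n)) \<epsilon> x) - \<sigma>^2)^2 \<partial>M))
          \<in> o(\<lambda>n. real n * opt_risk M \<epsilon> n (X n) (k n) (Mn n) (fvec n (p n) (X n) (\<beta> n)))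
      \<and> (\<lambda>n. psi (theta n (X n) (fvec n (p n) (X n) (\<beta> n))) (k n) (Mn n))
          \<in> o(\<lambda>n. real n * opt_risk M \<epsilon> n (X n) (k n) (Mn n) (fvec n (p n) (X n) (\<beta> n)))
      \<longrightarrow> (\<exists>a. a \<longlonglongrightarrow> 0 \<and> (\<forall>\<^sub>F n in sequentially.
             Q_loss M \<epsilon> n (X n) (k n) (Mn n) (fvec n (p n) (X n) (\<beta> n)) (what n)
               \<le> (1 + a n) * opt_risk M \<epsilon> n (X n) (k n) (Mn n) (fvec n (p n) (X n) (\<beta> n))
           \<and> Q_risk M \<epsilon> n (X n) (k n) (Mn n) (fvec n (p n) (X n) (\<beta> n)) (what n)
               \<le> (1 + a n) * opt_risk M \<epsilon> n (X n) (k n) (Mn n) (fvec n (p n) (X n) (\<beta> n)))))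
   \<and>
    (\<forall>(\<kappa> :: real) (what :: nat \<Rightarrow> (nat \<Rightarrow> real) \<Rightarrow> nat \<Rightarrow> real).
      let mm = (\<lambda>n. min (nat \<lfloor>\<kappa> * real n\<rfloor>) (p n));
          sh = (\<lambda>n y. sqn n (\<lambda>i. y i - proj n (X n) (mm n) y i) / (real n - real (mm n)))
      in
      0 < \<kappa> \<and> \<kappa> < 1
      \<and> (\<forall>n\<ge>1. \<forall>y. what n y \<in> wsimplex (p n) \<and>
           (\<forall>w\<in>wsimplex (p n). mma_crit n (X n) id (p n) (sh n y) y (what n y)
                                 \<le> mma_crit n (X n) id (p n) (sh n y) y w))
      \<and> (\<forall>n m. (\<lambda>x. what n (noisy n (fvec n (p n) (X n) (\<beta> n)) \<epsilon> x) m) \<in> borel_measurable M)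
      \<and> (\<lambda>n. max (1 / real n)
               ((\<Sum>l\<in>{mm n + 1..p n}. (theta n (X n) (fvec n (p n) (X n) (\<beta> n)) l)^2)^2))
          \<in> o(\<lambda>n. opt_risk M \<epsilon> n (X n) id (p n) (fvec n (p n) (X n) (\<beta> n)))
      \<and> (\<lambda>n. (ln (real (p n)) + varphi (theta n (X n) (fvec n (p n) (X n) (\<beta> n))) (p n))
               * (ln (real (p n)))^2)
          \<in> o(\<lambda>n. real n * opt_risk M \<epsilon> n (X n) id (p n) (fvec n (p n) (X n) (\<beta> n)))
      \<longrightarrow> (\<exists>a. a \<longlonglongrightarrow> 0 \<and> (\<forall>\<^sub>F n in sequentially.
             Q_loss M \<epsilon> n (X n) id (p n) (fvec n (p n) (X n) (\<beta> n)) (what n)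
               \<le> (1 + a n) * opt_risk M \<epsilon> n (X n) id (p n) (fvec n (p n) (X n) (\<beta> n))
           \<and> Q_risk M \<epsilon> n (X n) id (p n) (fvec n (p n) (X n) (\<beta> n)) (what n)
               \<le> (1 + a n) * opt_risk M \<epsilon> n (X n) id (p n) (fvec n (p n) (X n) (\<beta> n)))))"
proof -
  interpret noise_model M \<epsilon> \<sigma> using noise by unfold_locales
  let ?f = "\<lambda>n. fvec n (p n) (X n) (\<beta> n)"
  have part1: "\<exists>a. a \<longlonglongrightarrow> 0 \<and> (\<forall>\<^sub>F n in sequentially.
        Q_loss M \<epsilon> n (X n) (k n) (Mn n) (?f n) (what n) \<le> (1 + a n) * opt_risk M \<epsilon> n (X n) (k n) (Mn n) (?f n)
      \<and> Q_risk M \<epsilon> n (X n) (k n) (Mn n) (?f n) (what n) \<le> (1 + a n) * opt_risk M \<epsilon> n (X n) (k n) (Mn n) (?f n))"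
    if sizes: "\<forall>n\<ge>1. 1 \<le> Mn n \<and> 1 \<le> k n 1 \<and> strict_mono_on {1..Mn n} (k n) \<and> k n (Mn n) \<le> p n"
      and "\<forall>\<^sub>F n in sequentially. integrable M (\<lambda>x. (sh n (noisy n (?f n) \<epsilon> x) - \<sigma>^2)^2)"
      and weights: "\<forall>n\<ge>1. \<forall>y. what n y \<in> wsimplex (Mn n) \<and> (\<forall>w\<in>wsimplex (Mn n).
        mma_crit n (X n) (k n) (Mn n) (sh n y) y (what n y) \<le> mma_crit n (X n) (k n) (Mn n) (sh n y) y w)"
      and "(\<lambda>n. real (k n (Mn n)) * (\<integral>x. (sh n (noisy n (?f n) \<epsilon> x) - \<sigma>^2)^2 \<partial>M))
          \<in> o(\<lambda>n. real n * opt_risk M \<epsilon> n (X n) (k n) (Mn n) (?f n))"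
      and "(\<lambda>n. psi (theta n (X n) (?f n)) (k n) (Mn n))
          \<in> o(\<lambda>n. real n * opt_risk M \<epsilon> n (X n) (k n) (Mn n) (?f n))"
    for k Mn sh what
  proof (rule mma_asymptotically_optimal[where sh=sh and p=p and f="?f"])
    fix n :: nat assume n: "1 \<le> n"
    have "regression_model M \<epsilon> \<sigma> n (p n) (X n)"
      by unfold_locales (use design n in blast)+
    then show "nested_model M \<epsilon> \<sigma> n (p n) (X n) (k n) (Mn n)"
      using mp[OF spec[OF sizes] n] by (auto intro!: nested_model.intro nested_model_axioms.intro)
    show "what n y \<in> wsimplex (Mn n)" for y
      using conjunct1[OF spec[OF mp[OF spec[OF weights] n]]] .
    show "mma_crit n (X n) (k n) (Mn n) (sh n y) y (what n y) \<le> mma_crit n (X n) (k n) (Mn n) (sh n y) y w"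
      if "w \<in> wsimplex (Mn n)" for y w using bspec[OF conjunct2[OF spec[OF mp[OF spec[OF weights] n]]] that] .
  qed (rule that(2), rule that(4), rule that(5))
  show ?thesis
  proof (intro conjI allI impI, goal_cases)
    case (1 k Mn sh what)
    then show ?case
      by (elim conjE) (rule part1[of Mn k sh what])
  next
    case (2 \<kappa> what)
    show ?case unfolding Let_def
    proof (intro impI, elim conjE)
      assume "0 < \<kappa>" "\<kappa> < 1"
        and weights: "\<forall>n\<ge>1. \<forall>y. what n y \<in> wsimplex (p n) \<and> (\<forall>w\<in>wsimplex (p n).
          mma_crit n (X n) id (p n) (sqn n (\<lambda>i. y i - proj n (X n) (min (nat \<lfloor>\<kappa> * real n\<rfloor>) (p n)) y i)
            / (real n - real (min (nat \<lfloor>\<kappa> * real n\<rfloor>) (p n)))) y (what n y)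
          \<le> mma_crit n (X n) id (p n) (sqn n (\<lambda>i. y i - proj n (X n) (min (nat \<lfloor>\<kappa> * real n\<rfloor>) (p n)) y i)
            / (real n - real (min (nat \<lfloor>\<kappa> * real n\<rfloor>) (p n)))) y w)"
        and tail: "(\<lambda>n. max (1 / real n)
            ((\<Sum>l\<in>{min (nat \<lfloor>\<kappa> * real n\<rfloor>) (p n) + 1..p n}. (theta n (X n) (?f n) l)^2)^2))
          \<in> o(\<lambda>n. opt_risk M \<epsilon> n (X n) id (p n) (?f n))"
        and growth: "(\<lambda>n. (ln (real (p n)) + varphi (theta n (X n) (?f n)) (p n)) * (ln (real (p n)))^2)
          \<in> o(\<lambda>n. real n * opt_risk M \<epsilon> n (X n) id (p n) (?f n))"
      show "\<exists>a. a \<longlonglongrightarrow> 0 \<and> (\<forall>\<^sub>F n in sequentially.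
            Q_loss M \<epsilon> n (X n) id (p n) (?f n) (what n) \<le> (1 + a n) * opt_risk M \<epsilon> n (X n) id (p n) (?f n)
          \<and> Q_risk M \<epsilon> n (X n) id (p n) (?f n) (what n) \<le> (1 + a n) * opt_risk M \<epsilon> n (X n) id (p n) (?f n))"
      proof (rule mma_all_models_asymptotically_optimal[where p=p and X=X and \<beta>=\<beta> and \<kappa>=\<kappa> and what=what])
        fix n :: nat assume n: "1 \<le> n"
        show "p n \<le> n \<and> full_col_rank n (p n) (X n)" using design n by blast
        show "what n y \<in> wsimplex (p n)" for y
          using conjunct1[OF spec[OF mp[OF spec[OF weights] n]]] .
        fix y w assume w: "w \<in> wsimplex (p n)"
        show "mma_crit n (X n) id (p n) (sqn n (\<lambda>i. y i - proj n (X n) (min (nat \<lfloor>\<kappa> * real n\<rfloor>) (p n)) y i)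
            / (real n - real (min (nat \<lfloor>\<kappa> * real n\<rfloor>) (p n)))) y (what n y)
          \<le> mma_crit n (X n) id (p n) (sqn n (\<lambda>i. y i - proj n (X n) (min (nat \<lfloor>\<kappa> * real n\<rfloor>) (p n)) y i)
            / (real n - real (min (nat \<lfloor>\<kappa> * real n\<rfloor>) (p n)))) y w"
          using bspec[OF conjunct2[OF spec[OF mp[OF spec[OF weights] n]]] w] .
      qed (fact \<open>0 < \<kappa>\<close> \<open>\<kappa> < 1\<close> tail growth)+
    qed
  qed
qed

end
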